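(* Let $\mathcal L$ be an affine subspace of $\mathbb R^n$. Then: (a) if $\mathcal L$ is extremal and $\mathbf f:U\to\mathcal L$, where $U\subset\mathbb R^d$ is open, is a smooth map which is nondegenerate in $\mathcal L$, then $\mathbf f$ is extremal; (b) if $\mathcal L$ is not extremal, then every point of $\mathcal L$ is very well approximable (in particular, no subset of $\mathcal L$ of positive measure is extremal).
   Context: All norms on $\mathbb R^k$ are sup-norms $\|\mathbf x\|=\max_i|x_i|$. For $\mathbf y\in\mathbb R^n$ (a row vector) and $\mathbf q\in\mathbb Z^n$, $\mathbf y\mathbf q=\sum y_iq_i$. For $v>0$, $\mathcal W_v(1,n)$ is the set of $\mathbf y\in\mathbb R^n$ such that there are infinitely many $\mathbf q\in\mathbb Z^n$ with $|\mathbf y\mathbf q+p|\le\|\mathbf q\|^{-v}$ for some $p\in\mathbb Z$. A vector $\mathbf y$ is very well approximable (VWA) if $\mathbf y\in\mathcal W_v(1,n)$ for some $v>n$. A map $\mathbf f$ from an open subset $U\subset\mathbb R^d$ to $\mathbb R^n$ is extremal if $\mathbf f(\mathbf x)$ is not VWA for Lebesgue-a.e. $\mathbf x\in U$; a submanifold (e.g. an affine subspace) of $\mathbb R^n$ is extremal if almost every point of it (w.r.t. its natural Lebesgue measure class) is not VWA. If $\mathcal L$ is an affine subspace with linear part $\mathcal L_0$ (i.e. $\mathcal L=\mathcal L_0+\mathbf y$), a smooth map $\mathbf f:U\to\mathcal L$ is nondegenerate in $\mathcal L$ at $\mathbf x$ if for some $l$ the partial derivatives of $\mathbf f$ at $\mathbf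 x$ of orders $1,\dots,l$ span $\mathcal L_0$; $\mathbf f$ is nondegenerate in $\mathcal L$ if it is nondegenerate in $\mathcal L$ at Lebesgue-a.e. point of $U$. *)

theory Defs
  imports "HOL-Analysis.Analysis"
begin

definition supnorm_int :: "int ^ 'n \<Rightarrow> real" where
  "supnorm_int q = Max (range (\<lambda>i. \<bar>real_of_int (q $ i)\<bar>))"

definition ydotq :: "real ^ 'n \<Rightarrow> int ^ 'n \<Rightarrow> real" where
  "ydotq y q = (\<Sum>i\<in>UNIV. y $ i * real_of_int (q $ i))"

definition W_set :: "real \<Rightarrow> (real ^ 'n) set" where
  "W_set v = {y. infinite {q :: int ^ 'n. \<exists>p::int. \<bar>ydotq y q + real_of_int p\<bar> \<le> supnorm_int q powr (- v)}}"

definition VWA :: "real ^ 'n \<Rightarrow> bool" where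
  "VWA y \<longleftrightarrow> (\<exists>v > real CARD('n). y \<in> W_set v)"

definition extremal_map :: "(real ^ 'd \<Rightarrow> real ^ 'n) \<Rightarrow> (real ^ 'd) set \<Rightarrow> bool" where
  "extremal_map f U \<longleftrightarrow> (AE x in lborel. x \<in> U \<longrightarrow> \<not> VWA (f x))"

definition lin_part :: "(real ^ 'n) set \<Rightarrow> (real ^ 'n) set" where
  "lin_part L = {a - b | a b. a \<in> L \<and> b \<in> L}"

text \<open>Extremality of an affine subspace L w.r.t. its natural Lebesgue measure class.
  The measure class is realised by pushing forward Lebesgue measure along an affine
  parametrisation x \<mapsto> y + T x of L by a linear map T of R^n onto L_0
  (a set N in L is null iff its preimage is Lebesgue null).\<close>
definition extremal_affine :: "(real ^ 'n) set \<Rightarrow> bool" where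
  "extremal_affine L \<longleftrightarrow>
     (\<exists>y (T :: real ^ 'n \<Rightarrow> real ^ 'n). linear T \<and> L = (\<lambda>x. y + T x) ` UNIV \<and>
            (AE x in lborel. \<not> VWA (y + T x)))"

fun partial_iter :: "(real ^ 'd \<Rightarrow> real ^ 'n) \<Rightarrow> 'd list \<Rightarrow> real ^ 'd \<Rightarrow> real ^ 'n" where
  "partial_iter f [] = f"
| "partial_iter f (i # is) = (\<lambda>x. frechet_derivative (partial_iter f is) (at x) (axis i 1))"

definition smooth_on :: "(real ^ 'd) set \<Rightarrow> (real ^ 'd \<Rightarrow> real ^ 'n) \<Rightarrow> bool" where
  "smooth_on U f \<longleftrightarrow>
     (\<forall>is. (\<forall>x\<in>U. partial_iter f is differentiable (at x)) \<and> continuous_on U (partial_iter f is))"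

definition nondegenerate_at :: "(real ^ 'n) set \<Rightarrow> (real ^ 'd \<Rightarrow> real ^ 'n) \<Rightarrow> real ^ 'd \<Rightarrow> bool" where
  "nondegenerate_at L f x \<longleftrightarrow>
     (\<exists>l::nat. span {partial_iter f is x | is. 1 \<le> length is \<and> length is \<le> l} = lin_part L)"

definition nondegenerate_in :: "(real ^ 'n) set \<Rightarrow> (real ^ 'd \<Rightarrow> real ^ 'n) \<Rightarrow> (real ^ 'd) set \<Rightarrow> bool" where
  "nondegenerate_in L f U \<longleftrightarrow> (AE x in lborel. x \<in> U \<longrightarrow> nondegenerate_at L f x)"

end

theory Submission
  imports Defs "HOL-Computational_Algebra.Polynomial"
begin

text \<open>Let \<open>y0\<close> be a point of \<open>L\<close> that is not very well approximable and \<open>f\<close> a nondegenerate map into \<open>L\<close>;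
  both claims reduce to showing that \<open>f x\<close> is almost surely not very well approximable (for the second one
  take for \<open>f\<close> an affine parametrisation of \<open>L\<close>). Very well approximable \<open>y\<close> correspond to lattices
  \<open>g\<^sub>\<tau> u\<^sub>y \<int>\<^bsup>n+1\<^esup>\<close> with vectors exponentially short in \<open>\<tau>\<close>, for arbitrarily large \<open>\<tau>\<close>. By quantitative
  nondivergence (Kleinbock--Margulis) these are rare along a curve as soon as the covolume of every rational
  subspace is not uniformly small on the curve. Such a covolume is a maximum of absolute values of affine
  functions of \<open>y\<close>, so its supremum over a nondegenerate curve in \<open>L\<close> dominates its value at the single
  point \<open>y0\<close>, where it is large because the lattice at \<open>y0\<close> has no short vectors. The case of several
  variables follows by integrating over translates of a monomial curve.\<close>

section \<open>Sublevel sets of functions with a large derivative\<close>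

text \<open>The bounds must hold for infinitely many rational subspaces at once, so constants along
  a curve may not depend on the affine function \<open>a + b \<bullet> y\<close>. This is possible
  because the part of \<open>b\<close> orthogonal to the linear part of \<open>L\<close> is constant
  on \<open>L\<close>, hence already seen at \<open>y0\<close>, while the other part is controlled
  by finitely many derivatives at one point of the curve. So some derivative of bounded order is
  nearly constant on a short interval and dominates the value at \<open>y0\<close> up to a fixed
  factor. A point that is not very well approximable only gives covolumes eventually above
  \<open>exp (- \<delta> * \<tau>)\<close> for each \<delta> > 0. The loss is harmless: vectors of
  length \<open>exp (- \<gamma> * \<tau>)\<close> are to be excluded, \<delta> is taken below
  \<gamma>, and the exceptional sets decay geometrically in \<tau>, so that Borel-Cantelli applies.
  In several variables the length of the good piece of curve through a point depends on the point
  without control. The exceptional points whose curve almost never returns to the exceptional set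
  are therefore collected in measurable sets; by Fubini these are almost disjoint from arbitrarily
  small translates of themselves, hence null.\<close>

lemma iterated_Rolle:
  fixes G :: "nat \<Rightarrow> real \<Rightarrow> real"
  assumes "\<And>i x. i < k \<Longrightarrow> x \<in> {a..b} \<Longrightarrow> (G i has_real_derivative G (Suc i) x) (at x)"
    and "\<And>i. i < k \<Longrightarrow> X i < X (Suc i)"
    and "\<And>i. i \<le> k \<Longrightarrow> X i \<in> {a..b} \<and> G 0 (X i) = 0"
  shows "\<exists>\<xi>\<in>{a..b}. G k \<xi> = 0"
  using assms
proof (induction k arbitrary: G X)
  case 0
  then show ?case by blast
next
  case (Suc k)
  have "\<exists>z. X i < z \<and> z < X (Suc i) \<and> G 1 z = 0" if "i \<le> k" for i
  proof -
    have lt: "X i < X (Suc i)" using Suc.prems(2) that by simp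
    have sub: "{X i..X (Suc i)} \<subseteq> {a..b}" using Suc.prems(3)[of i] Suc.prems(3)[of "Suc i"] that by auto
    have d: "(G 0 has_real_derivative G 1 x) (at x)" if "x \<in> {X i..X (Suc i)}" for x
      using Suc.prems(1)[of 0 x] that sub by auto
    have "\<exists>z. X i < z \<and> z < X (Suc i) \<and> (G 0 has_real_derivative 0) (at z)"
    proof (rule Rolle[OF lt])
      show "G 0 (X i) = G 0 (X (Suc i))" using Suc.prems(3) that by simp
      show "continuous_on {X i..X (Suc i)} (G 0)"
        using d by (meson DERIV_isCont continuous_at_imp_continuous_on)
      show "G 0 differentiable at x" if "X i < x" "x < X (Suc i)" for x
        using d[of x] that real_differentiable_def by auto
    qed
    then obtain z where z: "X i < z" "z < X (Suc i)" "(G 0 has_real_derivative 0) (at z)" by blast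
    with d[of z] have "G 1 z = 0" using DERIV_unique[of "G 0" "G 1 z" z 0] by auto
    with z show ?thesis by blast
  qed
  then obtain Z where Z: "\<And>i. i \<le> k \<Longrightarrow> X i < Z i \<and> Z i < X (Suc i) \<and> G 1 (Z i) = 0"
    by metis
  have "\<exists>\<xi>\<in>{a..b}. (\<lambda>i. G (Suc i)) k \<xi> = 0"
  proof (rule Suc.IH)
    show "(G (Suc i) has_real_derivative G (Suc (Suc i)) x) (at x)" if "i < k" "x \<in> {a..b}" for i x
      using Suc.prems(1)[of "Suc i" x] that by simp
    show "Z i < Z (Suc i)" if "i < k" for i using Z[of i] Z[of "Suc i"] that by simp
    show "Z i \<in> {a..b} \<and> G (Suc 0) (Z i) = 0" if "i \<le> k" for i
      using Z[OF that] Suc.prems(3)[of i] Suc.prems(3)[of "Suc i"] that by auto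
  qed
  then show ?case by simp
qed

lemma iterated_Rolle_set:
  fixes G :: "nat \<Rightarrow> real \<Rightarrow> real"
  assumes "\<And>i x. i < k \<Longrightarrow> x \<in> {a..b} \<Longrightarrow> (G i has_real_derivative G (Suc i) x) (at x)"
    and S: "finite S" "card S = Suc k" "S \<subseteq> {a..b}" "\<And>x. x \<in> S \<Longrightarrow> G 0 x = 0"
  shows "\<exists>\<xi>\<in>{a..b}. G k \<xi> = 0"
proof -
  let ?xs = "sorted_list_of_set S"
  have len: "length ?xs = Suc k" using S by simp
  show ?thesis
  proof (rule iterated_Rolle[of k a b G "\<lambda>i. ?xs ! i"])
    show "?xs ! i < ?xs ! Suc i" if "i < k" for i
      using sorted_wrt_nth_less[OF strict_sorted_list_of_set[of S], of i "Suc i"] len that by simp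
    show "?xs ! i \<in> {a..b} \<and> G 0 (?xs ! i) = 0" if "i \<le> k" for i
      using S nth_mem[of i ?xs] len that by auto
  qed (use assms(1) in auto)
qed

lemma degree_higher_pderiv_0:
  fixes p :: "real poly"
  assumes "degree p \<le> k"
  shows "(pderiv ^^ k) p = [:fact k * coeff p k:]"
proof (rule poly_eqI)
  fix n
  show "coeff ((pderiv ^^ k) p) n = coeff [:fact k * coeff p k:] n"
  proof (cases n)
    case 0
    then show ?thesis by (simp add: coeff_higher_pderiv pochhammer_fact)
  next
    case (Suc m)
    then show ?thesis using assms by (simp add: coeff_higher_pderiv coeff_eq_0)
  qed
qed

text \<open>The \<open>k\<close>-th derivative of the Lagrange interpolation polynomial is constant; compare it with
  that of the function by Rolle's theorem.\<close>

lemma divided_difference_mvt: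
  fixes G :: "nat \<Rightarrow> real \<Rightarrow> real"
  assumes d: "\<And>i x. i < k \<Longrightarrow> x \<in> {a..b} \<Longrightarrow> (G i has_real_derivative G (Suc i) x) (at x)"
    and S: "finite S" "card S = Suc k" "S \<subseteq> {a..b}"
  shows "\<exists>\<xi>\<in>{a..b}. (\<Sum>x\<in>S. G 0 x / (\<Prod>y\<in>S-{x}. x - y)) = G k \<xi> / fact k"
proof -
  define Q where "Q x = (\<Prod>y\<in>S-{x}. [:-y, 1:])" for x
  define c where "c x = G 0 x / (\<Prod>y\<in>S-{x}. x - y)" for x
  define P where "P = (\<Sum>x\<in>S. smult (c x) (Q x))"
  have nz: "(\<Prod>y\<in>S-{x}. x - y) \<noteq> 0" for x using S(1) by simp
  have Qz: "poly (Q x) z = (\<Prod>y\<in>S-{x}. z - y)" for x z by (simp add: Q_def poly_prod)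
  have Pz: "poly P z = G 0 z" if "z \<in> S" for z
  proof -
    have "poly P z = (\<Sum>x\<in>S. c x * poly (Q x) z)" by (simp add: P_def poly_sum)
    also have "\<dots> = (\<Sum>x\<in>S. if x = z then G 0 z else 0)"
    proof (rule sum.cong)
      fix x assume "x \<in> S"
      show "c x * poly (Q x) z = (if x = z then G 0 z else 0)"
      proof (cases "x = z")
        case True
        then show ?thesis using nz[of z] by (simp add: Qz c_def)
      next
        case False
        then have "poly (Q x) z = 0" using that S(1) by (auto simp: Qz)
        then show ?thesis using False by simp
      qed
    qed simp
    also have "\<dots> = G 0 z" using S(1) that by simp
    finally show ?thesis .
  qed
  have degQ: "degree (Q x) = k" if "x \<in> S" for x
  proof -
    have "degree (Q x) = (\<Sum>y\<in>S-{x}. degree [:-y, 1:])"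
      unfolding Q_def by (rule degree_prod_eq_sum_degree) auto
    then show ?thesis using S that by simp
  qed
  have lcQ: "coeff (Q x) k = 1" if "x \<in> S" for x
  proof -
    have "lead_coeff (Q x) = (\<Prod>y\<in>S-{x}. lead_coeff [:-y, 1:])"
      unfolding Q_def by (rule lead_coeff_prod)
    then show ?thesis using degQ[OF that] by simp
  qed
  have degP: "degree P \<le> k"
    unfolding P_def by (rule degree_sum_le) (use S(1) degQ in \<open>auto intro: order.trans[OF degree_smult_le]\<close>)
  have cP: "coeff P k = (\<Sum>x\<in>S. c x)"
    using lcQ by (simp add: P_def coeff_sum)
  have "\<exists>\<xi>\<in>{a..b}. (\<lambda>i t. G i t - poly ((pderiv ^^ i) P) t) k \<xi> = 0"
  proof (rule iterated_Rolle_set[OF _ S])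
    show "((\<lambda>t. G i t - poly ((pderiv ^^ i) P) t) has_real_derivative
            G (Suc i) x - poly ((pderiv ^^ Suc i) P) x) (at x)" if "i < k" "x \<in> {a..b}" for i x
      using d[OF that] poly_DERIV[of "(pderiv ^^ i) P" x] by (auto intro: DERIV_diff)
    show "G 0 x - poly ((pderiv ^^ 0) P) x = 0" if "x \<in> S" for x using Pz[OF that] by simp
  qed
  then obtain \<xi> where "\<xi> \<in> {a..b}" "G k \<xi> = fact k * (\<Sum>x\<in>S. c x)"
    by (auto simp: degree_higher_pderiv_0[OF degP] cP)
  then show ?thesis by (intro bexI[of _ \<xi>]) (auto simp: c_def)
qed

text \<open>Greedy choice: with j <= k points chosen, the intervals of radius h = |A| / (2 (k + 1))
  around them have total length j |A| / (k + 1) < |A| and leave a point of A uncovered.\<close>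

lemma separated_points:
  fixes A :: "real set"
  assumes A: "A \<in> lmeasurable" and m: "measure lebesgue A > 0" and jk: "j \<le> Suc k"
  shows "\<exists>S\<subseteq>A. finite S \<and> card S = j \<and>
           (\<forall>x\<in>S. \<forall>y\<in>S. x \<noteq> y \<longrightarrow> \<bar>x - y\<bar> \<ge> measure lebesgue A / (2 * real (Suc k)))"
  using jk
proof (induction j)
  case 0
  then show ?case by (intro exI[of _ "{}"]) auto
next
  case (Suc j)
  let ?h = "measure lebesgue A / (2 * real (Suc k))"
  from Suc obtain S where S: "S \<subseteq> A" "finite S" "card S = j"
    "\<And>x y. x \<in> S \<Longrightarrow> y \<in> S \<Longrightarrow> x \<noteq> y \<Longrightarrow> \<bar>x - y\<bar> \<ge> ?h" by (metis Suc_leD)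
  have hpos: "?h > 0" using m by simp
  have "\<not> A \<subseteq> (\<Union>x\<in>S. {x - ?h<..<x + ?h})"
  proof
    assume sub: "A \<subseteq> (\<Union>x\<in>S. {x - ?h<..<x + ?h})"
    have "measure lebesgue A \<le> measure lebesgue (\<Union>x\<in>S. {x - ?h<..<x + ?h})"
      by (rule measure_mono_fmeasurable[OF sub]) (use A S(2) in \<open>auto intro!: fmeasurable.finite_UN simp: fmeasurableD\<close>)
    also have "\<dots> \<le> (\<Sum>x\<in>S. measure lebesgue {x - ?h<..<x + ?h})"
      by (rule measure_UNION_le) (use S(2) in auto)
    also have "\<dots> = real j * (2 * ?h)"
      using hpos S(3) by (simp add: measure_def)
    also have "\<dots> = real j / real (Suc k) * measure lebesgue A" by (simp add: divide_simps)
    also have "\<dots> < 1 * measure lebesgue A"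
      by (rule mult_strict_right_mono[OF _ m]) (use Suc.prems in simp)
    also have "\<dots> = measure lebesgue A" by simp
    finally show False by simp
  qed
  then obtain z where z: "z \<in> A" "\<And>x. x \<in> S \<Longrightarrow> \<bar>z - x\<bar> \<ge> ?h"
    by (auto simp: abs_if not_less) (smt (verit) greaterThanLessThan_iff)
  have "z \<notin> S" using z(2)[of z] hpos by auto
  then have "insert z S \<subseteq> A" "finite (insert z S)" "card (insert z S) = Suc j" using S z by auto
  moreover have "\<bar>x - y\<bar> \<ge> ?h" if "x \<in> insert z S" "y \<in> insert z S" "x \<noteq> y" for x y
    using that S(4) z(2) abs_minus_commute by (metis insertE)
  ultimately show ?case by blast
qed

lemma separated_prod_ge:
  fixes S :: "real set"
  assumes "finite S" "x \<in> S" "h \<ge> 0" "card S = Suc k"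
    and "\<And>x y. x \<in> S \<Longrightarrow> y \<in> S \<Longrightarrow> x \<noteq> y \<Longrightarrow> \<bar>x - y\<bar> \<ge> h"
  shows "h ^ k \<le> \<bar>\<Prod>y\<in>S-{x}. x - y\<bar>"
proof -
  have "h ^ k = (\<Prod>y\<in>S-{x}. h)" using assms by simp
  also have "\<dots> \<le> (\<Prod>y\<in>S-{x}. \<bar>x - y\<bar>)" by (rule prod_mono) (use assms in auto)
  finally show ?thesis by (simp add: abs_prod)
qed

text \<open>The divided difference over k + 1 separated points of A is a value of \<open>G k\<close>
  divided by k!, while each of its k + 1 terms is at most \<epsilon> / h ^ k.\<close>

lemma sublevel_derivative_bound:
  fixes G :: "nat \<Rightarrow> real \<Rightarrow> real"
  assumes d: "\<And>i x. i < k \<Longrightarrow> x \<in> {a..b} \<Longrightarrow> (G i has_real_derivative G (Suc i) x) (at x)"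
    and v: "\<And>x. x \<in> {a..b} \<Longrightarrow> v \<le> \<bar>G k x\<bar>"
    and A: "A \<in> lmeasurable" "measure lebesgue A > 0" "A \<subseteq> {a..b}" "\<And>x. x \<in> A \<Longrightarrow> \<bar>G 0 x\<bar> \<le> \<epsilon>"
  shows "v \<le> fact k * real (Suc k) * \<epsilon> * (2 * real (Suc k) / measure lebesgue A) ^ k"
proof -
  define h where "h = measure lebesgue A / (2 * real (Suc k))"
  have h: "h > 0" using A by (simp add: h_def)
  obtain S where S: "S \<subseteq> A" "finite S" "card S = Suc k"
    "\<And>x y. x \<in> S \<Longrightarrow> y \<in> S \<Longrightarrow> x \<noteq> y \<Longrightarrow> \<bar>x - y\<bar> \<ge> h"
    using separated_points[OF A(1,2), of "Suc k" k] by (auto simp: h_def)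
  obtain \<xi> where xi: "\<xi> \<in> {a..b}" "(\<Sum>x\<in>S. G 0 x / (\<Prod>y\<in>S-{x}. x - y)) = G k \<xi> / fact k"
    using divided_difference_mvt[of k a b G S] d S A(3) by blast
  have "\<bar>G k \<xi> / fact k\<bar> \<le> (\<Sum>x\<in>S. \<bar>G 0 x / (\<Prod>y\<in>S-{x}. x - y)\<bar>)"
    unfolding xi(2)[symmetric] by (rule sum_abs)
  also have "\<dots> \<le> (\<Sum>x\<in>S. \<epsilon> / h ^ k)"
  proof (rule sum_mono)
    fix x assume x: "x \<in> S"
    have "h ^ k \<le> \<bar>\<Prod>y\<in>S-{x}. x - y\<bar>" using separated_prod_ge[OF S(2) x _ S(3) S(4)] h by auto
    then show "\<bar>G 0 x / (\<Prod>y\<in>S-{x}. x - y)\<bar> \<le> \<epsilon> / h ^ k"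
      unfolding abs_divide using A(4)[of x] x S(1) h by (intro frac_le) auto
  qed
  also have "\<dots> = real (Suc k) * (\<epsilon> / h ^ k)" using S by simp
  finally have "\<bar>G k \<xi>\<bar> \<le> fact k * (real (Suc k) * (\<epsilon> / h ^ k))"
    by (simp add: abs_divide divide_le_eq mult.commute)
  then have "v \<le> fact k * (real (Suc k) * (\<epsilon> / h ^ k))" using v[OF xi(1)] by linarith
  also have "\<dots> = fact k * real (Suc k) * \<epsilon> * (2 * real (Suc k) / measure lebesgue A) ^ k"
    by (simp add: h_def power_divide)
  finally show ?thesis .
qed

text \<open>Apply the divided difference to y together with k separated points of A and solve for
  \<open>G 0 y\<close>. The term with the derivative contributes 2 (k + 1), by
  \<open>sublevel_derivative_bound\<close> and the factor 2 between the two bounds on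
  \<open>G k\<close>; the terms at points of A contribute k. Hence 3 k + 2.\<close>

lemma sublevel_value_bound:
  fixes G :: "nat \<Rightarrow> real \<Rightarrow> real"
  assumes d: "\<And>i x. i < k \<Longrightarrow> x \<in> {a..b} \<Longrightarrow> (G i has_real_derivative G (Suc i) x) (at x)"
    and v: "\<And>x. x \<in> {a..b} \<Longrightarrow> v \<le> \<bar>G k x\<bar>" "\<And>x. x \<in> {a..b} \<Longrightarrow> \<bar>G k x\<bar> \<le> 2 * v"
    and A: "A \<in> lmeasurable" "measure lebesgue A > 0" "A \<subseteq> {a..b}" "\<And>x. x \<in> A \<Longrightarrow> \<bar>G 0 x\<bar> \<le> \<epsilon>"
    and y: "y \<in> {a..b}" "\<And>x. x \<in> A \<Longrightarrow> \<bar>y - x\<bar> \<le> L" "measure lebesgue A \<le> L"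
  shows "\<bar>G 0 y\<bar> \<le> real (3 * k + 2) * \<epsilon> * (2 * real (Suc k) * L / measure lebesgue A) ^ k"
proof -
  define h where "h = measure lebesgue A / (2 * real (Suc k))"
  have h: "h > 0" using A by (simp add: h_def)
  have "h \<le> measure lebesgue A" using A(2) by (simp add: h_def field_simps)
  then have hL: "h \<le> L" using y(3) by linarith
  then have Lh: "1 \<le> L / h" using h by simp
  have "A \<noteq> {}" using A(2) by auto
  then have eps: "\<epsilon> \<ge> 0" using A(4) by force
  obtain S where S: "S \<subseteq> A" "finite S" "card S = k"
    "\<And>x y. x \<in> S \<Longrightarrow> y \<in> S \<Longrightarrow> x \<noteq> y \<Longrightarrow> \<bar>x - y\<bar> \<ge> h"
    using separated_points[OF A(1,2), of k k] by (auto simp: h_def)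
  have goal: "\<bar>G 0 y\<bar> \<le> real (3 * k + 2) * \<epsilon> * (L / h) ^ k"
  proof (cases "y \<in> S")
    case True
    then have "\<bar>G 0 y\<bar> \<le> \<epsilon> * 1" using A(4) S(1) by auto
    also have "\<dots> \<le> (real (3 * k + 2) * \<epsilon>) * (L / h) ^ k"
      by (rule mult_mono) (use eps Lh in \<open>auto intro: one_le_power mult_right_mono\<close>, simp add: algebra_simps)
    finally show ?thesis .
  next
    case False
    define T where "T = insert y S"
    have T: "finite T" "card T = Suc k" "T \<subseteq> {a..b}" using S False A(3) y(1) by (auto simp: T_def)
    obtain \<xi> where xi: "\<xi> \<in> {a..b}" "(\<Sum>x\<in>T. G 0 x / (\<Prod>z\<in>T-{x}. x - z)) = G k \<xi> / fact k"
      using divided_difference_mvt[of k a b G T] d T by blast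
    define pp where "pp = (\<Prod>z\<in>S. y - z)"
    have Pi0: "pp \<noteq> 0" using False S(2) by (auto simp: pp_def)
    have "T - {y} = S" using False by (auto simp: T_def)
    then have "G 0 y / pp = G k \<xi> / fact k - (\<Sum>x\<in>S. G 0 x / (\<Prod>z\<in>T-{x}. x - z))"
      using xi(2) False S(2) by (simp add: T_def pp_def)
    then have "G 0 y = pp * (G k \<xi> / fact k) - (\<Sum>x\<in>S. pp * (G 0 x / (\<Prod>z\<in>T-{x}. x - z)))"
      using Pi0 by (simp add: field_simps sum_distrib_left)
    then have "\<bar>G 0 y\<bar> \<le> \<bar>pp * (G k \<xi> / fact k)\<bar> + \<bar>\<Sum>x\<in>S. pp * (G 0 x / (\<Prod>z\<in>T-{x}. x - z))\<bar>"
      by linarith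
    also have "\<bar>pp * (G k \<xi> / fact k)\<bar> \<le> L ^ k * (2 * real (Suc k) * \<epsilon> / h ^ k)"
      unfolding abs_mult
    proof (rule mult_mono)
      have "\<bar>pp\<bar> \<le> (\<Prod>z\<in>S. L)"
        unfolding pp_def abs_prod by (rule prod_mono) (use y(2) S(1) in auto)
      then show "\<bar>pp\<bar> \<le> L ^ k" using S by simp
      have "\<bar>G k \<xi>\<bar> \<le> 2 * (fact k * real (Suc k) * \<epsilon> * (2 * real (Suc k) / measure lebesgue A) ^ k)"
        using sublevel_derivative_bound[of k a b G v A \<epsilon>, OF d v(1) A] v(2)[OF xi(1)] by auto
      also have "\<dots> = fact k * (2 * real (Suc k) * \<epsilon> / h ^ k)"
        by (simp add: h_def power_divide)
      finally show "\<bar>G k \<xi> / fact k\<bar> \<le> 2 * real (Suc k) * \<epsilon> / h ^ k"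
        by (simp add: abs_divide divide_le_eq mult.commute)
    qed (use h hL in auto)
    also have "\<bar>\<Sum>x\<in>S. pp * (G 0 x / (\<Prod>z\<in>T-{x}. x - z))\<bar> \<le> (\<Sum>x\<in>S. \<epsilon> * (L / h) ^ k)"
    proof (rule order.trans[OF sum_abs sum_mono])
      fix x assume x: "x \<in> S"
      obtain k' where k': "k = Suc k'" using x S(2,3) by (metis card_gt_0_iff empty_iff gr0_implies_Suc)
      have xy: "x \<noteq> y" using x False by auto
      have "T - {x} = insert y (S - {x})" using xy by (auto simp: T_def)
      then have e1: "(\<Prod>z\<in>T-{x}. x - z) = (x - y) * (\<Prod>z\<in>S-{x}. x - z)" using False S(2) by simp
      have e2: "pp = (y - x) * (\<Prod>z\<in>S-{x}. y - z)" unfolding pp_def using x S(2) by (rule prod.remove[rotated])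
      have e3: "\<bar>pp * (G 0 x / (\<Prod>z\<in>T-{x}. x - z))\<bar>
          = \<bar>G 0 x\<bar> * (\<bar>\<Prod>z\<in>S-{x}. y - z\<bar> / \<bar>\<Prod>z\<in>S-{x}. x - z\<bar>)"
        unfolding e1 e2 abs_minus_commute[of y x] abs_mult abs_divide using xy
        by (simp add: abs_minus_commute[of y x])
      have "\<bar>\<Prod>z\<in>S-{x}. y - z\<bar> \<le> (\<Prod>z\<in>S-{x}. L)"
        unfolding abs_prod by (rule prod_mono) (use y(2) S(1) in auto)
      then have n: "\<bar>\<Prod>z\<in>S-{x}. y - z\<bar> \<le> L ^ k'" using S x k' by simp
      have dd: "h ^ k' \<le> \<bar>\<Prod>z\<in>S-{x}. x - z\<bar>"
        using separated_prod_ge[OF S(2) x _ _ S(4), of k'] S(3) k' h by auto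
      have "\<bar>\<Prod>z\<in>S-{x}. y - z\<bar> / \<bar>\<Prod>z\<in>S-{x}. x - z\<bar> \<le> L ^ k' / h ^ k'"
        using n dd h hL by (intro frac_le) auto
      also have "\<dots> = (L / h) ^ k'" by (simp add: power_divide)
      also have "\<dots> \<le> (L / h) ^ k" using Lh k' by (intro power_increasing) auto
      finally show "\<bar>pp * (G 0 x / (\<Prod>z\<in>T-{x}. x - z))\<bar> \<le> \<epsilon> * (L / h) ^ k"
        unfolding e3 using A(4)[of x] x S(1) eps by (intro mult_mono) auto
    qed
    finally show ?thesis using S(3) h by (simp add: power_divide field_simps)
  qed
  have "L / h = 2 * real (Suc k) * L / measure lebesgue A" by (simp add: h_def)
  then show ?thesis using goal by simp
qed

text \<open>This is the (C, \<alpha>)-good property of Kleinbock and Margulis with \<alpha> = 1 / l.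
  The order k of the nearly constant derivative will vary with the function, so the bound is relaxed
  from k to a common l; this is possible because the proportion \<open>r\<close> is at most
  1.\<close>

lemma sublevel_good:
  fixes G :: "nat \<Rightarrow> real \<Rightarrow> real"
  assumes d: "\<And>i x. i < k \<Longrightarrow> x \<in> {a..b} \<Longrightarrow> (G i has_real_derivative G (Suc i) x) (at x)"
    and v: "\<And>x. x \<in> {a..b} \<Longrightarrow> v \<le> \<bar>G k x\<bar>" "\<And>x. x \<in> {a..b} \<Longrightarrow> \<bar>G k x\<bar> \<le> 2 * v"
    and J: "J \<subseteq> {a..b}" "\<And>x y. x \<in> J \<Longrightarrow> y \<in> J \<Longrightarrow> \<bar>x - y\<bar> \<le> L" "y \<in> J"
    and A: "{x\<in>J. \<bar>G 0 x\<bar> < \<tau> * \<bar>G 0 y\<bar>} \<in> lmeasurable"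
      "measure lebesgue {x\<in>J. \<bar>G 0 x\<bar> < \<tau> * \<bar>G 0 y\<bar>} \<le> L"
    and kl: "k \<le> l" "0 < l" and L: "L > 0" and tau: "0 \<le> \<tau>"
  shows "measure lebesgue {x\<in>J. \<bar>G 0 x\<bar> < \<tau> * \<bar>G 0 y\<bar>}
           \<le> root l (real (3 * l + 2) * (2 * real (Suc l)) ^ l * \<tau>) * L"
proof -
  let ?A = "{x\<in>J. \<bar>G 0 x\<bar> < \<tau> * \<bar>G 0 y\<bar>}"
  define m where "m = measure lebesgue ?A"
  show ?thesis
  proof (cases "m > 0")
    case False
    then have "m \<le> 0" by simp
    also have "0 \<le> root l (real (3 * l + 2) * (2 * real (Suc l)) ^ l * \<tau>) * L"
      using L tau kl by (intro mult_nonneg_nonneg real_root_ge_zero) auto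
    finally show ?thesis by (simp add: m_def)
  next
    case True
    define r where "r = m / L"
    have r: "0 < r" "r \<le> 1" using True A(2) L by (auto simp: r_def m_def)
    have Gy: "\<bar>G 0 y\<bar> > 0"
    proof (rule ccontr)
      assume "\<not> \<bar>G 0 y\<bar> > 0"
      then have e: "?A = {}" by auto
      show False using True unfolding m_def e by simp
    qed
    have "\<bar>G 0 y\<bar> \<le> real (3 * k + 2) * (\<tau> * \<bar>G 0 y\<bar>) * (2 * real (Suc k) * L / measure lebesgue ?A) ^ k"
      by (rule sublevel_value_bound[OF d v A(1)])
        (use True J A(2) in \<open>auto simp: m_def\<close>)
    also have "2 * real (Suc k) * L / measure lebesgue ?A = 2 * real (Suc k) / r"
      by (simp add: r_def m_def)
    finally have "1 * \<bar>G 0 y\<bar> \<le> (real (3 * k + 2) * \<tau> * (2 * real (Suc k) / r) ^ k) * \<bar>G 0 y\<bar>"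
      by (simp add: mult_ac)
    then have "1 \<le> real (3 * k + 2) * \<tau> * (2 * real (Suc k) / r) ^ k"
      using Gy by (rule mult_right_le_imp_le)
    then have "r ^ k \<le> real (3 * k + 2) * \<tau> * (2 * real (Suc k)) ^ k"
      using r by (simp add: power_divide field_simps)
    also have "\<dots> \<le> real (3 * l + 2) * \<tau> * (2 * real (Suc l)) ^ l"
    proof (rule mult_mono)
      have "(2 * real (Suc k)) ^ k \<le> (2 * real (Suc l)) ^ k" using kl by (intro power_mono) auto
      also have "\<dots> \<le> (2 * real (Suc l)) ^ l" using kl by (intro power_increasing) auto
      finally show "(2 * real (Suc k)) ^ k \<le> (2 * real (Suc l)) ^ l" .
    qed (use kl tau in \<open>auto intro!: mult_right_mono\<close>)
    finally have "r ^ k \<le> real (3 * l + 2) * (2 * real (Suc l)) ^ l * \<tau>" by (simp add: mult_ac)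
    moreover have "r ^ l \<le> r ^ k" using r kl by (intro power_decreasing) auto
    ultimately have "r ^ l \<le> real (3 * l + 2) * (2 * real (Suc l)) ^ l * \<tau>" by simp
    then have "root l (r ^ l) \<le> root l (real (3 * l + 2) * (2 * real (Suc l)) ^ l * \<tau>)"
      using kl by (simp only: real_root_le_iff)
    then have "r \<le> root l (real (3 * l + 2) * (2 * real (Suc l)) ^ l * \<tau>)"
      using kl r by (simp only: real_root_power_cancel)
    then show ?thesis using L by (simp add: r_def m_def divide_le_eq)
  qed
qed

section \<open>Quantitative nondivergence\<close>

text \<open>Half-open cells defined by the floor: those of one level partition the line, any two are
  nested or disjoint, and the parent of cell j is cell \<open>j div 2\<close>. Coverings by maximal
  cells are therefore disjoint and no multiplicity constant enters.\<close>

definition dyadic_cell :: "nat \<Rightarrow> int \<Rightarrow> real set" where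
  "dyadic_cell k j = {y. \<lfloor>2 ^ k * y\<rfloor> = j}"

lemma dyadic_cell_eq: "dyadic_cell k j = {real_of_int j / 2 ^ k ..< (real_of_int j + 1) / 2 ^ k}"
  by (auto simp: dyadic_cell_def floor_eq_iff field_simps)

lemma borel_dyadic_cell [measurable]: "dyadic_cell k j \<in> sets borel"
  by (simp add: dyadic_cell_eq)

lemma emeasure_dyadic_cell: "emeasure lborel (dyadic_cell k j) = ennreal (1 / 2 ^ k)"
proof -
  have "(real_of_int j + 1) / 2 ^ k - real_of_int j / 2 ^ k = 1 / 2 ^ k"
    by (simp add: diff_divide_distrib[symmetric])
  then show ?thesis unfolding dyadic_cell_eq
    by (subst emeasure_lborel_Ico) (auto intro: divide_right_mono)
qed

lemma floor_dyadic_div: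
  assumes "k \<le> k'"
  shows "\<lfloor>2 ^ k * y :: real\<rfloor> = \<lfloor>2 ^ k' * y\<rfloor> div 2 ^ (k' - k)"
proof -
  have "(2::real) ^ k' = 2 ^ k * 2 ^ (k' - k)" using assms by (simp flip: power_add)
  then have "2 ^ k * y = (2 ^ k' * y) / real_of_int (2 ^ (k' - k))" by simp
  then show ?thesis using floor_divide_real_eq_div[of "2 ^ (k' - k)" "2 ^ k' * y"] by simp
qed

lemma dyadic_cell_nested:
  assumes "k \<le> k'" "y \<in> dyadic_cell k j" "y \<in> dyadic_cell k' j'"
  shows "dyadic_cell k' j' \<subseteq> dyadic_cell k j"
  using assms floor_dyadic_div[OF assms(1)] by (auto simp: dyadic_cell_def)

lemma dyadic_cell_parent:
  assumes "0 < k"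
  shows "dyadic_cell k j \<subseteq> dyadic_cell (k - 1) (j div 2)"
  using floor_dyadic_div[of "k - 1" k] assms by (auto simp: dyadic_cell_def)

lemma dyadic_cell_nonempty: "\<exists>y. y \<in> dyadic_cell k j"
  by (intro exI[of _ "real_of_int j / 2 ^ k"]) (simp add: dyadic_cell_def)

lemma dyadic_cell_dist:
  assumes "x \<in> dyadic_cell k j" "y \<in> dyadic_cell k j"
  shows "\<bar>x - y\<bar> \<le> 1 / 2 ^ k"
  using assms unfolding dyadic_cell_eq by (auto simp: field_simps abs_le_iff)

section \<open>Chains of weights and the exceptional set\<close>

definition pairwise_rel :: "('e \<Rightarrow> 'e \<Rightarrow> bool) \<Rightarrow> 'e set \<Rightarrow> bool" where
  "pairwise_rel R F \<longleftrightarrow> (\<forall>D\<in>F. \<forall>E\<in>F. R D E)"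

text \<open>\<open>F\<close> is the part of the chain fixed at earlier stages; bounds are demanded
  only on \<open>G - F\<close>, since a member of \<open>F\<close> receives its own when it is
  inserted. With \<open>F = {}\<close> this is the notion of a marked point in the
  Kleinbock-Margulis argument: a flag whose covolumes lie in a window and which cannot be refined by
  a subspace of covolume below \<rho>'.\<close>

definition chain_protected ::
    "('e \<Rightarrow> 'e \<Rightarrow> bool) \<Rightarrow> 'e set \<Rightarrow> ('e \<Rightarrow> real \<Rightarrow> real) \<Rightarrow> 'e set \<Rightarrow> real \<Rightarrow> real \<Rightarrow> real \<Rightarrow> real \<Rightarrow> bool" where
  "chain_protected R P \<psi> F \<epsilon> \<rho> \<rho>' x \<longleftrightarrow>
     (\<exists>G. F \<subseteq> G \<and> G \<subseteq> P \<and> finite G \<and> pairwise_rel R G \<and>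
        (\<forall>E\<in>G-F. \<epsilon> \<le> \<psi> E x \<and> \<psi> E x \<le> \<rho>) \<and>
        (\<forall>E\<in>P-G. (\<forall>D\<in>G. R E D) \<longrightarrow> \<rho>' \<le> \<psi> E x))"

text \<open>A point outside the exceptional set is protected by a
  chain \<open>G\<close> of weights in \<open>[\<epsilon>, \<rho>]\<close> such that everything comparable with \<open>G\<close> has weight
  bounded below. In the inductive step the cell is cut into the maximal dyadic subcells on which
  some weight is below \<open>\<rho>\<close>; on these all weights still reach \<open>c * \<rho>\<close>, since they reach \<open>\<rho>\<close> on
  the parent cell.\<close>

lemma nondivergence_induction:
  fixes \<psi> :: "'e \<Rightarrow> real \<Rightarrow> real" and R :: "'e \<Rightarrow> 'e \<Rightarrow> bool"
  assumes R: "\<And>D. R D D" "\<And>D E. R D E \<Longrightarrow> R E D"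
    and K: "\<And>F. finite F \<Longrightarrow> F \<subseteq> P \<Longrightarrow> pairwise_rel R F \<Longrightarrow> card F \<le> K"
    and cont: "\<And>E. E \<in> P \<Longrightarrow> continuous_on {0..<1} (\<psi> E)"
    and meas: "\<And>E k j s. E \<in> P \<Longrightarrow> dyadic_cell k j \<subseteq> {0..<1} \<Longrightarrow>
        {x \<in> dyadic_cell k j. \<psi> E x < s} \<in> sets borel"
    and good: "\<And>E k j y \<tau>. E \<in> P \<Longrightarrow> dyadic_cell k j \<subseteq> {0..<1} \<Longrightarrow> y \<in> dyadic_cell k j \<Longrightarrow> 0 \<le> \<tau> \<Longrightarrow>
        emeasure lborel {x \<in> dyadic_cell k j. \<psi> E x < \<tau> * \<psi> E y} \<le> ennreal (\<eta> \<tau>) * emeasure lborel (dyadic_cell k j)"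
    and \<eta>: "\<And>s t. 0 \<le> s \<Longrightarrow> s \<le> t \<Longrightarrow> \<eta> s \<le> \<eta> t" "\<eta> 0 \<ge> 0"
    and c: "0 < c" "c \<le> 1" "\<eta> c < 1 / 2"
    and F: "finite F" "F \<subseteq> P" "pairwise_rel R F" "K - card F \<le> m"
    and cell: "dyadic_cell k0 j0 \<subseteq> {0..<1}"
    and pos: "0 < \<rho>" "0 < \<epsilon>"
    and large: "\<And>E. E \<in> P - F \<Longrightarrow> (\<And>D. D \<in> F \<Longrightarrow> R E D) \<Longrightarrow> \<exists>y\<in>dyadic_cell k0 j0. \<rho> \<le> \<psi> E y"
  shows "\<exists>Bad\<in>sets borel. Bad \<subseteq> dyadic_cell k0 j0 \<and>
     emeasure lborel Bad \<le> ennreal (real m * \<eta> (\<epsilon> / (c ^ m * \<rho>))) * emeasure lborel (dyadic_cell k0 j0) \<and>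
     (\<forall>x\<in>dyadic_cell k0 j0 - Bad. chain_protected R P \<psi> F \<epsilon> \<rho> (c ^ m * \<rho>) x)"
  using F cell pos large
proof (induction m arbitrary: F k0 j0 \<rho>)
  case 0
  \<comment> \<open>By now \<open>card F\<close> has reached the maximal size \<open>K\<close>, so
    nothing outside \<open>F\<close> is comparable with all of it, and \<open>G = F\<close> serves
    at every point.\<close>
  have none: "\<not> (\<forall>D\<in>F. R E D)" if "E \<in> P - F" for E
  proof
    assume "\<forall>D\<in>F. R E D"
    then have "pairwise_rel R (insert E F)"
      using 0(3) R unfolding pairwise_rel_def by blast
    then have "card (insert E F) \<le> K" using K[of "insert E F"] 0(1,2) that by auto
    then show False using that 0(1,4) by simp
  qed
  have "chain_protected R P \<psi> F \<epsilon> \<rho> (c ^ 0 * \<rho>) x" for x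
    unfolding chain_protected_def by (rule exI[of _ F]) (use 0(1,2,3) none in auto)
  then show ?case by (intro bexI[of _ "{}"]) simp_all
next
  case (Suc m)
  define S where "S = {E \<in> P - F. \<forall>D\<in>F. R E D}"
  define low where "low k j \<longleftrightarrow> (\<exists>E\<in>S. \<forall>y\<in>dyadic_cell k j. \<psi> E y < \<rho>)" for k j
  \<comment> \<open>\<open>low\<close> passes to subcells, so maximality only has to exclude that
    the parent is low. Because k0 < k, the parent still lies inside the starting cell.\<close>
  define \<D> where "\<D> = {(k, j). k0 < k \<and> dyadic_cell k j \<subseteq> dyadic_cell k0 j0 \<and> low k j \<and> \<not> low (k - 1) (j div 2)}"
  let ?b = "\<eta> (\<epsilon> / (c ^ Suc m * \<rho>))"
  have cm: "0 < c ^ n" "c ^ n \<le> 1" for n using c by (auto simp: power_le_one)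
  have \<eta>pos: "0 \<le> \<eta> s" if "0 \<le> s" for s using \<eta>(1)[of 0 s] \<eta>(2) that by auto
  have notlow0: "\<not> low k0 j0"
    using Suc.prems(8) by (fastforce simp: low_def S_def)
  have step: "\<exists>Bad\<in>sets borel. Bad \<subseteq> dyadic_cell k j \<and>
     emeasure lborel Bad \<le> ennreal (real (Suc m) * ?b) * emeasure lborel (dyadic_cell k j) \<and>
     (\<forall>x\<in>dyadic_cell k j - Bad. chain_protected R P \<psi> F \<epsilon> \<rho> (c ^ Suc m * \<rho>) x)" if "(k, j) \<in> \<D>" for k j
  proof -
    from that have kj: "k0 < k" "dyadic_cell k j \<subseteq> dyadic_cell k0 j0" "low k j" "\<not> low (k - 1) (j div 2)"
      by (auto simp: \<D>_def)
    obtain E0 where E0: "E0 \<in> S" "\<And>y. y \<in> dyadic_cell k j \<Longrightarrow> \<psi> E0 y < \<rho>"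
      using kj(3) by (auto simp: low_def)
    have cell01: "dyadic_cell k j \<subseteq> {0..<1}" using kj(2) Suc.prems(5) by blast
    obtain z where z: "z \<in> dyadic_cell k j" using dyadic_cell_nonempty by blast
    have par: "dyadic_cell k j \<subseteq> dyadic_cell (k - 1) (j div 2)" using dyadic_cell_parent kj(1) by auto
    have "dyadic_cell (k - 1) (j div 2) \<subseteq> dyadic_cell k0 j0"
      by (rule dyadic_cell_nested[of k0 "k - 1" z]) (use z kj(1,2) par in auto)
    then have par01: "dyadic_cell (k - 1) (j div 2) \<subseteq> {0..<1}" using Suc.prems(5) by blast
    \<comment> \<open>Otherwise the whole cell, which is half of its parent, would lie in the
      sublevel set of height c times a value on the parent that is at least \<rho>, against \<eta> c
      < 1 / 2.\<close>
    have reach: "\<exists>y\<in>dyadic_cell k j. c * \<rho> \<le> \<psi> E y" if ES: "E \<in> S" for E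
    proof (rule ccontr)
      assume a: "\<not> ?thesis"
      obtain y where y: "y \<in> dyadic_cell (k - 1) (j div 2)" "\<rho> \<le> \<psi> E y"
        using kj(4) ES unfolding low_def by (meson not_le)
      have "\<psi> E x < c * \<psi> E y" if "x \<in> dyadic_cell k j" for x
        using a that mult_left_mono[OF y(2), of c] c by (smt (verit))
      then have sub: "dyadic_cell k j \<subseteq> {x \<in> dyadic_cell (k - 1) (j div 2). \<psi> E x < c * \<psi> E y}"
        using par by auto
      have EP: "E \<in> P" using ES by (simp add: S_def)
      have "emeasure lborel (dyadic_cell k j) \<le> emeasure lborel {x \<in> dyadic_cell (k - 1) (j div 2). \<psi> E x < c * \<psi> E y}"
        by (rule emeasure_mono[OF sub]) (use meas[OF EP par01] in simp)
      also have "\<dots> \<le> ennreal (\<eta> c) * emeasure lborel (dyadic_cell (k - 1) (j div 2))"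
        using good[OF EP par01 y(1)] c by simp
      finally have "1 / 2 ^ k \<le> \<eta> c * (1 / 2 ^ (k - 1))"
        using \<eta>pos[of c] c by (simp add: emeasure_dyadic_cell ennreal_mult[symmetric])
      also have "\<dots> = 2 * \<eta> c * (1 / 2 ^ k)" using kj(1) by (cases k) auto
      finally have "1 \<le> 2 * \<eta> c" by (simp add: divide_le_cancel)
      then show False using c(3) by simp
    qed
    have E0P: "E0 \<in> P" "E0 \<notin> F" "\<And>D. D \<in> F \<Longrightarrow> R E0 D" using E0(1) by (auto simp: S_def)
    \<comment> \<open>The threshold drops to c * \<rho>, and c ^ m * (c * \<rho>) equals c ^ Suc m *
      \<rho>: all levels of the recursion share the same final bound and the same error term
      \<open>?b\<close>.\<close>
    have IH: "\<exists>Bad\<in>sets borel. Bad \<subseteq> dyadic_cell k j \<and>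
       emeasure lborel Bad \<le> ennreal (real m * \<eta> (\<epsilon> / (c ^ m * (c * \<rho>)))) * emeasure lborel (dyadic_cell k j) \<and>
       (\<forall>x\<in>dyadic_cell k j - Bad. chain_protected R P \<psi> (insert E0 F) \<epsilon> (c * \<rho>) (c ^ m * (c * \<rho>)) x)"
    proof (rule Suc.IH)
      show "pairwise_rel R (insert E0 F)"
        using E0P(3) R Suc.prems(3) unfolding pairwise_rel_def by blast
      show "\<exists>y\<in>dyadic_cell k j. c * \<rho> \<le> \<psi> E y" if "E \<in> P - insert E0 F" "\<And>D. D \<in> insert E0 F \<Longrightarrow> R E D" for E
        using that by (intro reach) (auto simp: S_def)
    qed (use Suc.prems E0P cell01 c in auto)
    then obtain B1 where B1: "B1 \<in> sets borel" "B1 \<subseteq> dyadic_cell k j"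
       "emeasure lborel B1 \<le> ennreal (real m * ?b) * emeasure lborel (dyadic_cell k j)"
       "\<And>x. x\<in>dyadic_cell k j - B1 \<Longrightarrow> chain_protected R P \<psi> (insert E0 F) \<epsilon> (c * \<rho>) (c ^ m * (c * \<rho>)) x"
      by (auto simp: mult_ac)
    \<comment> \<open>\<open>E0\<close> is below \<rho> on the whole cell. Off \<open>B2\<close> it
      is also at least \<epsilon>, hence a legitimate member of the chain; the price is one more
      error term \<open>?b\<close>.\<close>
    define B2 where "B2 = {x \<in> dyadic_cell k j. \<psi> E0 x < \<epsilon>}"
    have B2m: "B2 \<in> sets borel" unfolding B2_def by (rule meas[OF E0P(1) cell01])
    obtain y where y: "y \<in> dyadic_cell k j" "c * \<rho> \<le> \<psi> E0 y" using reach[OF E0(1)] by blast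
    have cr: "0 < c * \<rho>" using c Suc.prems(6) by simp
    have "emeasure lborel B2 \<le> emeasure lborel {x \<in> dyadic_cell k j. \<psi> E0 x < \<epsilon> / (c * \<rho>) * \<psi> E0 y}"
    proof (rule emeasure_mono)
      have "\<epsilon> \<le> \<epsilon> / (c * \<rho>) * \<psi> E0 y"
        using mult_left_mono[OF y(2), of "\<epsilon>"] cr Suc.prems(7) by (simp add: pos_le_divide_eq)
      then show "B2 \<subseteq> {x \<in> dyadic_cell k j. \<psi> E0 x < \<epsilon> / (c * \<rho>) * \<psi> E0 y}"
        by (auto simp: B2_def)
    qed (use meas[OF E0P(1) cell01] in simp)
    also have "\<dots> \<le> ennreal (\<eta> (\<epsilon> / (c * \<rho>))) * emeasure lborel (dyadic_cell k j)"
      by (rule good[OF E0P(1) cell01 y(1)]) (use cr Suc.prems(7) in auto)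
    also have "\<dots> \<le> ennreal ?b * emeasure lborel (dyadic_cell k j)"
    proof -
      have "c ^ Suc m * \<rho> \<le> c * \<rho>"
        using mult_right_mono[OF cm(2)[of m], of "c * \<rho>"] cr by (simp add: mult_ac)
      moreover have "0 < c ^ Suc m * \<rho>" by (rule mult_pos_pos[OF cm(1) Suc.prems(6)])
      ultimately have "\<epsilon> / (c * \<rho>) \<le> \<epsilon> / (c ^ Suc m * \<rho>)"
        using cr Suc.prems(7) by (intro divide_left_mono) auto
      then have "\<eta> (\<epsilon> / (c * \<rho>)) \<le> ?b"
        using cr Suc.prems(7) by (intro \<eta>(1)) auto
      then show ?thesis by (intro mult_right_mono ennreal_leI) auto
    qed
    finally have B2: "emeasure lborel B2 \<le> ennreal ?b * emeasure lborel (dyadic_cell k j)" .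
    have b0: "0 \<le> ?b" 
      by (rule \<eta>pos) (use mult_pos_pos[OF cm(1)[of "Suc m"] Suc.prems(6)] Suc.prems(7) in simp)
    show ?thesis
    proof (intro bexI[of _ "B1 \<union> B2"] conjI ballI)
      have "emeasure lborel (B1 \<union> B2) \<le> emeasure lborel B1 + emeasure lborel B2"
        by (rule emeasure_subadditive) (use B1 B2m in auto)
      also have "\<dots> \<le> ennreal (real m * ?b) * emeasure lborel (dyadic_cell k j) + ennreal ?b * emeasure lborel (dyadic_cell k j)"
        by (intro add_mono B1 B2)
      also have "\<dots> = ennreal (real (Suc m) * ?b) * emeasure lborel (dyadic_cell k j)"
      proof -
        have "real (Suc m) * ?b = real m * ?b + ?b" by (simp add: algebra_simps)
        then have "ennreal (real (Suc m) * ?b) = ennreal (real m * ?b) + ennreal ?b"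
          using b0 by (simp only: ennreal_plus[symmetric] mult_nonneg_nonneg of_nat_0_le_iff)
        then show ?thesis by (simp only: distrib_right)
      qed
      finally show "emeasure lborel (B1 \<union> B2) \<le> ennreal (real (Suc m) * ?b) * emeasure lborel (dyadic_cell k j)" .
      show "B1 \<union> B2 \<subseteq> dyadic_cell k j" using B1 by (auto simp: B2_def)
      show "B1 \<union> B2 \<in> sets borel" using B1 B2m by auto
      fix x assume x: "x \<in> dyadic_cell k j - (B1 \<union> B2)"
      then have "chain_protected R P \<psi> (insert E0 F) \<epsilon> (c * \<rho>) (c ^ m * (c * \<rho>)) x"
        by (intro B1(4)) auto
      then obtain G where G: "insert E0 F \<subseteq> G" "G \<subseteq> P" "finite G" "pairwise_rel R G"
          "\<And>E. E\<in>G - insert E0 F \<Longrightarrow> \<epsilon> \<le> \<psi> E x \<and> \<psi> E x \<le> c * \<rho>"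
          "\<And>E. E\<in>P-G \<Longrightarrow> (\<forall>D\<in>G. R E D) \<Longrightarrow> c ^ m * (c * \<rho>) \<le> \<psi> E x"
        unfolding chain_protected_def by blast
      have "\<epsilon> \<le> \<psi> E x \<and> \<psi> E x \<le> \<rho>" if "E \<in> G - F" for E
      proof (cases "E = E0")
        case True
        then show ?thesis using x E0(2)[of x] by (auto simp: B2_def not_less)
      next
        case False
        have "c * \<rho> \<le> \<rho>" using c Suc.prems(6) by simp
        then show ?thesis using G(5)[of E] that False by auto
      qed
      then show "chain_protected R P \<psi> F \<epsilon> \<rho> (c ^ Suc m * \<rho>) x"
        unfolding chain_protected_def using G by (intro exI[of _ G]) (auto simp: mult_ac)
    qed
  qed
  then obtain B where B: "\<And>p. p \<in> \<D> \<Longrightarrow> B p \<in> sets borel"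
     "\<And>k j. (k, j) \<in> \<D> \<Longrightarrow> B (k, j) \<subseteq> dyadic_cell k j"
     "\<And>k j. (k, j) \<in> \<D> \<Longrightarrow> emeasure lborel (B (k, j)) \<le> ennreal (real (Suc m) * ?b) * emeasure lborel (dyadic_cell k j)"
     "\<And>k j x. (k, j) \<in> \<D> \<Longrightarrow> x\<in>dyadic_cell k j - B (k, j) \<Longrightarrow> chain_protected R P \<psi> F \<epsilon> \<rho> (c ^ Suc m * \<rho>) x"
  proof -
    have "\<forall>p\<in>\<D>. \<exists>Bad. Bad\<in>sets borel \<and> Bad \<subseteq> dyadic_cell (fst p) (snd p) \<and>
     emeasure lborel Bad \<le> ennreal (real (Suc m) * ?b) * emeasure lborel (dyadic_cell (fst p) (snd p)) \<and>
     (\<forall>x\<in>dyadic_cell (fst p) (snd p) - Bad. chain_protected R P \<psi> F \<epsilon> \<rho> (c ^ Suc m * \<rho>) x)"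
      using step by (auto simp: Bex_def)
    from bchoice[OF this] obtain B where BB: "\<forall>p\<in>\<D>. B p\<in>sets borel \<and> B p \<subseteq> dyadic_cell (fst p) (snd p) \<and>
     emeasure lborel (B p) \<le> ennreal (real (Suc m) * ?b) * emeasure lborel (dyadic_cell (fst p) (snd p)) \<and>
     (\<forall>x\<in>dyadic_cell (fst p) (snd p) - B p. chain_protected R P \<psi> F \<epsilon> \<rho> (c ^ Suc m * \<rho>) x)" by blast
    show thesis
    proof (rule that[of B])
      show "B p \<in> sets borel" if "p \<in> \<D>" for p using BB that by blast
      fix k j assume kj: "(k, j) \<in> \<D>"
      show "B (k, j) \<subseteq> dyadic_cell k j" using bspec[OF BB kj] by simp
      show "emeasure lborel (B (k, j)) \<le> ennreal (real (Suc m) * ?b) * emeasure lborel (dyadic_cell k j)"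
        using bspec[OF BB kj] by simp
      fix x assume "x \<in> dyadic_cell k j - B (k, j)"
      then show "chain_protected R P \<psi> F \<epsilon> \<rho> (c ^ Suc m * \<rho>) x"
        using bspec[OF BB kj] by simp
    qed
  qed
  \<comment> \<open>Of two overlapping cells of different levels the smaller has its parent inside
    the larger one, which is low; this contradicts maximality. Disjointness makes the error terms
    add up to the same proportion of the starting cell.\<close>
  have disj: "(k, j) = (k', j')" if "(k, j) \<in> \<D>" "(k', j') \<in> \<D>" "k \<le> k'"
    "y \<in> dyadic_cell k j" "y \<in> dyadic_cell k' j'" for k j k' j' y
  proof (cases "k = k'")
    case True
    then show ?thesis using that by (auto simp: dyadic_cell_def)
  next
    case False
    then have k: "k \<le> k' - 1" "0 < k'" using that by auto
    have "y \<in> dyadic_cell (k' - 1) (j' div 2)" using dyadic_cell_parent[OF k(2)] that by auto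
    then have "dyadic_cell (k' - 1) (j' div 2) \<subseteq> dyadic_cell k j"
      using dyadic_cell_nested[OF k(1)] that by auto
    then have "low (k' - 1) (j' div 2)" using that(1) by (fastforce simp: \<D>_def low_def)
    then show ?thesis using that by (auto simp: \<D>_def)
  qed
  have dfam: "disjoint_family_on (\<lambda>p. dyadic_cell (fst p) (snd p)) \<D>"
    unfolding disjoint_family_on_def
  proof (intro ballI impI)
    fix p q assume a: "p \<in> \<D>" "q \<in> \<D>" "p \<noteq> q"
    show "dyadic_cell (fst p) (snd p) \<inter> dyadic_cell (fst q) (snd q) = {}"
    proof (rule ccontr)
      assume "\<not> ?thesis"
      then obtain y where "y \<in> dyadic_cell (fst p) (snd p)" "y \<in> dyadic_cell (fst q) (snd q)" by auto
      then show False using disj[of "fst p" "snd p" "fst q" "snd q" y] disj[of "fst q" "snd q" "fst p" "snd p" y] a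
        by (cases "fst p \<le> fst q") auto
    qed
  qed
  have Bsub: "B p \<subseteq> dyadic_cell (fst p) (snd p)" if "p \<in> \<D>" for p using B(2)[of "fst p" "snd p"] that by simp
  have Bdis: "disjoint_family_on B \<D>"
    using dfam Bsub unfolding disjoint_family_on_def by blast
  have cnt: "countable \<D>" by simp
  show ?case
  proof (intro bexI[of _ "\<Union>p\<in>\<D>. B p"] conjI ballI)
    show "(\<Union>p\<in>\<D>. B p) \<in> sets borel" using B(1) cnt by (intro sets.countable_UN') auto
    show "(\<Union>p\<in>\<D>. B p) \<subseteq> dyadic_cell k0 j0" using Bsub by (fastforce simp: \<D>_def)
    have "emeasure lborel (\<Union>p\<in>\<D>. B p) = (\<integral>\<^sup>+p. emeasure lborel (B p) \<partial>count_space \<D>)"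
      by (rule emeasure_UN_countable) (use B(1) cnt Bdis in auto)
    also have "\<dots> \<le> (\<integral>\<^sup>+p. ennreal (real (Suc m) * ?b) * emeasure lborel (dyadic_cell (fst p) (snd p)) \<partial>count_space \<D>)"
      by (rule nn_integral_mono) (use B(3) in auto)
    also have "\<dots> = ennreal (real (Suc m) * ?b) * (\<integral>\<^sup>+p. emeasure lborel (dyadic_cell (fst p) (snd p)) \<partial>count_space \<D>)"
      by (rule nn_integral_cmult) auto
    also have "(\<integral>\<^sup>+p. emeasure lborel (dyadic_cell (fst p) (snd p)) \<partial>count_space \<D>)
        = emeasure lborel (\<Union>p\<in>\<D>. dyadic_cell (fst p) (snd p))"
      by (rule emeasure_UN_countable[symmetric]) (use cnt dfam in auto)
    also have "ennreal (real (Suc m) * ?b) * \<dots> \<le> ennreal (real (Suc m) * ?b) * emeasure lborel (dyadic_cell k0 j0)"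
      by (intro mult_left_mono emeasure_mono) (auto simp: \<D>_def)
    finally show "emeasure lborel (\<Union>p\<in>\<D>. B p) \<le> ennreal (real (Suc m) * ?b) * emeasure lborel (dyadic_cell k0 j0)" .
    fix x assume x: "x \<in> dyadic_cell k0 j0 - (\<Union>p\<in>\<D>. B p)"
    show "chain_protected R P \<psi> F \<epsilon> \<rho> (c ^ Suc m * \<rho>) x"
    proof (cases "\<exists>k j. (k, j) \<in> \<D> \<and> x \<in> dyadic_cell k j")
      case True
      then obtain k j where "(k, j) \<in> \<D>" "x \<in> dyadic_cell k j" by blast
      then show ?thesis using x by (intro B(4)) auto
    next
      case False
      \<comment> \<open>Off the maximal low cells no weight comparable with \<open>F\<close> is
        below \<rho>: by continuity it would stay below on a small cell around x, and the coarsest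
        low cell around x inside the starting cell belongs to \<D>. So \<open>G = F\<close> serves
        here.\<close>
      have ge: "\<rho> \<le> \<psi> E x" if ES: "E \<in> S" for E
      proof (rule ccontr)
        assume "\<not> \<rho> \<le> \<psi> E x"
        then have lt: "\<psi> E x < \<rho>" by simp
        have EP: "E \<in> P" using ES by (simp add: S_def)
        have x01: "x \<in> {0..<1}" using x Suc.prems(5) by auto
        from cont[OF EP] x01 lt obtain d where d: "d > 0"
          "\<And>y. y \<in> {0..<1} \<Longrightarrow> dist y x < d \<Longrightarrow> dist (\<psi> E y) (\<psi> E x) < \<rho> - \<psi> E x"
          unfolding continuous_on_iff by (metis diff_gt_0_iff_gt)
        obtain n where n: "1 / 2 ^ n < d" using d(1) real_arch_pow_inv[of d "1/2"] by (auto simp: power_one_over)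
        define k1 where "k1 = max n k0"
        have "low k1 \<lfloor>2 ^ k1 * x\<rfloor>" unfolding low_def
        proof (intro bexI[OF _ ES] ballI)
          fix y assume y: "y \<in> dyadic_cell k1 \<lfloor>2 ^ k1 * x\<rfloor>"
          have xk: "x \<in> dyadic_cell k1 \<lfloor>2 ^ k1 * x\<rfloor>" by (simp add: dyadic_cell_def)
          have "dyadic_cell k1 \<lfloor>2 ^ k1 * x\<rfloor> \<subseteq> dyadic_cell k0 j0"
            by (rule dyadic_cell_nested[OF _ _ xk]) (use x in \<open>auto simp: k1_def\<close>)
          then have "y \<in> {0..<1}" using y Suc.prems(5) by auto
          moreover have "\<bar>y - x\<bar> \<le> 1 / 2 ^ k1" by (rule dyadic_cell_dist[OF y xk])
          moreover have "1 / 2 ^ k1 \<le> (1 / 2 ^ n :: real)"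
            by (intro divide_left_mono power_increasing) (auto simp: k1_def)
          ultimately show "\<psi> E y < \<rho>" using d(2)[of y] n by (simp add: dist_real_def)
        qed
        then have ex: "\<exists>k. k0 \<le> k \<and> low k \<lfloor>2 ^ k * x\<rfloor>" by (intro exI[of _ k1]) (auto simp: k1_def)
        define k where "k = (LEAST k. k0 \<le> k \<and> low k \<lfloor>2 ^ k * x\<rfloor>)"
        have k: "k0 \<le> k" "low k \<lfloor>2 ^ k * x\<rfloor>" using LeastI_ex[OF ex] by (auto simp: k_def)
        have x0: "\<lfloor>2 ^ k0 * x\<rfloor> = j0" using x by (simp add: dyadic_cell_def)
        have "k \<noteq> k0" using k notlow0 x0 by auto
        then have kk: "k0 < k" using k by simp
        have "\<not> low (k - 1) \<lfloor>2 ^ (k - 1) * x\<rfloor>"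
          using not_less_Least[of "k - 1" "\<lambda>k. k0 \<le> k \<and> low k \<lfloor>2 ^ k * x\<rfloor>"] kk by (auto simp: k_def)
        then have nl: "\<not> low (k - 1) (\<lfloor>2 ^ k * x\<rfloor> div 2)"
          using floor_dyadic_div[of "k - 1" k x] kk by simp
        have xk: "x \<in> dyadic_cell k \<lfloor>2 ^ k * x\<rfloor>" by (simp add: dyadic_cell_def)
        have "dyadic_cell k \<lfloor>2 ^ k * x\<rfloor> \<subseteq> dyadic_cell k0 j0"
          by (rule dyadic_cell_nested[OF k(1) _ xk]) (use x in auto)
        then have "(k, \<lfloor>2 ^ k * x\<rfloor>) \<in> \<D>" using kk k nl by (simp add: \<D>_def)
        then show False using False xk by blast
      qed
      have "c ^ Suc m * \<rho> \<le> \<psi> E x" if "E \<in> P - F" "\<forall>D\<in>F. R E D" for E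
      proof -
        have "c ^ Suc m * \<rho> \<le> 1 * \<rho>" by (rule mult_right_mono[OF cm(2)]) (use Suc.prems(6) in simp)
        also have "\<dots> \<le> \<psi> E x" using ge[of E] that by (simp add: S_def)
        finally show ?thesis .
      qed
      then show ?thesis unfolding chain_protected_def using Suc.prems(1-3) by (intro exI[of _ F]) auto
    qed
  qed
qed

section \<open>Covolumes of rational subspaces\<close>

text \<open>Completing the vectors to a square matrix lets \<open>det\<close> do the work of
  exterior algebra; the rows outside \<open>S\<close> play the part of test vectors.\<close>

definition mix_rows :: "'m set \<Rightarrow> ('m \<Rightarrow> real^'m) \<Rightarrow> ('m \<Rightarrow> real^'m) \<Rightarrow> real^'m^'m" where
  "mix_rows S w u = (\<chi> i. if i \<in> S then w i else u i)"

text \<open>Expanding along the coordinate rows, these determinants are the maximal minors of the rows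
  \<open>w i\<close> with \<open>i \<in> S\<close>, so this is the sup-norm of the exterior product of these vectors.\<close>

definition covol :: "'m::finite set \<Rightarrow> ('m \<Rightarrow> real^'m) \<Rightarrow> real" where
  "covol S w = Max (range (\<lambda>\<sigma>::'m \<Rightarrow> 'm. \<bar>det (mix_rows S w (\<lambda>i. axis (\<sigma> i) 1))\<bar>))"

lemma covol_ge: "\<bar>det (mix_rows S w (\<lambda>i. axis (\<sigma> i) 1))\<bar> \<le> covol S w"
  unfolding covol_def by (rule Max_ge) auto

lemma covol_attained: "\<exists>\<sigma>. covol S w = \<bar>det (mix_rows S w (\<lambda>i. axis (\<sigma> i) 1))\<bar>"
proof -
  have "covol S w \<in> range (\<lambda>\<sigma>::'a \<Rightarrow> 'a. \<bar>det (mix_rows S w (\<lambda>i. axis (\<sigma> i) 1))\<bar>)"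
    unfolding covol_def by (rule Max_in) auto
  then show ?thesis by auto
qed

lemma covol_le: "(\<And>\<sigma>. \<bar>det (mix_rows S w (\<lambda>i. axis (\<sigma> i) 1))\<bar> \<le> C) \<Longrightarrow> covol S w \<le> C"
  using covol_attained[of S w] by metis

lemma covol_nonneg: "0 \<le> covol S w"
  using covol_attained[of S w] by (metis abs_ge_zero)

lemma det_mix_rows_expand:
  assumes "i \<notin> S"
  shows "det (mix_rows S w u) = (\<Sum>m\<in>UNIV. u i $ m * det (mix_rows S w (u(i := axis m 1))))"
proof -
  define c where "c = ($) (mix_rows S w u)"
  have "mix_rows S w u = (\<chi> r. if r = i then (\<Sum>m\<in>UNIV. (u i $ m) *s axis m 1) else c r)"
    using assms by (simp add: vec_eq_iff mix_rows_def basis_expansion c_def)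
  then have "det (mix_rows S w u) =
      (\<Sum>m\<in>UNIV. u i $ m * det (\<chi> r. if r = i then axis m 1 else c r))"
    by (simp add: det_linear_row_sum det_row_mul)
  also have "(\<lambda>m. (\<chi> r. if r = i then axis m 1 else c r)) = (\<lambda>m. mix_rows S w (u(i := axis m 1)))"
    using assms by (auto simp: vec_eq_iff mix_rows_def fun_eq_iff c_def)
  finally show ?thesis .
qed

text \<open>The rows in \<open>T\<close> are expanded in coordinate vectors one after another, each
  expansion costing a factor \<open>CARD('m) * C\<close>.\<close>

lemma det_mix_rows_bound:
  fixes w :: "'m::finite \<Rightarrow> real^'m"
  assumes "finite T" "T \<inter> S = {}" "0 \<le> C"
    and "\<And>i m. i \<in> T \<Longrightarrow> \<bar>u i $ m\<bar> \<le> C" "\<And>i. i \<notin> S \<union> T \<Longrightarrow> u i = axis (\<sigma> i) 1"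
  shows "\<bar>det (mix_rows S w u)\<bar> \<le> (real CARD('m) * C) ^ card T * covol S w"
  using assms
proof (induction T arbitrary: u \<sigma> rule: finite_induct)
  case empty
  have "mix_rows S w u = mix_rows S w (\<lambda>i. axis (\<sigma> i) 1)"
    using empty by (simp add: mix_rows_def vec_eq_iff)
  then show ?case using covol_ge[of S w \<sigma>] by simp
next
  case (insert i T)
  have i: "i \<notin> S" using insert by auto
  have "\<bar>det (mix_rows S w u)\<bar> \<le> (\<Sum>m\<in>UNIV. \<bar>u i $ m * det (mix_rows S w (u(i := axis m 1)))\<bar>)"
    by (subst det_mix_rows_expand[OF i]) (rule sum_abs)
  also have "\<dots> \<le> (\<Sum>m\<in>(UNIV::'m set). C * ((real CARD('m) * C) ^ card T * covol S w))"
  proof (rule sum_mono)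
    fix m
    have "\<bar>det (mix_rows S w (u(i := axis m 1)))\<bar> \<le> (real CARD('m) * C) ^ card T * covol S w"
      by (rule insert.IH[of _ "\<sigma>(i := m)"]) (use insert in auto)
    then show "\<bar>u i $ m * det (mix_rows S w (u(i := axis m 1)))\<bar> \<le> C * ((real CARD('m) * C) ^ card T * covol S w)"
      unfolding abs_mult by (intro mult_mono) (use insert in auto)
  qed
  also have "\<dots> = (real CARD('m) * C) ^ card (insert i T) * covol S w" using insert by simp
  finally show ?case .
qed

lemma covol_insert:
  fixes w :: "'m::finite \<Rightarrow> real^'m"
  assumes "i \<notin> S" "\<And>m. \<bar>v $ m\<bar> \<le> C"
  shows "covol (insert i S) (w(i := v)) \<le> real CARD('m) * C * covol S w"
proof (rule covol_le)
  fix \<sigma>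
  have C: "0 \<le> C" using assms(2) abs_ge_zero order_trans by blast
  have "mix_rows (insert i S) (w(i := v)) (\<lambda>i. axis (\<sigma> i) 1) = mix_rows S w ((\<lambda>i. axis (\<sigma> i) 1)(i := v))"
    using assms by (auto simp: mix_rows_def vec_eq_iff)
  then show "\<bar>det (mix_rows (insert i S) (w(i := v)) (\<lambda>i. axis (\<sigma> i) 1))\<bar> \<le> real CARD('m) * C * covol S w"
    using det_mix_rows_bound[of "{i}" S C "(\<lambda>i. axis (\<sigma> i) 1)(i := v)" \<sigma> w] assms C by simp
qed

text \<open>Steinitz exchange. With the coordinate vectors as \<open>U\<close> it gives positivity
  of covolumes, with integer vectors of bounded image it gives their lower bound.\<close>

lemma mix_rows_extend:
  fixes w :: "'m::finite \<Rightarrow> real^'m"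
  assumes w: "inj_on w S" "independent (w ` S)" and U: "span U = UNIV"
  shows "\<exists>u. (\<forall>i. i \<notin> S \<longrightarrow> u i \<in> U) \<and> det (mix_rows S w u) \<noteq> 0"
proof -
  obtain B where B: "w ` S \<subseteq> B" "B \<subseteq> w ` S \<union> U" "independent B" "w ` S \<union> U \<subseteq> span B"
    using maximal_independent_subset_extend[of "w ` S" "w ` S \<union> U"] w by blast
  have "span U \<subseteq> span B" using B(4) by (intro span_minimal) auto
  then have spB: "span B = UNIV" using U by auto
  have fB: "finite B" using B(3) by (rule independent_imp_finite)
  have cB: "card B = CARD('m)"
    using dim_eq_card_independent[OF B(3)] spB dim_span[of B] by (simp add: dim_UNIV)
  have "card (B - w ` S) = card (- S)"
    using cB w B(1) fB by (simp add: card_Diff_subset card_image Compl_eq_Diff_UNIV)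
  then obtain f where f: "bij_betw f (- S) (B - w ` S)"
    using finite_same_card_bij[of "- S" "B - w ` S"] fB by fastforce
  have fU: "f i \<in> U" if "i \<notin> S" for i
    using f that B(2) unfolding bij_betw_def by blast
  have "rows (mix_rows S w f) = w ` S \<union> f ` (- S)"
    unfolding rows_def row_def mix_rows_def by (auto simp: image_iff split: if_splits)
  also have "\<dots> = B" using f B(1) unfolding bij_betw_def by auto
  finally have "span (rows (mix_rows S w f)) = UNIV" using spB by simp
  then have "det (mix_rows S w f) \<noteq> 0"
    using matrix_left_invertible_span_rows[of "mix_rows S w f"]
    by (metis invertible_det_nz invertible_left_inverse)
  then show ?thesis using fU by blast
qed

lemma span_axis_UNIV: "span (range (\<lambda>i. axis i 1 :: real^'m::finite)) = UNIV"
proof -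
  have "x \<in> span (range (\<lambda>i. axis i 1))" for x :: "real^'m"
  proof -
    have "(\<Sum>i\<in>UNIV. (x $ i) *\<^sub>R (axis i 1 :: real^'m)) \<in> span (range (\<lambda>i. axis i 1))"
      by (intro span_sum span_scale span_base) auto
    then show ?thesis using basis_expansion[of x] by (simp add: scalar_mult_eq_scaleR)
  qed
  then show ?thesis by auto
qed

lemma covol_pos:
  fixes w :: "'m::finite \<Rightarrow> real^'m"
  assumes "inj_on w S" "independent (w ` S)"
  shows "0 < covol S w"
proof -
  from mix_rows_extend[OF assms span_axis_UNIV] obtain u where
    u: "\<And>i. i \<notin> S \<Longrightarrow> u i \<in> range (\<lambda>i. axis i 1)" "det (mix_rows S w u) \<noteq> 0" by blast
  then have "\<forall>i. \<exists>j. i \<notin> S \<longrightarrow> u i = axis j 1" by blast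
  then obtain \<sigma> where "\<And>i. i \<notin> S \<Longrightarrow> u i = axis (\<sigma> i) 1" by metis
  then have "mix_rows S w u = mix_rows S w (\<lambda>i. axis (\<sigma> i) 1)" by (simp add: mix_rows_def vec_eq_iff)
  then show ?thesis using covol_ge[of S w \<sigma>] u(2) by (metis abs_le_zero_iff not_le_imp_less order_trans)
qed

text \<open>The coefficients of \<open>w'\<close> in terms of \<open>w\<close>, completed by the
  identity on the rows outside \<open>S\<close>, form a matrix that factors out on the left. Linear
  maps respect the combinations, so the factor r is the same for every h and u.\<close>

lemma det_mix_rows_proportional:
  fixes w w' :: "'m::finite \<Rightarrow> real^'m"
  assumes "inj_on w S" "\<And>i. i \<in> S \<Longrightarrow> w' i \<in> span (w ` S)"
  shows "\<exists>r. \<forall>h u. linear h \<longrightarrow> det (mix_rows S (h \<circ> w') u) = r * det (mix_rows S (h \<circ> w) u)"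
proof -
  have "\<exists>c. i \<in> S \<longrightarrow> w' i = (\<Sum>k\<in>S. c k *\<^sub>R w k)" for i
  proof (cases "i \<in> S")
    case True
    then have "w' i \<in> range (\<lambda>u. \<Sum>v\<in>w ` S. u v *\<^sub>R v)" using assms(2) span_finite[of "w ` S"] by auto
    then obtain c where "w' i = (\<Sum>v\<in>w ` S. c v *\<^sub>R v)" by auto
    then have "w' i = (\<Sum>k\<in>S. (c \<circ> w) k *\<^sub>R w k)" by (simp add: sum.reindex[OF assms(1)])
    then show ?thesis by blast
  qed auto
  then obtain c where c: "\<And>i. i \<in> S \<Longrightarrow> w' i = (\<Sum>k\<in>S. c i k *\<^sub>R w k)" by metis
  define C :: "real^'m^'m" where
    "C = (\<chi> i j. if i \<in> S then (if j \<in> S then c i j else 0) else (if i = j then 1 else 0))"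
  have "mix_rows S (h \<circ> w') u = C ** mix_rows S (h \<circ> w) u" if h: "linear h" for h u
  proof -
    have "(C ** mix_rows S (h \<circ> w) u) $ i $ j = mix_rows S (h \<circ> w') u $ i $ j" for i j
    proof (cases "i \<in> S")
      case True
      have "(C ** mix_rows S (h \<circ> w) u) $ i $ j = (\<Sum>k\<in>UNIV. (if k \<in> S then c i k * h (w k) $ j else 0))"
        unfolding matrix_matrix_mult_def using True by (auto simp: C_def mix_rows_def intro!: sum.cong)
      also have "\<dots> = (\<Sum>k\<in>S. c i k * h (w k) $ j)" by (simp add: sum.If_cases)
      also have "\<dots> = h (w' i) $ j"
        by (simp add: c[OF True] linear_sum[OF h] linear_scale[OF h])
      finally show ?thesis using True by (simp add: mix_rows_def)
    next
      case False
      have Ci: "C $ i $ k = (if k = i then 1 else 0)" for k using False by (auto simp: C_def)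
      have "(C ** mix_rows S (h \<circ> w) u) $ i $ j = (\<Sum>k\<in>UNIV. (if k = i then mix_rows S (h \<circ> w) u $ k $ j else 0))"
        by (simp add: matrix_matrix_mult_def Ci if_distrib[of "\<lambda>x. x * _"] cong: if_cong)
      then show ?thesis using False by (simp add: mix_rows_def)
    qed
    then show ?thesis by (simp add: vec_eq_iff)
  qed
  then show ?thesis by (intro exI[of _ "det C"]) (simp add: det_mul)
qed

lemma det_mix_rows_linear:
  assumes "linear h"
  shows "det (mix_rows S (h \<circ> w) (h \<circ> u)) = det (mix_rows S w u) * det (matrix h)"
proof -
  have h: "h x $ j = (\<Sum>k\<in>UNIV. x $ k * matrix h $ j $ k)" for x j
  proof -
    have "matrix h *v x = h x" using assms by (intro matrix_works) (simp add: linear_matrix_vector_mul_eq)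
    then show ?thesis by (metis (no_types, lifting) matrix_vector_mult_def mult.commute sum.cong vec_lambda_beta)
  qed
  have "mix_rows S (h \<circ> w) (h \<circ> u) = mix_rows S w u ** transpose (matrix h)"
    by (auto simp: vec_eq_iff mix_rows_def matrix_matrix_mult_def transpose_def h)
  then show ?thesis by (simp add: det_mul det_transpose)
qed

section \<open>Rational subspaces and their integer bases\<close>

definition int_vectors :: "(real^'m) set" where
  "int_vectors = {v. \<forall>i. v $ i \<in> \<int>}"

lemma det_int: "(\<And>i j. A $ i $ j \<in> \<int>) \<Longrightarrow> det (A :: real^'m::finite^'m) \<in> \<int>"
  unfolding det_def by (intro Ints_sum Ints_mult Ints_prod) auto

text \<open>One fixed index set per cardinality, increasing in j: bases of all j-dimensional
  subspaces occupy the same rows, and raising the dimension by one adds a single row.\<close>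

definition initial_indices :: "nat \<Rightarrow> 'm::finite set" where
  "initial_indices j = set (take j (SOME xs. distinct xs \<and> set xs = UNIV))"

lemma card_initial_indices: "j \<le> CARD('m) \<Longrightarrow> card (initial_indices j :: 'm::finite set) = j"
  and initial_indices_Suc: "j < CARD('m) \<Longrightarrow>
    \<exists>i. i \<notin> initial_indices j \<and> (initial_indices (Suc j) :: 'm set) = insert i (initial_indices j)"
proof -
  let ?xs = "SOME xs. distinct xs \<and> set xs = (UNIV :: 'm set)"
  have "\<exists>xs. distinct xs \<and> set xs = (UNIV :: 'm set)"
    using finite_distinct_list[of "UNIV :: 'm set"] by auto
  from someI_ex[OF this] have d: "distinct ?xs" and s: "set ?xs = UNIV" by auto
  have len: "length ?xs = CARD('m)" using distinct_card[OF d] s by simp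
  show "j \<le> CARD('m) \<Longrightarrow> card (initial_indices j :: 'm set) = j"
    unfolding initial_indices_def using d len by (subst distinct_card) auto
  assume "j < CARD('m)"
  then have j: "j < length ?xs" using len by simp
  have t: "take (Suc j) ?xs = take j ?xs @ [?xs ! j]" by (rule take_Suc_conv_app_nth[OF j])
  have "?xs ! j \<notin> set (take j ?xs)"
    using distinct_take[OF d, of "Suc j"] unfolding t by simp
  then show "\<exists>i. i \<notin> initial_indices j \<and> (initial_indices (Suc j) :: 'm set) = insert i (initial_indices j)"
    unfolding initial_indices_def t by (intro exI[of _ "?xs ! j"]) simp
qed

definition rational_subspace :: "(real^'m) set \<Rightarrow> bool" where
  "rational_subspace E \<longleftrightarrow> (\<exists>A\<subseteq>int_vectors. E = span A)"

definition int_basis :: "(real^'m::finite) set \<Rightarrow> ('m \<Rightarrow> real^'m) \<Rightarrow> bool" where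
  "int_basis E w \<longleftrightarrow> (\<forall>i\<in>initial_indices (dim E). w i \<in> int_vectors) \<and> inj_on w (initial_indices (dim E)) \<and>
     independent (w ` initial_indices (dim E)) \<and> span (w ` initial_indices (dim E)) = E"

lemma dim_le_CARD: "dim (E :: (real^'m::finite) set) \<le> CARD('m)"
  using dim_subset_UNIV[of E] by simp

lemma int_basis_exists:
  fixes E :: "(real^'m::finite) set"
  assumes "rational_subspace E"
  shows "\<exists>w. int_basis E w"
proof -
  obtain A where A: "A \<subseteq> int_vectors" "E = span A" using assms by (auto simp: rational_subspace_def)
  obtain B where B: "B \<subseteq> A" "independent B" "A \<subseteq> span B" using maximal_independent_subset[of A] by blast
  have spB: "span B = E" using B A by (metis span_mono span_span subset_antisym)
  have "card B = dim E" using dim_eq_card_independent[OF B(2)] spB dim_span[of B] by simp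
  then have "card (initial_indices (dim E) :: 'm set) = card B"
    using card_initial_indices[OF dim_le_CARD[of E]] by simp
  then obtain w where w: "bij_betw w (initial_indices (dim E) :: 'm set) B"
    using finite_same_card_bij[of "initial_indices (dim E) :: 'm set" B] independent_imp_finite[OF B(2)] by auto
  then have "int_basis E w"
    using B A spB unfolding int_basis_def bij_betw_def by auto
  then show ?thesis by blast
qed

text \<open>Integer bases of \<open>E\<close> have proportional exterior products, so a basis minimising \<open>covol\<close>
  does so after every linear map. This replaces the choice of a basis of \<open>E \<inter> \<int>\<^sup>m\<close>.\<close>

lemma minimal_int_basis_exists:
  assumes "rational_subspace E"
  shows "\<exists>w. int_basis E w \<and> (\<forall>w' h. int_basis E w' \<longrightarrow> linear h \<longrightarrow>
      covol (initial_indices (dim E)) (h \<circ> w) \<le> covol (initial_indices (dim E)) (h \<circ> w'))"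
proof -
  let ?S = "initial_indices (dim E)"
  \<comment> \<open>Integer bases have integer covolumes, so a least one exists and comparing floors
    loses nothing.\<close>
  have int: "covol ?S w \<in> \<int>" if "int_basis E w" for w
  proof -
    obtain \<sigma> where s: "covol ?S w = \<bar>det (mix_rows ?S w (\<lambda>i. axis (\<sigma> i) 1))\<bar>"
      using covol_attained by blast
    have "det (mix_rows ?S w (\<lambda>i. axis (\<sigma> i) 1)) \<in> \<int>"
      by (rule det_int) (use that in \<open>auto simp: mix_rows_def int_basis_def int_vectors_def axis_def\<close>)
    then show ?thesis unfolding s by (rule Ints_abs)
  qed
  obtain w where w: "int_basis E w" "\<And>w'. int_basis E w' \<Longrightarrow> nat \<lfloor>covol ?S w\<rfloor> \<le> nat \<lfloor>covol ?S w'\<rfloor>"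
    using ex_has_least_nat[of "int_basis E" _ "\<lambda>w. nat \<lfloor>covol ?S w\<rfloor>"] int_basis_exists[OF assms] by blast
  have le: "covol ?S w \<le> covol ?S w'" if "int_basis E w'" for w'
    using w(2)[OF that] int[OF w(1)] int[OF that] covol_nonneg[of ?S w] covol_nonneg[of ?S w']
    by (auto elim!: Ints_cases simp: nat_le_eq_zle)
  have "covol ?S (h \<circ> w) \<le> covol ?S (h \<circ> w')" if w': "int_basis E w'" and h: "linear h" for w' h
  proof -
    obtain r where r: "\<And>h u. linear h \<Longrightarrow> det (mix_rows ?S (h \<circ> w') u) = r * det (mix_rows ?S (h \<circ> w) u)"
      using det_mix_rows_proportional[of w ?S w'] w(1) w' unfolding int_basis_def
      by (metis imageI span_base)
    have eq: "covol ?S (h \<circ> w') = \<bar>r\<bar> * covol ?S (h \<circ> w)" if "linear h" for h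
    proof (rule antisym)
      show "covol ?S (h \<circ> w') \<le> \<bar>r\<bar> * covol ?S (h \<circ> w)"
        by (rule covol_le) (simp add: r[OF that] abs_mult mult_left_mono covol_ge)
      obtain \<sigma> where "covol ?S (h \<circ> w) = \<bar>det (mix_rows ?S (h \<circ> w) (\<lambda>i. axis (\<sigma> i) 1))\<bar>"
        using covol_attained by blast
      then have "\<bar>r\<bar> * covol ?S (h \<circ> w) = \<bar>det (mix_rows ?S (h \<circ> w') (\<lambda>i. axis (\<sigma> i) 1))\<bar>"
        by (simp add: r[OF that] abs_mult)
      then show "\<bar>r\<bar> * covol ?S (h \<circ> w) \<le> covol ?S (h \<circ> w')" using covol_ge by metis
    qed
    \<comment> \<open>For the identity, minimality reads 1 <= |r|. Since r does not depend on h,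
      minimality carries over to every linear h.\<close>
    have "1 * covol ?S w \<le> \<bar>r\<bar> * covol ?S w" using eq[OF linear_id] le[OF w'] by simp
    moreover have "0 < covol ?S w" using w(1) by (intro covol_pos) (auto simp: int_basis_def)
    ultimately have "1 \<le> \<bar>r\<bar>" by (metis mult_right_le_imp_le)
    then show ?thesis using mult_right_mono[of 1 "\<bar>r\<bar>" "covol ?S (h \<circ> w)"] covol_nonneg[of ?S "h \<circ> w"] eq[OF h] by simp
  qed
  then show ?thesis using w(1) by blast
qed

definition minimal_basis :: "(real^'m::finite) set \<Rightarrow> 'm \<Rightarrow> real^'m" where
  "minimal_basis E = (SOME w. int_basis E w \<and> (\<forall>w' h. int_basis E w' \<longrightarrow> linear h \<longrightarrow>
      covol (initial_indices (dim E)) (h \<circ> w) \<le> covol (initial_indices (dim E)) (h \<circ> w')))"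

text \<open>For invertible linear h this is the covolume, measured by the sup-norm of exterior
  products, of the lattice formed by the images of the integer points of \<open>E\<close>.\<close>

definition subspace_weight :: "(real^'m::finite \<Rightarrow> real^'m) \<Rightarrow> (real^'m) set \<Rightarrow> real" where
  "subspace_weight h E = covol (initial_indices (dim E)) (h \<circ> minimal_basis E)"

lemma int_basis_minimal_basis: "rational_subspace E \<Longrightarrow> int_basis E (minimal_basis E)"
  and subspace_weight_le: "rational_subspace E \<Longrightarrow> int_basis E w \<Longrightarrow> linear h \<Longrightarrow>
     subspace_weight h E \<le> covol (initial_indices (dim E)) (h \<circ> w)"
  using someI_ex[OF minimal_int_basis_exists, of E]
  unfolding minimal_basis_def[symmetric] subspace_weight_def by blast+

lemma rational_subspace_insert:
  assumes "rational_subspace E" "v \<in> int_vectors"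
  shows "rational_subspace (span (insert v E))"
proof -
  obtain A where A: "A \<subseteq> int_vectors" "E = span A" using assms by (auto simp: rational_subspace_def)
  have "span (insert v E) = span (insert v A)"
    unfolding A(2) by (intro subset_antisym span_minimal) (auto intro: span_base span_mono[THEN subsetD])
  then show ?thesis unfolding rational_subspace_def using A assms(2) by (intro exI[of _ "insert v A"]) auto
qed

text \<open>Appending v to the minimal basis of \<open>E\<close> gives an integer basis of the
  larger span. It need not be minimal, but passing to a minimal one only lowers the weight.\<close>

lemma subspace_weight_insert:
  fixes E :: "(real^'m::finite) set"
  assumes E: "rational_subspace E" and v: "v \<in> int_vectors" "v \<notin> E" and h: "linear h"
    and C: "\<And>m. \<bar>h v $ m\<bar> \<le> C"
  shows "subspace_weight h (span (insert v E)) \<le> real CARD('m) * C * subspace_weight h E"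
proof -
  let ?w = "minimal_basis E" and ?S = "initial_indices (dim E) :: 'm set"
  have w: "\<forall>i\<in>?S. ?w i \<in> int_vectors" "inj_on ?w ?S" "independent (?w ` ?S)" "span (?w ` ?S) = E"
    using int_basis_minimal_basis[OF E] by (auto simp: int_basis_def)
  have sub: "span E = E" using E by (auto simp: rational_subspace_def span_span)
  have ind: "independent (insert v (?w ` ?S))"
    using w(3,4) v(2) by (simp add: independent_insertI)
  have sp: "span (insert v (?w ` ?S)) = span (insert v E)"
  proof (intro subset_antisym span_minimal)
    have "?w ` ?S \<subseteq> E" using span_superset[of "?w ` ?S"] unfolding w(4) .
    then show "insert v (?w ` ?S) \<subseteq> span (insert v E)"
      using span_superset[of "insert v E"] by blast
    have "E \<subseteq> span (insert v (?w ` ?S))" using span_mono[OF subset_insertI, of "?w ` ?S" v] unfolding w(4) .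
    then show "insert v E \<subseteq> span (insert v (?w ` ?S))" by (simp add: span_base)
  qed (rule subspace_span)+
  have vn: "v \<notin> ?w ` ?S" using v(2) span_superset[of "?w ` ?S"] unfolding w(4) by blast
  have cS: "card ?S = dim E" by (rule card_initial_indices[OF dim_le_CARD])
  have d: "dim (span (insert v E)) = Suc (dim E)"
    using dim_eq_card_independent[OF ind] sp dim_span[of "insert v (?w ` ?S)"] vn card_image[OF w(2)] cS
    by simp
  then have "dim E < CARD('m)" using dim_le_CARD[of "span (insert v E)"] by simp
  then obtain i where i: "i \<notin> ?S" "initial_indices (Suc (dim E)) = insert i ?S"
    using initial_indices_Suc by blast
  have im: "(?w(i := v)) ` insert i ?S = insert v (?w ` ?S)" using i(1) by auto
  have "int_basis (span (insert v E)) (?w(i := v))"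
    unfolding int_basis_def d i(2) im using w v i vn ind sp by (auto simp: inj_on_def)
  then have "subspace_weight h (span (insert v E)) \<le> covol (insert i ?S) (h \<circ> (?w(i := v)))"
    using subspace_weight_le[OF rational_subspace_insert[OF E v(1)] _ h, of "?w(i := v)"] unfolding d i(2) by simp
  also have "h \<circ> (?w(i := v)) = (h \<circ> ?w)(i := h v)" by auto
  also have "covol (insert i ?S) ((h \<circ> ?w)(i := h v)) \<le> real CARD('m) * C * covol ?S (h \<circ> ?w)"
    by (rule covol_insert[OF i(1) C])
  finally show ?thesis unfolding subspace_weight_def .
qed

text \<open>Completing the minimal basis by vectors of \<open>U\<close> gives a nonsingular integer
  matrix, whose determinant is at least 1 in absolute value. Applying h leaves this absolute value
  unchanged, and expanding along the rows from \<open>U\<close> bounds it by a power of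
  \<open>CARD('m) * C\<close> times the weight.\<close>

lemma subspace_weight_lower:
  fixes E :: "(real^'m::finite) set"
  assumes E: "rational_subspace E" and h: "linear h" "\<bar>det (matrix h)\<bar> = 1"
    and U: "U \<subseteq> int_vectors" "span U = UNIV" "\<And>u m. u \<in> U \<Longrightarrow> \<bar>h u $ m\<bar> \<le> C" and C: "1 \<le> C"
  shows "1 \<le> (real CARD('m) * C) ^ CARD('m) * subspace_weight h E"
proof -
  let ?w = "minimal_basis E" and ?S = "initial_indices (dim E) :: 'm set"
  have w: "\<forall>i\<in>?S. ?w i \<in> int_vectors" "inj_on ?w ?S" "independent (?w ` ?S)"
    using int_basis_minimal_basis[OF E] by (auto simp: int_basis_def)
  obtain u where u: "\<And>i. i \<notin> ?S \<Longrightarrow> u i \<in> U" "det (mix_rows ?S ?w u) \<noteq> 0"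
    using mix_rows_extend[OF w(2,3) U(2)] by blast
  have uZ: "u i \<in> int_vectors" if "i \<notin> ?S" for i using u(1)[OF that] U(1) by auto
  have "det (mix_rows ?S ?w u) \<in> \<int>"
    by (rule det_int) (use w(1) uZ in \<open>auto simp: mix_rows_def int_vectors_def\<close>)
  then have "1 \<le> \<bar>det (mix_rows ?S ?w u)\<bar>" using u(2) by (rule Ints_nonzero_abs_ge1)
  also have "\<dots> = \<bar>det (mix_rows ?S (h \<circ> ?w) (h \<circ> u))\<bar>"
    by (simp add: det_mix_rows_linear[OF h(1)] abs_mult h(2))
  also have "\<dots> \<le> (real CARD('m) * C) ^ card (- ?S) * covol ?S (h \<circ> ?w)"
    by (rule det_mix_rows_bound) (use u U(3) C in auto)
  also have "\<dots> \<le> (real CARD('m) * C) ^ CARD('m) * covol ?S (h \<circ> ?w)"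
  proof (intro mult_right_mono power_increasing covol_nonneg)
    show "card (- ?S) \<le> CARD('m)" by (rule card_mono) auto
    have "1 * 1 \<le> real CARD('m) * C" using C by (intro mult_mono) auto
    then show "1 \<le> real CARD('m) * C" by simp
  qed
  finally show ?thesis unfolding subspace_weight_def .
qed

text \<open>A matrix whose rows are coordinate vectors has determinant 0, 1 or -1. The zero subspace
  will serve as the bottom of a chain.\<close>

lemma subspace_weight_0: "subspace_weight h {0 :: real^'m::finite} \<le> 1"
proof -
  have S: "initial_indices (dim {0 :: real^'m}) = ({} :: 'm set)" by (simp add: initial_indices_def)
  show ?thesis unfolding subspace_weight_def S
  proof (rule covol_le)
    fix \<sigma> :: "'m \<Rightarrow> 'm"
    let ?M = "mix_rows {} (h \<circ> minimal_basis {0}) (\<lambda>i. axis (\<sigma> i) 1) :: real^'m^'m"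
    show "\<bar>det ?M\<bar> \<le> 1"
    proof (cases "inj \<sigma>")
      case True
      then have "\<sigma> permutes UNIV"
        by (metis bijI bij_iff finite_UNIV_inj_surj finite_code permutes_univ)
      have "?M = (\<chi> i. (mat 1 :: real^'m^'m) $ \<sigma> i)"
        by (auto simp: mix_rows_def vec_eq_iff mat_def axis_def)
      then have "det ?M = of_int (sign \<sigma>) * det (mat 1 :: real^'m^'m)"
        using det_permute_rows[OF \<open>\<sigma> permutes UNIV\<close>, of "mat 1 :: real^'m^'m"] by simp
      then show ?thesis by (simp add: sign_def)
    next
      case False
      then obtain i j where "i \<noteq> j" "\<sigma> i = \<sigma> j" by (auto simp: inj_on_def)
      then have "det ?M = 0"
        by (intro det_identical_rows[of i j]) (auto simp: row_def mix_rows_def)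
      then show ?thesis by simp
    qed
  qed
qed

section \<open>Chains of rational subspaces\<close>

definition comparable :: "'a set \<Rightarrow> 'a set \<Rightarrow> bool" where
  "comparable D E \<longleftrightarrow> D \<subseteq> E \<or> E \<subseteq> D"

text \<open>Comparable subspaces of equal dimension coincide, so a chain has at most one member for
  each of the dimensions 0, ..., \<open>CARD('m)\<close>; hence the \<open>Suc\<close>.\<close>

lemma subspace_chain_card:
  fixes F :: "(real^'m::finite) set set"
  assumes "finite F" "F \<subseteq> Collect rational_subspace" "pairwise_rel comparable F"
  shows "card F \<le> Suc CARD('m)"
proof -
  have sub: "subspace E" if "E \<in> F" for E using assms(2) that by (auto simp: rational_subspace_def)
  have "inj_on dim F"
  proof (rule inj_onI)
    fix D E assume a: "D \<in> F" "E \<in> F" "dim D = dim E"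
    then have "D \<subseteq> E \<or> E \<subseteq> D" using assms(3) by (auto simp: pairwise_rel_def comparable_def)
    then show "D = E" using subspace_dim_equal[of D E] subspace_dim_equal[of E D] sub a by auto
  qed
  then have "card F = card (dim ` F)" by (simp add: card_image)
  also have "\<dots> \<le> card {..CARD('m)}" by (rule card_mono) (auto simp: dim_le_CARD)
  finally show ?thesis by simp
qed

text \<open>Let \<open>E\<close> be the largest member of the chain, extended by {0}, that misses v.
  Members containing v contain \<open>E\<close> and so the span of \<open>E\<close> and v; the
  others lie in \<open>E\<close>. Thus this span is comparable with the whole chain and its weight
  is at least \<open>min \<epsilon> \<rho>'\<close>, whereas a short v makes it small because the
  weight of \<open>E\<close> is at most 1.\<close>

lemma short_vector_bound:
  fixes v :: "real^'m::finite"
  assumes prot: "chain_protected comparable (Collect rational_subspace) (\<lambda>E x. subspace_weight (h x) E) {} \<epsilon> \<rho> \<rho>' x"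
    and h: "linear (h x)" and \<rho>: "\<rho> \<le> 1" and v: "v \<in> int_vectors" "v \<noteq> 0" "\<And>m. \<bar>h x v $ m\<bar> \<le> C"
  shows "min \<epsilon> \<rho>' \<le> real CARD('m) * C"
proof -
  obtain G where G: "G \<subseteq> Collect rational_subspace" "finite G" "pairwise_rel comparable G"
    "\<And>E. E \<in> G \<Longrightarrow> \<epsilon> \<le> subspace_weight (h x) E \<and> subspace_weight (h x) E \<le> \<rho>"
    "\<And>E. rational_subspace E \<Longrightarrow> E \<notin> G \<Longrightarrow> (\<forall>D\<in>G. comparable E D) \<Longrightarrow> \<rho>' \<le> subspace_weight (h x) E"
    using prot unfolding chain_protected_def by auto
  have C: "0 \<le> C" using v(3) abs_ge_zero order_trans by blast
  have rat0: "rational_subspace {0 :: real^'m}" unfolding rational_subspace_def by (intro exI[of _ "{}"]) auto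
  have sub: "subspace E" if "E \<in> insert {0} G" for E using G(1) that rat0 by (auto simp: rational_subspace_def)
  let ?G = "{E \<in> insert {0} G. v \<notin> E}"
  have "finite ?G" "?G \<noteq> {}" using G(2) v(2) by auto
  then obtain E where E: "E \<in> ?G" "\<And>D. D \<in> ?G \<Longrightarrow> E \<subseteq> D \<Longrightarrow> E = D"
    using finite_has_maximal[of ?G] by auto
  have cmp0: "comparable D D'" if "D \<in> insert {0} G" "D' \<in> insert {0} G" for D D'
    using that G(3) sub subspace_0 unfolding pairwise_rel_def comparable_def by blast
  have ratE: "rational_subspace E" using E(1) G(1) rat0 by auto
  have wE: "subspace_weight (h x) E \<le> 1" using E(1) G(4)[of E] \<rho> subspace_weight_0[of "h x"] by auto
  let ?E' = "span (insert v E)"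
  have "comparable ?E' D" if D: "D \<in> G" for D
  proof (cases "v \<in> D")
    case True
    have "E \<subseteq> D" using cmp0[of E D] E(1) D True by (auto simp: comparable_def)
    then have "?E' \<subseteq> D" using True sub[of D] D by (intro span_minimal) auto
    then show ?thesis by (simp add: comparable_def)
  next
    case False
    then have "D \<subseteq> E" using cmp0[of E D] E D by (auto simp: comparable_def)
    then show ?thesis unfolding comparable_def by (meson insert_subset order_trans span_superset subset_insertI)
  qed
  then have "min \<epsilon> \<rho>' \<le> subspace_weight (h x) ?E'"
    using G(4)[of ?E'] G(5)[of ?E'] rational_subspace_insert[OF ratE v(1)] by (cases "?E' \<in> G") auto
  also have "\<dots> \<le> real CARD('m) * C * subspace_weight (h x) E"
    by (rule subspace_weight_insert[OF ratE v(1) _ h v(3)]) (use E(1) in auto)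
  also have "\<dots> \<le> real CARD('m) * C * 1"
    using wE C by (intro mult_left_mono) auto
  finally show ?thesis by simp
qed

section \<open>Very well approximable vectors and short lattice vectors\<close>

text \<open>The coordinate \<open>None\<close> of a vector of \<open>\<int>\<^bsup>n+1\<^esup>\<close> is the integer \<open>p\<close>, the others form \<open>q\<close>. The map is
  \<open>g\<^sub>\<tau> u\<^sub>y\<close> with time normalised so that \<open>q\<close> contracts by \<open>exp \<tau>\<close>.\<close>

definition renorm :: "real \<Rightarrow> real^'n::finite \<Rightarrow> real^('n option) \<Rightarrow> real^('n option)" where
  "renorm \<tau> y v = (\<chi> i. case i of
      None \<Rightarrow> exp (real CARD('n) * \<tau>) * (v $ None + (\<Sum>k\<in>UNIV. y $ k * v $ Some k))
    | Some k \<Rightarrow> exp (- \<tau>) * v $ Some k)"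

lemma renorm_None: "renorm \<tau> y v $ None = exp (real CARD('n) * \<tau>) * (v $ None + (\<Sum>k\<in>UNIV. y $ k * v $ Some k))"
  for y :: "real^'n::finite"
  by (simp add: renorm_def)

lemma renorm_Some: "renorm \<tau> y v $ Some k = exp (- \<tau>) * v $ Some k"
  by (simp add: renorm_def)

lemma linear_renorm: "linear (renorm \<tau> y)"
  by (rule linearI)
    (auto simp: vec_eq_iff renorm_def algebra_simps sum.distrib sum_distrib_left split: option.split)

lemma prod_option: "(\<Prod>i\<in>(UNIV :: 'n::finite option set). f i) = f None * (\<Prod>k\<in>UNIV. f (Some k))"
  by (simp add: UNIV_option_conv prod.reindex)

lemma det_renorm: "det (matrix (renorm \<tau> y)) = 1"
proof -
  let ?n = "real CARD('a)"
  define A0 :: "real^('a option)^('a option)" where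
    "A0 = (\<chi> i j. if i = j then (case i of None \<Rightarrow> exp (?n * \<tau>) | Some k \<Rightarrow> exp (- \<tau>)) else 0)"
  \<comment> \<open>The combination of the other rows whose addition to row \<open>None\<close> of
    the diagonal matrix produces the entries of y.\<close>
  define x where "x = (\<Sum>k\<in>UNIV. (exp (?n * \<tau>) * y $ k * exp \<tau>) *\<^sub>R row (Some k) A0)"
  have row: "row (Some k) A0 $ j = (if j = Some k then exp (- \<tau>) else 0)" for k j
    by (auto simp: row_def A0_def)
  have xN: "x $ None = 0" by (simp add: x_def row)
  have xS: "x $ Some k = exp (?n * \<tau>) * y $ k" for k
  proof -
    have "x $ Some k = (\<Sum>l\<in>UNIV. if l = k then exp (?n * \<tau>) * y $ l else 0)"
      unfolding x_def sum_component by (rule sum.cong) (auto simp: row exp_minus)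
    then show ?thesis by simp
  qed
  have "x \<in> span {row j A0 |j. j \<noteq> None}"
    unfolding x_def by (intro span_sum span_scale span_base) auto
  then have "x \<in> vec.span {row j A0 |j. j \<noteq> None}" by (simp add: span_vec_eq)
  from det_row_span[OF this]
  have d: "det (\<chi> k. if k = None then row None A0 + x else row k A0) = det A0" .
  have "matrix (renorm \<tau> y) = (\<chi> k. if k = None then row None A0 + x else row k A0)"
  proof -
    have "matrix (renorm \<tau> y) $ i $ j = (if i = None then row None A0 + x else row i A0) $ j" for i j
    proof (cases i)
      case None
      show ?thesis
      proof (cases j)
        case None
        have "renorm \<tau> y (axis None 1) $ None = exp (?n * \<tau>)"
          by (simp add: renorm_None axis_def)
        then show ?thesis using \<open>i = None\<close> None xN by (simp add: matrix_def row_def A0_def)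
      next
        case (Some k)
        have "(\<Sum>l\<in>UNIV. y $ l * (axis (Some k) 1 :: real^('a option)) $ Some l) = (\<Sum>l\<in>UNIV. if l = k then y $ l else 0)"
          by (rule sum.cong) (auto simp: axis_def)
        then have "renorm \<tau> y (axis (Some k) 1) $ None = exp (?n * \<tau>) * y $ k"
          by (simp add: renorm_None) (simp add: axis_def)
        then show ?thesis using \<open>i = None\<close> xS[of k] Some by (simp add: matrix_def row_def A0_def)
      qed
    next
      case (Some k)
      have "renorm \<tau> y (axis j 1) $ Some k = (if j = Some k then exp (- \<tau>) else 0)"
        by (auto simp: renorm_Some axis_def)
      then show ?thesis using Some by (simp add: matrix_def row)
    qed
    then show ?thesis by (simp add: vec_eq_iff)
  qed
  then have "det (matrix (renorm \<tau> y)) = det A0" using d by simp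
  also have "\<dots> = (\<Prod>i\<in>UNIV. A0 $ i $ i)" by (rule det_diagonal) (simp add: A0_def)
  also have "\<dots> = exp (?n * \<tau>) * exp (- \<tau>) ^ CARD('a)" by (simp add: prod_option A0_def)
  also have "\<dots> = 1" by (simp add: exp_of_nat_mult[symmetric] mult_exp_exp)
  finally show ?thesis .
qed

text \<open>y enters a renormalised vector only through its coordinate \<open>None\<close>, hence
  only one column of the matrix. After transposition, multilinearity in row \<open>None\<close>
  gives an affine function of y.\<close>

lemma det_renorm_affine:
  fixes w :: "'n option \<Rightarrow> real^('n::finite option)"
  shows "\<exists>a b. \<forall>y. det (mix_rows S (renorm \<tau> y \<circ> w) (\<lambda>i. axis (\<sigma> i) 1)) = a + b \<bullet> y"
proof -
  let ?n = "real CARD('n)"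
  define c0 :: "real^('n option)" where
    "c0 = (\<chi> i. if i \<in> S then exp (?n * \<tau>) * w i $ None else axis (\<sigma> i) 1 $ None)"
  define dd :: "'n \<Rightarrow> real^('n option)" where
    "dd k = (\<chi> i. if i \<in> S then exp (?n * \<tau>) * w i $ Some k else 0)" for k
  define rr :: "'n option \<Rightarrow> real^('n option)" where
    "rr j = (\<chi> i. if i \<in> S then exp (- \<tau>) * w i $ j else axis (\<sigma> i) 1 $ j)" for j
  have "det (mix_rows S (renorm \<tau> y \<circ> w) (\<lambda>i. axis (\<sigma> i) 1)) =
      det (\<chi> j. if j = None then c0 else rr j) + (\<chi> k. det (\<chi> j. if j = None then dd k else rr j)) \<bullet> y" for y
  proof -
    have "transpose (mix_rows S (renorm \<tau> y \<circ> w) (\<lambda>i. axis (\<sigma> i) 1)) =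
        (\<chi> j. if j = None then c0 + (\<Sum>k\<in>UNIV. y $ k *s dd k) else rr j)"
    proof -
      have "transpose (mix_rows S (renorm \<tau> y \<circ> w) (\<lambda>i. axis (\<sigma> i) 1)) $ j $ i =
        (if j = None then c0 + (\<Sum>k\<in>UNIV. y $ k *s dd k) else rr j) $ i" for i j
        by (cases j; cases "i \<in> S") (simp_all add: transpose_def mix_rows_def c0_def dd_def rr_def renorm_None renorm_Some
            distrib_left sum_distrib_left mult_ac)
      then show ?thesis by (simp add: vec_eq_iff)
    qed
    then have "det (mix_rows S (renorm \<tau> y \<circ> w) (\<lambda>i. axis (\<sigma> i) 1)) =
        det (\<chi> j. if j = None then c0 + (\<Sum>k\<in>UNIV. y $ k *s dd k) else rr j)"
      using det_transpose[of "mix_rows S (renorm \<tau> y \<circ> w) (\<lambda>i. axis (\<sigma> i) 1)"] by simp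
    also have "\<dots> = det (\<chi> j. if j = None then c0 else rr j) + det (\<chi> j. if j = None then \<Sum>k\<in>UNIV. y $ k *s dd k else rr j)"
      by (rule det_row_add)
    also have "det (\<chi> j. if j = None then \<Sum>k\<in>UNIV. y $ k *s dd k else rr j) =
        (\<Sum>k\<in>UNIV. det (\<chi> j. if j = None then y $ k *s dd k else rr j))"
      by (rule det_linear_row_sum) simp
    also have "\<dots> = (\<Sum>k\<in>UNIV. y $ k * det (\<chi> j. if j = None then dd k else rr j))"
      by (rule sum.cong[OF refl], rule det_row_mul)
    also have "\<dots> = (\<chi> k. det (\<chi> j. if j = None then dd k else rr j)) \<bullet> y"
      by (simp add: inner_vec_def mult.commute)
    finally show ?thesis .
  qed
  then show ?thesis by blast
qed

text \<open>Pigeonhole: the box of all q with each q k in {0..Q k} has more than \<open>M\<close>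
  integer points, while the fractional parts fall into \<open>M\<close> intervals of length 1 /
  M.\<close>

lemma dirichlet_linear_form:
  fixes y :: "real^'n::finite" and Q :: "'n \<Rightarrow> nat"
  assumes Q: "\<And>k. 1 \<le> Q k"
  shows "\<exists>(q :: 'n \<Rightarrow> int) (p :: int). (\<exists>k. q k \<noteq> 0) \<and> (\<forall>k. \<bar>q k\<bar> \<le> int (Q k)) \<and>
           \<bar>real_of_int p + (\<Sum>k\<in>UNIV. y $ k * real_of_int (q k))\<bar> \<le> 1 / (\<Prod>k\<in>UNIV. real (Q k))"
proof -
  define M where "M = (\<Prod>k\<in>UNIV. Q k)"
  have M1: "1 \<le> M" unfolding M_def using Q by (intro prod_ge_1) auto
  define B where "B = PiE (UNIV :: 'n set) (\<lambda>k. {0..int (Q k)})"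
  define L where "L q = (\<Sum>k\<in>UNIV. y $ k * real_of_int (q k))" for q :: "'n \<Rightarrow> int"
  define f where "f q = \<lfloor>real M * frac (L q)\<rfloor>" for q
  have fB: "finite B" unfolding B_def by (intro finite_PiE) auto
  have nat_Q: "nat (int q + 1) = Suc q" for q by linarith
  have "card B = (\<Prod>k\<in>UNIV. Q k + 1)"
    unfolding B_def using nat_Q by (subst card_PiE) auto
  also have "\<dots> > M" unfolding M_def by (rule prod_mono_strict) (use Q in \<open>auto simp: Suc_le_eq\<close>)
  finally have cB: "M < card B" .
  have "f ` B \<subseteq> {0..<int M}"
  proof safe
    fix q
    have "frac (L q) < 1" "0 \<le> frac (L q)" by (auto simp: frac_lt_1)
    then have "real M * frac (L q) < real M" "0 \<le> real M * frac (L q)" using M1 by auto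
    then show "f q \<in> {0..<int M}" unfolding f_def by (auto simp: floor_less_iff)
  qed
  then have "card (f ` B) \<le> M" using card_mono[of "{0..<int M}" "f ` B"] by simp
  then have "\<not> inj_on f B" using cB card_image[of f B] by auto
  then obtain q q' where q: "q \<in> B" "q' \<in> B" "q \<noteq> q'" "f q = f q'" by (auto simp: inj_on_def)
  define p where "p = - (\<lfloor>L q\<rfloor> - \<lfloor>L q'\<rfloor>)"
  have "real_of_int p + L (\<lambda>k. q k - q' k) = frac (L q) - frac (L q')"
    by (simp add: p_def L_def frac_def algebra_simps sum_subtractf)
  moreover have "\<bar>real M * frac (L q) - real M * frac (L q')\<bar> < 1"
    using q(4) unfolding f_def by linarith
  then have "real M * \<bar>frac (L q) - frac (L q')\<bar> < 1"
    using M1 by (simp add: abs_mult flip: right_diff_distrib)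
  then have "\<bar>frac (L q) - frac (L q')\<bar> \<le> 1 / real M" using M1 by (simp add: field_simps)
  ultimately have "\<bar>real_of_int p + L (\<lambda>k. q k - q' k)\<bar> \<le> 1 / (\<Prod>k\<in>UNIV. real (Q k))"
    by (simp add: M_def)
  moreover have "\<exists>k. q k - q' k \<noteq> 0" using q(3) by auto
  moreover have "\<bar>q k - q' k\<bar> \<le> int (Q k)" for k
  proof -
    have "q k \<in> {0..int (Q k)}" "q' k \<in> {0..int (Q k)}" using q(1,2) by (auto simp: B_def PiE_def Pi_def)
    then show ?thesis by auto
  qed
  ultimately show ?thesis unfolding L_def by (intro exI[of _ "\<lambda>k. q k - q' k"] exI[of _ p]) auto
qed

text \<open>Dirichlet's theorem with \<open>Q k\<close> the floor of
  \<open>c k * exp \<tau>\<close>. That number is at least 1, so rounding it down costs at most a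
  factor 2, which is the 2 in the product.\<close>

lemma dirichlet_renorm:
  fixes y :: "real^'n::finite"
  assumes c: "\<And>k. 1 \<le> c k * exp \<tau>"
  shows "\<exists>v\<in>int_vectors. v \<noteq> 0 \<and> (\<forall>k. \<bar>renorm \<tau> y v $ Some k\<bar> \<le> c k) \<and>
           \<bar>renorm \<tau> y v $ None\<bar> \<le> (\<Prod>k\<in>UNIV. 2 / c k)"
proof -
  define Q where "Q k = nat \<lfloor>c k * exp \<tau>\<rfloor>" for k
  have Q1: "1 \<le> Q k" for k using c[of k] by (simp add: Q_def le_nat_iff)
  have Qr: "real (Q k) = of_int \<lfloor>c k * exp \<tau>\<rfloor>" for k using c[of k] by (simp add: Q_def)
  have Qle: "real (Q k) \<le> c k * exp \<tau>" for k unfolding Qr by linarith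
  have Qge: "c k * exp \<tau> \<le> 2 * real (Q k)" for k
  proof -
    have "1 \<le> real (Q k)" using Q1[of k] by simp
    then show ?thesis using Qr[of k] by linarith
  qed
  have cpos: "0 < c k" for k using c[of k] by (smt (verit) exp_gt_zero mult_nonpos_nonneg)
  obtain q :: "'n \<Rightarrow> int" and p :: int where qp: "\<exists>k. q k \<noteq> 0" "\<And>k. \<bar>q k\<bar> \<le> int (Q k)"
    "\<bar>real_of_int p + (\<Sum>k\<in>UNIV. y $ k * real_of_int (q k))\<bar> \<le> 1 / (\<Prod>k\<in>UNIV. real (Q k))"
    using dirichlet_linear_form[of Q y] Q1 by blast
  define v :: "real^('n option)" where
    "v = (\<chi> i. case i of None \<Rightarrow> real_of_int p | Some k \<Rightarrow> real_of_int (q k))"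
  have "v \<in> int_vectors" by (auto simp: int_vectors_def v_def split: option.split)
  moreover have "v \<noteq> 0"
  proof
    assume a: "v = 0"
    obtain k where k: "q k \<noteq> 0" using qp(1) by blast
    have "v $ Some k = 0" using a by simp
    then show False using k by (simp add: v_def)
  qed
  moreover have "\<bar>renorm \<tau> y v $ Some k\<bar> \<le> c k" for k
  proof -
    have "real_of_int \<bar>q k\<bar> \<le> real_of_int (int (Q k))" using qp(2)[of k] by (rule of_int_le_iff[THEN iffD2])
    then have "\<bar>real_of_int (q k)\<bar> \<le> c k * exp \<tau>" using Qle[of k] by simp
    then have "exp (- \<tau>) * \<bar>real_of_int (q k)\<bar> \<le> exp (- \<tau>) * (c k * exp \<tau>)" by (intro mult_left_mono) auto
    also have "\<dots> = c k" by (simp add: exp_minus)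
    finally show ?thesis by (simp add: renorm_Some v_def abs_mult)
  qed
  moreover have "\<bar>renorm \<tau> y v $ None\<bar> \<le> (\<Prod>k\<in>UNIV. 2 / c k)"
  proof -
    have "\<bar>renorm \<tau> y v $ None\<bar> = exp (real CARD('n) * \<tau>) * \<bar>real_of_int p + (\<Sum>k\<in>UNIV. y $ k * real_of_int (q k))\<bar>"
      by (simp add: renorm_None v_def abs_mult)
    also have "\<dots> \<le> exp (real CARD('n) * \<tau>) * (1 / (\<Prod>k\<in>UNIV. real (Q k)))"
      using qp(3) by (intro mult_left_mono) auto
    also have "\<dots> = (\<Prod>k\<in>(UNIV::'n set). exp \<tau> / real (Q k))"
      by (simp add: prod_dividef exp_of_nat_mult)
    also have "\<dots> \<le> (\<Prod>k\<in>UNIV. 2 / c k)"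
    proof (rule prod_mono)
      fix k
      show "0 \<le> exp \<tau> / real (Q k) \<and> exp \<tau> / real (Q k) \<le> 2 / c k"
        using Qge[of k] Q1[of k] cpos[of k] by (simp add: field_simps)
    qed
    finally show ?thesis .
  qed
  ultimately show ?thesis by blast
qed

text \<open>A substitute for Minkowski's second theorem. If the renormalised vectors had a common
  normal \<xi>, let m be the position of its largest entry. Dirichlet's theorem gives an integer
  vector that is small in all directions but m; orthogonality to \<xi> then makes it small in
  direction m as well, against \<open>short\<close>.\<close>

lemma renorm_spanning:
  fixes y :: "real^'n::finite"
  assumes short: "\<And>v. v \<in> int_vectors \<Longrightarrow> v \<noteq> 0 \<Longrightarrow> \<exists>m. ell \<le> \<bar>renorm \<tau> y v $ m\<bar>"
    and lam: "0 < ell" "ell \<le> 1" "0 \<le> \<tau>" "1 \<le> ell / (2 * real CARD('n)) * exp \<tau>"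
  shows "span {u \<in> int_vectors. \<forall>m. \<bar>renorm \<tau> y u $ m\<bar> \<le> (4 * real CARD('n) / ell) ^ CARD('n)} = UNIV"
proof -
  let ?n = "CARD('n)"
  \<comment> \<open>\<mu> is chosen with n * \<mu> = ell / 2 < ell, and \<open>C\<close> is (2 /
    \<mu>) ^ n, the bound that Dirichlet's theorem leaves for the single long direction.\<close>
  define \<mu> where "\<mu> = ell / (2 * real ?n)"
  define C where "C = (4 * real ?n / ell) ^ ?n"
  define U where "U = {u \<in> int_vectors. \<forall>m. \<bar>renorm \<tau> y u $ m\<bar> \<le> C}"
  have n1: "1 \<le> real ?n" by (simp add: Suc_le_eq)
  have nmu: "real ?n * \<mu> = ell / 2" by (simp add: \<mu>_def)
  have mu0: "0 < \<mu>" using lam(1) by (simp add: \<mu>_def)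
  have "1 * \<mu> \<le> real ?n * \<mu>" using n1 mu0 by (intro mult_right_mono) auto
  then have mu: "0 < \<mu>" "\<mu> < ell" "real ?n * \<mu> < ell" "\<mu> \<le> 1"
    using lam(1,2) nmu mu0 by auto
  have Cmu: "C = (2 / \<mu>) ^ ?n" by (simp add: C_def \<mu>_def)
  have C1: "1 \<le> C" unfolding Cmu by (rule one_le_power) (use mu in simp)
  have box: "\<exists>v\<in>int_vectors. v \<noteq> 0 \<and> (\<forall>i. i \<noteq> m \<longrightarrow> \<bar>renorm \<tau> y v $ i\<bar> \<le> \<mu>) \<and> \<bar>renorm \<tau> y v $ m\<bar> \<le> C" for m
  proof (cases m)
    case None
    obtain v where v: "v \<in> int_vectors" "v \<noteq> 0" "\<And>k. \<bar>renorm \<tau> y v $ Some k\<bar> \<le> \<mu>"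
       "\<bar>renorm \<tau> y v $ None\<bar> \<le> (\<Prod>k\<in>(UNIV::'n set). 2 / \<mu>)"
      using dirichlet_renorm[of "\<lambda>_. \<mu>" \<tau> y] lam(4) by (auto simp: \<mu>_def)
    have "\<bar>renorm \<tau> y v $ i\<bar> \<le> \<mu>" if "i \<noteq> None" for i using v(3) that by (cases i) auto
    then show ?thesis using v None by (intro bexI[of _ v]) (auto simp: Cmu)
  next
    case (Some k0)
    \<comment> \<open>If the long direction is \<open>Some k0\<close>, widening the box to C there
      brings the bound on coordinate \<open>None\<close> down to (2 / C) * (2 / \<mu>) ^ (n - 1) =
      \<mu>.\<close>
    let ?c = "(\<lambda>_. \<mu>)(k0 := C)"
    have "1 \<le> C * exp \<tau>" using C1 lam(3) mult_mono[of 1 C 1 "exp \<tau>"] by simp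
    then have "1 \<le> ?c k * exp \<tau>" for k using lam(4) by (auto simp: \<mu>_def)
    from dirichlet_renorm[of ?c \<tau> y, OF this]
    obtain v where v: "v \<in> int_vectors" "v \<noteq> 0" "\<And>k. \<bar>renorm \<tau> y v $ Some k\<bar> \<le> ?c k"
       "\<bar>renorm \<tau> y v $ None\<bar> \<le> (\<Prod>k\<in>(UNIV::'n set). 2 / ?c k)" by blast
    have "(\<Prod>k\<in>(UNIV::'n set). 2 / ?c k) = 2 / C * (\<Prod>k\<in>UNIV-{k0}. 2 / ?c k)"
      by (subst prod.remove[of _ k0]) auto
    also have "(\<Prod>k\<in>UNIV-{k0}. 2 / ?c k) = (\<Prod>k\<in>UNIV-{k0}. 2 / \<mu>)" by (rule prod.cong) auto
    also have "\<dots> = (2 / \<mu>) ^ (?n - 1)" by simp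
    also have "2 / C * (2 / \<mu>) ^ (?n - 1) = \<mu>"
    proof -
      have "C = (2 / \<mu>) * (2 / \<mu>) ^ (?n - 1)" unfolding Cmu by (simp flip: power_Suc)
      then show ?thesis using mu by simp
    qed
    finally have N: "\<bar>renorm \<tau> y v $ None\<bar> \<le> \<mu>" using v(4) by simp
    have "\<bar>renorm \<tau> y v $ i\<bar> \<le> \<mu>" if "i \<noteq> Some k0" for i
      using v(3) N that by (cases i) (auto split: if_splits, metis)
    moreover have "\<bar>renorm \<tau> y v $ Some k0\<bar> \<le> C" using v(3)[of k0] by simp
    ultimately show ?thesis using v Some by blast
  qed
  have inj: "inj (renorm \<tau> y)"
    using det_nz_iff_inj[of "renorm \<tau> y"] det_renorm[of \<tau> y] linear_renorm by auto
  have "span (renorm \<tau> y ` U) = UNIV"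
  proof (rule ccontr)
    assume "span (renorm \<tau> y ` U) \<noteq> UNIV"
    then obtain \<xi> where xi: "\<xi> \<noteq> 0" "\<And>x. x \<in> span (renorm \<tau> y ` U) \<Longrightarrow> \<xi> \<bullet> x = 0"
      using span_not_UNIV_orthogonal[of "renorm \<tau> y ` U"] by blast
    have "Max (range (\<lambda>i. \<bar>\<xi> $ i\<bar>)) \<in> range (\<lambda>i. \<bar>\<xi> $ i\<bar>)" by (rule Max_in) auto
    then obtain m where "Max (range (\<lambda>i. \<bar>\<xi> $ i\<bar>)) = \<bar>\<xi> $ m\<bar>" by (rule rangeE)
    then have m: "\<bar>\<xi> $ i\<bar> \<le> \<bar>\<xi> $ m\<bar>" for i
      using Max_ge[of "range (\<lambda>i. \<bar>\<xi> $ i\<bar>)" "\<bar>\<xi> $ i\<bar>"] by auto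
    have m0: "0 < \<bar>\<xi> $ m\<bar>"
    proof (rule ccontr)
      assume "\<not> 0 < \<bar>\<xi> $ m\<bar>"
      then have "\<xi> $ i = 0" for i using m[of i] by auto
      then show False using xi(1) by (simp add: vec_eq_iff)
    qed
    obtain v where v: "v \<in> int_vectors" "v \<noteq> 0" "\<And>i. i \<noteq> m \<Longrightarrow> \<bar>renorm \<tau> y v $ i\<bar> \<le> \<mu>"
      "\<bar>renorm \<tau> y v $ m\<bar> \<le> C" using box[of m] by blast
    have "\<bar>renorm \<tau> y v $ i\<bar> \<le> C" for i using v(3)[of i] v(4) mu C1 by (cases "i = m") auto
    then have "v \<in> U" using v(1) by (simp add: U_def)
    then have "\<xi> \<bullet> renorm \<tau> y v = 0" by (intro xi(2) span_base) auto
    then have "\<xi> $ m * renorm \<tau> y v $ m = - (\<Sum>i\<in>UNIV-{m}. \<xi> $ i * renorm \<tau> y v $ i)"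
      by (simp add: inner_vec_def sum.remove[of UNIV m])
    then have "\<bar>\<xi> $ m\<bar> * \<bar>renorm \<tau> y v $ m\<bar> = \<bar>\<Sum>i\<in>UNIV-{m}. \<xi> $ i * renorm \<tau> y v $ i\<bar>"
      by (simp flip: abs_mult)
    also have "\<dots> \<le> (\<Sum>i\<in>UNIV-{m}. \<bar>\<xi> $ m\<bar> * \<mu>)"
      by (rule order.trans[OF sum_abs sum_mono])
        (use m v(3) in \<open>auto simp: abs_mult intro!: mult_mono\<close>)
    also have "\<dots> = \<bar>\<xi> $ m\<bar> * (real ?n * \<mu>)" by simp
    finally have "\<bar>renorm \<tau> y v $ m\<bar> \<le> real ?n * \<mu>" using m0 by simp
    then have "\<bar>renorm \<tau> y v $ i\<bar> < ell" for i using v(3)[of i] mu by (cases "i = m") auto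
    then show False using short[OF v(1,2)] by (meson not_le)
  qed
  then have im: "renorm \<tau> y ` span U = UNIV" by (simp add: linear_span_image[OF linear_renorm])
  have "z \<in> span U" for z
  proof -
    have "renorm \<tau> y z \<in> renorm \<tau> y ` span U" unfolding im by simp
    then show ?thesis using inj by (simp add: inj_image_mem_iff)
  qed
  then have "span U = UNIV" by blast
  then show ?thesis unfolding U_def C_def .
qed

section \<open>Approximation exponents and the lengths of lattice vectors\<close>

lemma eventually_le_exp:
  assumes "a > 0"
  shows "\<forall>\<^sub>F \<tau> in sequentially. K \<le> exp (a * real \<tau>)"
  using eventually_ge_at_top[of "nat \<lceil>K / a\<rceil>"]
proof eventually_elim
  case (elim \<tau>)
  then have "K / a \<le> real \<tau>" by linarith
  then have "K \<le> a * real \<tau>" using assms by (simp add: field_simps)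
  also have "\<dots> \<le> exp (a * real \<tau>)" using exp_ge_add_one_self[of "a * real \<tau>"] by linarith
  finally show ?case .
qed

lemma supnorm_int_ge: "\<bar>real_of_int (q $ i)\<bar> \<le> supnorm_int q"
  unfolding supnorm_int_def by (rule Max_ge) auto

lemma supnorm_int_attained: "\<exists>i. supnorm_int q = \<bar>real_of_int (q $ i)\<bar>"
proof -
  have "supnorm_int q \<in> range (\<lambda>i. \<bar>real_of_int (q $ i)\<bar>)" unfolding supnorm_int_def by (rule Max_in) auto
  then show ?thesis by auto
qed

lemma supnorm_int_ge_1: "q \<noteq> 0 \<Longrightarrow> 1 \<le> supnorm_int q"
proof -
  assume "q \<noteq> 0"
  then obtain i where "q $ i \<noteq> 0" by (auto simp: vec_eq_iff)
  then have "1 \<le> \<bar>real_of_int (q $ i)\<bar>" by linarith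
  then show ?thesis using supnorm_int_ge[of q i] by linarith
qed

lemma finite_supnorm_int_le: "finite {q :: int^'n::finite. supnorm_int q \<le> B}"
proof (rule finite_subset)
  let ?F = "PiE (UNIV :: 'n set) (\<lambda>_. {-\<lfloor>B\<rfloor>..\<lfloor>B\<rfloor>})"
  show "{q :: int^'n. supnorm_int q \<le> B} \<subseteq> (\<lambda>f. \<chi> i. f i) ` ?F"
  proof
    fix q :: "int^'n" assume q: "q \<in> {q. supnorm_int q \<le> B}"
    have "q $ i \<in> {-\<lfloor>B\<rfloor>..\<lfloor>B\<rfloor>}" for i
    proof -
      have "\<bar>real_of_int (q $ i)\<bar> \<le> B" using supnorm_int_ge[of q i] q by simp
      then show ?thesis by (simp add: le_floor_iff) linarith
    qed
    then have "(\<lambda>i. q $ i) \<in> ?F" by auto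
    then show "q \<in> (\<lambda>f. \<chi> i. f i) ` ?F" by (intro image_eqI[of _ _ "\<lambda>i. q $ i"]) (simp_all add: vec_eq_iff)
  qed
  show "finite ((\<lambda>f. (\<chi> i. f i) :: int^'n) ` ?F)" by (intro finite_imageI finite_PiE) auto
qed

lemma dist_Ints_pos:
  fixes x :: real
  assumes "x \<notin> \<int>"
  shows "\<exists>d>0. \<forall>p::int. d \<le> \<bar>x + real_of_int p\<bar>"
proof (intro exI[of _ "min (frac x) (1 - frac x)"] conjI allI)
  have "frac x > 0" using assms by (simp add: frac_gt_0_iff)
  then show "min (frac x) (1 - frac x) > 0" using frac_lt_1[of x] by simp
  fix p :: int
  show "min (frac x) (1 - frac x) \<le> \<bar>x + real_of_int p\<bar>"
  proof (cases "0 \<le> \<lfloor>x\<rfloor> + p")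
    case True
    then have "0 \<le> real_of_int \<lfloor>x\<rfloor> + real_of_int p" by linarith
    then show ?thesis unfolding frac_def by linarith
  next
    case False
    then have "\<lfloor>x\<rfloor> + p \<le> -1" by simp
    then have "real_of_int \<lfloor>x\<rfloor> + real_of_int p \<le> -1" by linarith
    then show ?thesis unfolding frac_def by linarith
  qed
qed

text \<open>If y q were an integer, every multiple of q would be an exact solution, giving
  infinitely many solutions for any exponent.\<close>

lemma not_VWA_dist:
  fixes y :: "real^'n::finite"
  assumes y: "\<not> VWA y" and q: "q \<noteq> (0 :: int^'n)"
  shows "\<exists>d>0. \<forall>p::int. d \<le> \<bar>ydotq y q + real_of_int p\<bar>"
proof (rule dist_Ints_pos, rule notI)
  assume "ydotq y q \<in> \<int>"
  then obtain a where a: "ydotq y q = real_of_int a" by (auto elim: Ints_cases)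
  let ?f = "\<lambda>k::nat. (\<chi> i. int k * q $ i) :: int^'n"
  let ?X = "{q :: int^'n. \<exists>p::int. \<bar>ydotq y q + real_of_int p\<bar> \<le> supnorm_int q powr (- (real CARD('n) + 1))}"
  obtain i where i: "q $ i \<noteq> 0" using q by (auto simp: vec_eq_iff)
  have "inj ?f"
  proof (rule injI)
    fix k l assume "?f k = ?f l"
    then have "?f k $ i = ?f l $ i" by simp
    then show "k = l" using i by simp
  qed
  then have "infinite (range ?f)" by (simp add: finite_image_iff)
  moreover have "range ?f \<subseteq> ?X"
  proof safe
    fix k
    have "ydotq y (?f k) = real k * ydotq y q"
      by (simp add: ydotq_def sum_distrib_left mult_ac)
    then have "ydotq y (?f k) + real_of_int (- (int k * a)) = 0" by (simp add: a)
    then show "\<exists>p::int. \<bar>ydotq y (?f k) + real_of_int p\<bar> \<le> supnorm_int (?f k) powr (- (real CARD('n) + 1))"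
      by (intro exI[of _ "- (int k * a)"]) simp
  qed
  ultimately have "infinite ?X" using finite_subset by blast
  then have "y \<in> W_set (real CARD('n) + 1)" by (simp add: W_set_def)
  then show False using y unfolding VWA_def by auto
qed

text \<open>A violating vector with q nonzero has |y q + p| < \<open>exp (- s * \<tau>)\<close> and
  |q| <= \<open>exp ((1 - \<beta>) * \<tau>)\<close> with s = n + \<beta>, so q solves the
  inequality with an exponent above n. Only finitely many q do, and for these y q keeps a common
  distance from the integers, which \<open>exp (- s * \<tau>)\<close> eventually undercuts.\<close>

lemma not_VWA_renorm:
  fixes y :: "real^'n::finite"
  assumes y: "\<not> VWA y" and beta: "\<beta> > 0"
  shows "\<forall>\<^sub>F \<tau> in sequentially. \<forall>v\<in>int_vectors. v \<noteq> 0 \<longrightarrow>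
           (\<exists>m. exp (- \<beta> * real \<tau>) \<le> \<bar>renorm (real \<tau>) y v $ m\<bar>)"
proof -
  define n where "n = real CARD('n)"
  define s where "s = n + \<beta>"
  have n0: "n > 0" by (simp add: n_def)
  let ?X = "{q :: int^'n. \<exists>p::int. \<bar>ydotq y q + real_of_int p\<bar> \<le> supnorm_int q powr (- s)}"
  have "y \<notin> W_set s" using y beta unfolding VWA_def s_def n_def by auto
  then have fX: "finite ?X" by (simp add: W_set_def)
  obtain d where d: "\<And>q. q \<noteq> (0 :: int^'n) \<Longrightarrow> 0 < d q \<and> (\<forall>p::int. d q \<le> \<bar>ydotq y q + real_of_int p\<bar>)"
    using not_VWA_dist[OF y] by metis
  \<comment> \<open>Inserting 1 keeps the set nonempty. The vector q = 0 has no positive distance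
    and is treated separately: there p is a nonzero integer.\<close>
  define d0 where "d0 = Min (insert 1 (d ` (?X - {0})))"
  have d0: "0 < d0" unfolding d0_def using fX d by (subst Min_gr_iff) auto
  have d0le: "d0 \<le> d q" if "q \<in> ?X" "q \<noteq> 0" for q
    unfolding d0_def using fX that by (intro Min_le) auto
  have "\<forall>\<^sub>F \<tau> in sequentially. 2 / d0 \<le> exp (s * real \<tau>)"
    by (rule eventually_le_exp) (use n0 beta in \<open>simp add: s_def\<close>)
  then show ?thesis
  proof eventually_elim
    case (elim \<tau>)
    have small: "exp (- s * real \<tau>) < d0"
    proof -
      have "2 \<le> d0 * exp (s * real \<tau>)" using elim d0 by (simp add: field_simps)
      then have "1 < d0 * exp (s * real \<tau>)" by simp
      then show ?thesis by (simp add: exp_minus field_simps)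
    qed
    show ?case
    proof (intro ballI impI, rule ccontr)
      fix v :: "real^('n option)"
      assume v: "v \<in> int_vectors" "v \<noteq> 0" and "\<not> (\<exists>m. exp (- \<beta> * real \<tau>) \<le> \<bar>renorm (real \<tau>) y v $ m\<bar>)"
      then have lt: "\<bar>renorm (real \<tau>) y v $ m\<bar> < exp (- \<beta> * real \<tau>)" for m by (meson not_le)
      define q :: "int^'n" where "q = (\<chi> k. \<lfloor>v $ Some k\<rfloor>)"
      define p where "p = \<lfloor>v $ None\<rfloor>"
      have vq: "v $ Some k = real_of_int (q $ k)" for k
        using v(1) by (auto simp: int_vectors_def q_def elim!: Ints_cases dest: spec[of _ "Some k"])
      have vp: "v $ None = real_of_int p"
        using v(1) by (auto simp: int_vectors_def p_def elim!: Ints_cases dest: spec[of _ None])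
      have "exp (n * real \<tau>) * \<bar>ydotq y q + real_of_int p\<bar> < exp (- \<beta> * real \<tau>)"
        using lt[of None] by (simp add: renorm_None vq vp ydotq_def abs_mult n_def add.commute)
      then have "exp (- n * real \<tau>) * (exp (n * real \<tau>) * \<bar>ydotq y q + real_of_int p\<bar>)
           < exp (- n * real \<tau>) * exp (- \<beta> * real \<tau>)" by (rule mult_strict_left_mono) simp
      then have P: "\<bar>ydotq y q + real_of_int p\<bar> < exp (- s * real \<tau>)"
        by (simp add: mult.assoc[symmetric] mult_exp_exp s_def algebra_simps)
      show False
      proof (cases "q = 0")
        case True
        have "p \<noteq> 0"
        proof
          assume "p = 0"
          then have "v $ i = 0" for i using True vq vp by (cases i) auto
          then show False using v(2) by (simp add: vec_eq_iff)
        qed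
        then have "1 \<le> \<bar>real_of_int p\<bar>" by linarith
        moreover have "exp (- s * real \<tau>) \<le> 1" using n0 beta by (simp add: s_def mult_nonpos_nonneg)
        moreover have "ydotq y q = 0" by (simp add: True ydotq_def)
        ultimately show False using P by linarith
      next
        case False
        let ?S = "supnorm_int q"
        have S1: "1 \<le> ?S" by (rule supnorm_int_ge_1[OF False])
        obtain i where i: "?S = \<bar>real_of_int (q $ i)\<bar>" using supnorm_int_attained by blast
        have "exp (- real \<tau>) * ?S < exp (- \<beta> * real \<tau>)"
          using lt[of "Some i"] by (simp add: renorm_Some vq abs_mult i)
        then have "exp (real \<tau>) * (exp (- real \<tau>) * ?S) < exp (real \<tau>) * exp (- \<beta> * real \<tau>)"
          by (rule mult_strict_left_mono) simp
        moreover have "exp (real \<tau>) * (exp (- real \<tau>) * ?S) = ?S" by (simp add: exp_minus)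
        moreover have "exp (real \<tau>) * exp (- \<beta> * real \<tau>) = exp ((1 - \<beta>) * real \<tau>)"
          by (simp add: mult_exp_exp algebra_simps)
        ultimately have "?S \<le> exp ((1 - \<beta>) * real \<tau>)" by linarith
        then have "exp ((1 - \<beta>) * real \<tau>) powr (- s) \<le> ?S powr (- s)"
          using S1 n0 beta by (intro powr_mono2') (auto simp: s_def)
        moreover have "exp (- s * real \<tau>) \<le> exp ((1 - \<beta>) * real \<tau>) powr (- s)"
        proof -
          have "s * ((1 - \<beta>) * real \<tau>) \<le> s * (1 * real \<tau>)"
            using n0 beta by (intro mult_left_mono mult_right_mono) (auto simp: s_def)
          then show ?thesis by (simp add: exp_powr_real mult.commute)
        qed
        ultimately have "q \<in> ?X" using P by (auto intro!: exI[of _ p])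
        then have "d0 \<le> d q" using d0le False by blast
        moreover have "d q \<le> \<bar>ydotq y q + real_of_int p\<bar>" using d[OF False] by blast
        ultimately have "d0 \<le> \<bar>ydotq y q + real_of_int p\<bar>" by linarith
        then show False using P small by linarith
      qed
    qed
  qed
qed

lemma not_VWA_weight:
  fixes y :: "real^'n::finite"
  assumes y: "\<not> VWA y" and delta: "\<delta> > 0"
  shows "\<forall>\<^sub>F \<tau> in sequentially. \<forall>E. rational_subspace E \<longrightarrow>
           exp (- \<delta> * real \<tau>) \<le> subspace_weight (renorm (real \<tau>) y) E"
proof -
  let ?n = "CARD('n)" and ?N = "CARD('n option)"
  \<comment> \<open>With n and N the two cardinalities, the loss (N C) ^ N in
    \<open>subspace_weight_lower\<close> is of order \<open>exp (N * n * \<beta> * \<tau>)\<close>.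
    The first bound on \<beta> makes this at most \<open>exp (\<delta> / 2 * \<tau>)\<close>; the
    other half of \<delta> absorbs the constant \<open>K\<close>. The cap 1 / 2 keeps
    \<open>exp \<tau> * ell\<close> large, as \<open>renorm_spanning\<close> requires.\<close>
  define \<beta> where "\<beta> = min (\<delta> / (2 * real ?n * real ?N)) (1 / 2)"
  have b: "0 < \<beta>" using delta by (simp add: \<beta>_def)
  have b1: "\<beta> \<le> 1 / 2" unfolding \<beta>_def by (rule min.cobounded2)
  have "\<beta> \<le> \<delta> / (2 * real ?n * real ?N)" unfolding \<beta>_def by (rule min.cobounded1)
  moreover have "0 < 2 * real ?n * real ?N" by simp
  ultimately have "\<beta> * (2 * real ?n * real ?N) \<le> \<delta>" by (simp only: pos_le_divide_eq)
  then have b2: "real ?N * (real ?n * \<beta>) \<le> \<delta> / 2" by (simp add: algebra_simps)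
  define K where "K = (real ?N * (4 * real ?n) ^ ?n) ^ ?N"
  have e1: "\<forall>\<^sub>F \<tau> in sequentially. K \<le> exp (\<delta> / 2 * real \<tau>)"
    by (rule eventually_le_exp) (use delta in simp)
  have e2: "\<forall>\<^sub>F \<tau> in sequentially. 2 * real ?n \<le> exp (1 / 2 * real \<tau>)"
    by (rule eventually_le_exp) simp
  show ?thesis
    using e1 e2 not_VWA_renorm[OF y b]
  proof eventually_elim
    case (elim \<tau>)
    define ell where "ell = exp (- \<beta> * real \<tau>)"
    define C where "C = (4 * real ?n / ell) ^ ?n"
    have ell: "0 < ell" "ell \<le> 1" using b b1 by (auto simp: ell_def)
    have "exp (1 / 2 * real \<tau>) \<le> exp (real \<tau>) * ell"
    proof -
      have "1 / 2 * real \<tau> \<le> (1 - \<beta>) * real \<tau>" using b1 by (intro mult_right_mono) auto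
      then show ?thesis by (simp add: ell_def mult_exp_exp algebra_simps)
    qed
    then have l4: "1 \<le> ell / (2 * real ?n) * exp (real \<tau>)" using elim(2) by (simp add: field_simps)
    have sp: "span {u \<in> int_vectors. \<forall>m. \<bar>renorm (real \<tau>) y u $ m\<bar> \<le> C} = UNIV"
      unfolding C_def by (rule renorm_spanning) (use elim(3) ell l4 in \<open>auto simp: ell_def\<close>)
    have C1: "1 \<le> C" unfolding C_def
    proof (rule one_le_power)
      have "1 \<le> real ?n" by (simp add: Suc_le_eq)
      then have "ell \<le> 4 * real ?n" using ell by linarith
      then show "1 \<le> 4 * real ?n / ell" using ell by simp
    qed
    have "(real ?N * C) ^ ?N = K * exp (real ?N * (real ?n * \<beta>) * real \<tau>)"
    proof -
      have "C = (4 * real ?n) ^ ?n * exp (real ?n * (\<beta> * real \<tau>))"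
        unfolding C_def ell_def exp_of_nat_mult by (simp add: power_divide power_mult_distrib exp_minus divide_inverse)
      then have "(real ?N * C) ^ ?N = K * exp (real ?n * (\<beta> * real \<tau>)) ^ ?N"
        by (simp only: K_def mult.assoc[symmetric] power_mult_distrib)
      also have "exp (real ?n * (\<beta> * real \<tau>)) ^ ?N = exp (real ?N * (real ?n * \<beta>) * real \<tau>)"
        by (simp only: exp_of_nat_mult[symmetric] mult.assoc)
      finally show ?thesis .
    qed
    also have "\<dots> \<le> exp (\<delta> / 2 * real \<tau>) * exp (\<delta> / 2 * real \<tau>)"
    proof (intro mult_mono elim(1))
      have "real ?N * (real ?n * \<beta>) * real \<tau> \<le> \<delta> / 2 * real \<tau>" by (rule mult_right_mono[OF b2]) simp
      then show "exp (real ?N * (real ?n * \<beta>) * real \<tau>) \<le> exp (\<delta> / 2 * real \<tau>)" by (simp only: exp_le_cancel_iff)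
    qed auto
    also have "\<dots> = exp (\<delta> * real \<tau>)" by (simp add: mult_exp_exp)
    finally have le: "(real ?N * C) ^ ?N \<le> exp (\<delta> * real \<tau>)" .
    show ?case
    proof (intro allI impI)
      fix E :: "(real^('n option)) set" assume E: "rational_subspace E"
      have "1 \<le> (real ?N * C) ^ ?N * subspace_weight (renorm (real \<tau>) y) E"
        by (rule subspace_weight_lower[OF E linear_renorm _ _ sp]) (use C1 in \<open>auto simp: det_renorm\<close>)
      also have "\<dots> \<le> exp (\<delta> * real \<tau>) * subspace_weight (renorm (real \<tau>) y) E"
        using le by (rule mult_right_mono) (simp add: subspace_weight_def covol_nonneg)
      finally show "exp (- \<delta> * real \<tau>) \<le> subspace_weight (renorm (real \<tau>) y) E"
        by (simp add: exp_minus field_simps)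
    qed
  qed
qed

lemma VWA_short_vectors:
  fixes y :: "real^'n::finite"
  assumes "VWA y"
  shows "\<exists>\<gamma>>0. \<forall>T. \<exists>\<tau>\<ge>T. \<exists>v\<in>int_vectors. v \<noteq> 0 \<and>
           (\<forall>m. \<bar>renorm (real \<tau>) y v $ m\<bar> \<le> exp (- \<gamma> * real \<tau>))"
proof -
  define n where "n = real CARD('n)"
  have n0: "n > 0" by (simp add: n_def)
  obtain s where s: "s > n" "y \<in> W_set s" using assms by (auto simp: VWA_def n_def)
  let ?X = "{q :: int^'n. \<exists>p::int. \<bar>ydotq y q + real_of_int p\<bar> \<le> supnorm_int q powr (- s)}"
  have X: "infinite ?X" using s(2) by (simp add: W_set_def)
  \<comment> \<open>The solution of s (1 - \<gamma>) = n + 2 \<gamma>. One \<gamma> is the gain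
    wanted in the coordinate \<open>None\<close>, the other absorbs the rounding of \<tau> to an
    integer.\<close>
  define \<gamma> where "\<gamma> = (s - n) / (s + 2)"
  have g: "0 < \<gamma>" "\<gamma> < 1" "s * (1 - \<gamma>) = n + 2 * \<gamma>"
    using s n0 by (auto simp: \<gamma>_def field_simps)
  have "\<exists>\<tau>\<ge>T. \<exists>v\<in>int_vectors. v \<noteq> 0 \<and> (\<forall>m. \<bar>renorm (real \<tau>) y v $ m\<bar> \<le> exp (- \<gamma> * real \<tau>))" for T
  proof -
    define T' where "T' = max T (nat \<lceil>(n + 2 * \<gamma>) / \<gamma>\<rceil>)"
    have "infinite (?X - {q. supnorm_int q \<le> exp (real T')})"
      using X finite_supnorm_int_le by (rule Diff_infinite_finite[rotated])
    then have "?X - {q. supnorm_int q \<le> exp (real T')} \<noteq> {}" by (metis finite.emptyI)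
    then obtain q where "q \<in> ?X - {q. supnorm_int q \<le> exp (real T')}" by blast
    then have q: "q \<in> ?X" "exp (real T') < supnorm_int q" by (auto simp: not_le)
    obtain p :: int where p: "\<bar>ydotq y q + real_of_int p\<bar> \<le> supnorm_int q powr (- s)" using q(1) by blast
    define S where "S = supnorm_int q"
    have S1: "1 < S" using q(2) one_le_exp_iff[of "real T'"] unfolding S_def by linarith
    have q0: "q \<noteq> 0"
    proof
      assume "q = 0"
      then have "S = 0" using supnorm_int_attained[of q] by (auto simp: S_def)
      then show False using S1 by simp
    qed
    \<comment> \<open>The least integer time at which q is contracted to length at most
      \<open>exp (- \<gamma> * \<tau>)\<close>.\<close>
    define \<tau> where "\<tau> = nat \<lceil>ln S / (1 - \<gamma>)\<rceil>"
    have "0 < ln S / (1 - \<gamma>)" using S1 g by simp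
    then have t: "ln S / (1 - \<gamma>) \<le> real \<tau>" "real \<tau> < ln S / (1 - \<gamma>) + 1" unfolding \<tau>_def by linarith+
    have lnS: "real T' < ln S" using q(2) S1 by (metis S_def exp_less_cancel_iff exp_ln less_trans zero_less_one)
    have "ln S \<le> ln S / (1 - \<gamma>)" using g S1 by (simp add: field_simps)
    then have tT: "T' \<le> \<tau>" using lnS t(1) by linarith
    have S_le: "S \<le> exp ((1 - \<gamma>) * real \<tau>)"
    proof -
      have "ln S \<le> (1 - \<gamma>) * real \<tau>" using t(1) g by (simp add: field_simps)
      then have "exp (ln S) \<le> exp ((1 - \<gamma>) * real \<tau>)" by simp
      then show ?thesis using S1 by simp
    qed
    have gT: "n + 2 * \<gamma> \<le> \<gamma> * real \<tau>"
    proof -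
      have "(n + 2 * \<gamma>) / \<gamma> \<le> real T'" unfolding T'_def by linarith
      then have "(n + 2 * \<gamma>) / \<gamma> \<le> real \<tau>" using tT by linarith
      then show ?thesis using g by (simp add: field_simps)
    qed
    have "S powr (- s) \<le> exp (- (n + \<gamma>) * real \<tau>)"
    proof -
      have "(1 - \<gamma>) * (real \<tau> - 1) \<le> ln S" using t(2) g by (simp add: field_simps)
      then have "s * ((1 - \<gamma>) * (real \<tau> - 1)) \<le> s * ln S" using s n0 by (intro mult_left_mono) auto
      then have "(n + 2 * \<gamma>) * (real \<tau> - 1) \<le> s * ln S" using g(3) by (simp add: mult.assoc[symmetric])
      then have "- s * ln S \<le> - (n + \<gamma>) * real \<tau>" using gT by (simp add: algebra_simps)
      then show ?thesis using S1 by (simp add: powr_def)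
    qed
    then have P: "\<bar>ydotq y q + real_of_int p\<bar> \<le> exp (- (n + \<gamma>) * real \<tau>)" using p S_def by simp
    define v :: "real^('n option)" where
      "v = (\<chi> i. case i of None \<Rightarrow> real_of_int p | Some k \<Rightarrow> real_of_int (q $ k))"
    have vZ: "v \<in> int_vectors" by (auto simp: int_vectors_def v_def split: option.split)
    have v0: "v \<noteq> 0"
    proof
      assume a: "v = 0"
      obtain k where k: "q $ k \<noteq> 0" using q0 by (auto simp: vec_eq_iff)
      have "v $ Some k = 0" using a by simp
      then show False using k by (simp add: v_def)
    qed
    have "\<bar>renorm (real \<tau>) y v $ m\<bar> \<le> exp (- \<gamma> * real \<tau>)" for m
    proof (cases m)
      case None
      have "\<bar>renorm (real \<tau>) y v $ None\<bar> = exp (n * real \<tau>) * \<bar>ydotq y q + real_of_int p\<bar>"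
        by (simp add: renorm_None v_def ydotq_def abs_mult n_def add.commute)
      also have "\<dots> \<le> exp (n * real \<tau>) * exp (- (n + \<gamma>) * real \<tau>)" using P by (intro mult_left_mono) auto
      also have "\<dots> = exp (- \<gamma> * real \<tau>)" by (simp add: mult_exp_exp algebra_simps)
      finally show ?thesis using None by simp
    next
      case (Some k)
      have "\<bar>renorm (real \<tau>) y v $ Some k\<bar> = exp (- real \<tau>) * \<bar>real_of_int (q $ k)\<bar>"
        by (simp add: renorm_Some v_def abs_mult)
      also have "\<dots> \<le> exp (- real \<tau>) * exp ((1 - \<gamma>) * real \<tau>)"
        using supnorm_int_ge[of q k] S_le by (intro mult_left_mono) (auto simp: S_def)
      also have "\<dots> = exp (- \<gamma> * real \<tau>)" by (simp add: mult_exp_exp algebra_simps)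
      finally show ?thesis using Some by simp
    qed
    then show ?thesis using tT vZ v0 by (intro exI[of _ \<tau>]) (auto simp: T'_def)
  qed
  then show ?thesis using g(1) by blast
qed

section \<open>Curves\<close>

lemma continuous_on_Max_image:
  fixes f :: "'i \<Rightarrow> 'a::topological_space \<Rightarrow> real"
  assumes "finite I" "I \<noteq> {}" "\<And>i. i \<in> I \<Longrightarrow> continuous_on X (f i)"
  shows "continuous_on X (\<lambda>x. Max ((\<lambda>i. f i x) ` I))"
  using assms
proof (induction I rule: finite_ne_induct)
  case (insert i I)
  then have "continuous_on X (\<lambda>x. max (f i x) (Max ((\<lambda>i. f i x) ` I)))"
    by (intro continuous_on_max) auto
  then show ?case using insert by simp
qed simp

lemma borel_sublevel_continuous_on:
  fixes f :: "real \<Rightarrow> real"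
  assumes "continuous_on X f" "X \<in> sets borel"
  shows "{x\<in>X. f x < s} \<in> sets borel"
proof -
  obtain A where A: "open A" "A \<inter> X = f -` {..<s} \<inter> X"
    using assms(1) open_lessThan[of s] unfolding continuous_on_open_invariant by blast
  then have "{x\<in>X. f x < s} = A \<inter> X" by auto
  then show ?thesis using A(1) assms(2) by auto
qed

text \<open>Two uses of the same derivative: the good property on dyadic cells, and, with the whole
  unit interval as sublevel set, the control of the level v by the supremum of the function. The
  constants depend on l only.\<close>

lemma affine_sublevel_good:
  fixes G :: "nat \<Rightarrow> real \<Rightarrow> real^'n::finite"
  assumes d: "\<And>i s. i < l \<Longrightarrow> s \<in> {0..1} \<Longrightarrow> (G i has_vector_derivative G (Suc i) s) (at s)"
    and k: "k \<le> l" "0 < l"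
    and v: "\<And>s. s \<in> {0..1} \<Longrightarrow> v \<le> \<bar>(if k = 0 then a else 0) + b \<bullet> G k s\<bar> \<and>
        \<bar>(if k = 0 then a else 0) + b \<bullet> G k s\<bar> \<le> 2 * v"
  shows "dyadic_cell j i \<subseteq> {0..<1} \<Longrightarrow> y \<in> dyadic_cell j i \<Longrightarrow> 0 \<le> \<tau> \<Longrightarrow>
      emeasure lborel {x \<in> dyadic_cell j i. \<bar>a + b \<bullet> G 0 x\<bar> < \<tau> * \<bar>a + b \<bullet> G 0 y\<bar>}
        \<le> ennreal (root l (real (3 * l + 2) * (2 * real (Suc l)) ^ l * \<tau>)) * emeasure lborel (dyadic_cell j i)"
    and "(\<And>s. s \<in> {0..<1} \<Longrightarrow> \<bar>a + b \<bullet> G 0 s\<bar> \<le> \<epsilon>) \<Longrightarrow>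
      v \<le> fact l * real (Suc l) * (2 * real (Suc l)) ^ l * \<epsilon>"
proof -
  define H where "H i s = (if i = 0 then a else 0) + b \<bullet> G i s" for i :: nat and s
  have dH: "(H i has_real_derivative H (Suc i) s) (at s)" if "i < k" "s \<in> {0..1}" for i s
  proof -
    have "((\<lambda>s. b \<bullet> G i s) has_vector_derivative b \<bullet> G (Suc i) s) (at s)"
      using bounded_linear.has_vector_derivative[OF bounded_linear_inner_right d[of i s], of b] that k by auto
    then have "((\<lambda>s. b \<bullet> G i s) has_real_derivative b \<bullet> G (Suc i) s) (at s)"
      by (simp add: has_real_derivative_iff_has_vector_derivative)
    then show ?thesis unfolding H_def by (auto intro!: derivative_eq_intros)
  qed
  have vH: "v \<le> \<bar>H k s\<bar>" "\<bar>H k s\<bar> \<le> 2 * v" if "s \<in> {0..1}" for s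
    using v[OF that] by (auto simp: H_def)
  have H0: "H 0 s = a + b \<bullet> G 0 s" for s by (simp add: H_def)
  {
    assume cell: "dyadic_cell j i \<subseteq> {0..<1}" and y: "y \<in> dyadic_cell j i" and t: "0 \<le> \<tau>"
    let ?A = "{x \<in> dyadic_cell j i. \<bar>H 0 x\<bar> < \<tau> * \<bar>H 0 y\<bar>}"
    have cont: "continuous_on {0..1} (\<lambda>x. \<bar>H 0 x\<bar>)"
    proof (intro continuous_on_rabs)
      have "G 0 differentiable at s" if "s \<in> {0..1}" for s
        using d[of 0 s] that k by (auto intro: differentiableI_vector)
      then have "continuous_on {0..1} (G 0)"
        by (intro continuous_at_imp_continuous_on ballI differentiable_imp_continuous_within) auto
      then show "continuous_on {0..1} (H 0)" unfolding H_def by (intro continuous_intros)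
    qed
    have m: "?A \<in> sets borel"
      by (rule borel_sublevel_continuous_on[OF continuous_on_subset[OF cont]]) (use cell in auto)
    have sub: "?A \<subseteq> dyadic_cell j i" by auto
    have "bounded ?A" by (rule bounded_subset[of "{0..1}"]) (use cell in auto)
    then have lm: "?A \<in> lmeasurable" using m by (intro bounded_set_imp_lmeasurable) auto
    have eA: "emeasure lborel ?A = ennreal (measure lebesgue ?A)"
      using emeasure_eq_measure2[OF lm] m by simp
    have "emeasure lborel ?A \<le> emeasure lborel (dyadic_cell j i)" by (rule emeasure_mono[OF sub]) simp
    then have le: "measure lebesgue ?A \<le> 1 / 2 ^ j" by (simp add: eA emeasure_dyadic_cell)
    have "measure lebesgue ?A \<le> root l (real (3 * l + 2) * (2 * real (Suc l)) ^ l * \<tau>) * (1 / 2 ^ j)"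
      by (rule sublevel_good[where G = H and k = k and v = v and a = 0 and b = 1])
        (use dH vH cell y dyadic_cell_dist lm le k t in \<open>auto simp: subset_iff\<close>)
    then have "emeasure lborel ?A \<le> ennreal (root l (real (3 * l + 2) * (2 * real (Suc l)) ^ l * \<tau>) * (1 / 2 ^ j))"
      unfolding eA by (rule ennreal_leI)
    also have "\<dots> = ennreal (root l (real (3 * l + 2) * (2 * real (Suc l)) ^ l * \<tau>)) * emeasure lborel (dyadic_cell j i)"
      using t k by (subst ennreal_mult) (auto simp: emeasure_dyadic_cell intro!: real_root_ge_zero)
    finally show "emeasure lborel {x \<in> dyadic_cell j i. \<bar>a + b \<bullet> G 0 x\<bar> < \<tau> * \<bar>a + b \<bullet> G 0 y\<bar>}
        \<le> ennreal (root l (real (3 * l + 2) * (2 * real (Suc l)) ^ l * \<tau>)) * emeasure lborel (dyadic_cell j i)"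
      unfolding H0 .
  }
  assume eps: "\<And>s. s \<in> {0..<1} \<Longrightarrow> \<bar>a + b \<bullet> G 0 s\<bar> \<le> \<epsilon>"
  have e0: "0 \<le> \<epsilon>" using eps[of 0] by (smt (verit) atLeastLessThan_iff)
  have "v \<le> fact k * real (Suc k) * \<epsilon> * (2 * real (Suc k) / measure lebesgue {0..<1::real}) ^ k"
    by (rule sublevel_derivative_bound[where G = H and k = k and v = v and a = 0 and b = 1])
      (use dH vH eps in \<open>auto simp: H0 intro!: bounded_set_imp_lmeasurable\<close>)
  also have "\<dots> = (fact k * real (Suc k) * (2 * real (Suc k)) ^ k) * \<epsilon>" by simp
  also have "\<dots> \<le> (fact l * real (Suc l) * (2 * real (Suc l)) ^ l) * \<epsilon>"
  proof (intro mult_right_mono mult_mono)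
    have "(2 * real (Suc k)) ^ k \<le> (2 * real (Suc l)) ^ k" using k by (intro power_mono) auto
    also have "\<dots> \<le> (2 * real (Suc l)) ^ l" using k by (intro power_increasing) auto
    finally show "(2 * real (Suc k)) ^ k \<le> (2 * real (Suc l)) ^ l" .
  qed (use k e0 fact_mono in \<open>auto simp: fact_mono\<close>)
  finally show "v \<le> fact l * real (Suc l) * (2 * real (Suc l)) ^ l * \<epsilon>" .
qed

text \<open>The hypothesis on a and b asks that every affine function has along the curve a
  derivative of order at most l that is constant up to a factor 2 and dominates the value at
  \<open>y0\<close>, with \<open>l\<close> and \<open>C0\<close> uniform. It feeds both inputs of
  the nondivergence argument, goodness and largeness, for all rational subspaces at once.\<close>

lemma unit_curve_no_short_vectors:
  fixes G :: "nat \<Rightarrow> real \<Rightarrow> real^'n::finite"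
  assumes d: "\<And>i s. i < l \<Longrightarrow> s \<in> {0..1} \<Longrightarrow> (G i has_vector_derivative G (Suc i) s) (at s)"
    and l: "0 < l" and C0: "0 < C0"
    and v: "\<And>a b. \<exists>k\<le>l. \<exists>v. \<bar>a + b \<bullet> y0\<bar> \<le> C0 * v \<and> (\<forall>s\<in>{0..1}. v \<le> \<bar>(if k = 0 then a else 0) + b \<bullet> G k s\<bar> \<and>
        \<bar>(if k = 0 then a else 0) + b \<bullet> G k s\<bar> \<le> 2 * v)"
    and y0: "\<not> VWA y0" and g: "0 < \<gamma>"
  shows "AE s in lborel. s \<in> {0..<1} \<longrightarrow> (\<forall>\<^sub>F \<tau> in sequentially.
     \<not> (\<exists>v\<in>int_vectors. v \<noteq> 0 \<and> (\<forall>m. \<bar>renorm (real \<tau>) (G 0 s) v $ m\<bar> \<le> exp (- \<gamma> * real \<tau>))))"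
proof -
  let ?N = "real CARD('n option)" and ?K = "Suc CARD('n option)"
  define B where "B = real (3 * l + 2) * (2 * real (Suc l)) ^ l"
  define \<eta> where "\<eta> \<tau> = root l (B * \<tau>)" for \<tau>
  \<comment> \<open>Chosen so that \<eta> c is 1 / 4.\<close>
  define c where "c = 1 / (B * 4 ^ l)"
  define C1 where "C1 = fact l * real (Suc l) * (2 * real (Suc l)) ^ l"
  \<comment> \<open>Makes C0 * C1 * \<kappa> at most 1 / 2, which gives the contradiction in
    \<open>large\<close>; the cap 1 keeps \<rho> at most 1.\<close>
  define \<kappa> where "\<kappa> = min 1 (1 / (2 * C0 * C1))"
  define \<psi> where "\<psi> \<tau> E s = subspace_weight (renorm (real \<tau>) (G 0 s)) E" for \<tau> :: nat and E s
  define bad where "bad \<tau> s \<longleftrightarrow> (\<exists>v\<in>int_vectors. v \<noteq> 0 \<and> (\<forall>m. \<bar>renorm (real \<tau>) (G 0 s) v $ m\<bar> \<le> exp (- \<gamma> * real \<tau>)))" for \<tau> :: nat and s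
  have B1: "1 \<le> B" unfolding B_def
  proof -
    have "1 * 1 \<le> real (3 * l + 2) * (2 * real (Suc l)) ^ l" by (intro mult_mono one_le_power) auto
    then show "1 \<le> real (3 * l + 2) * (2 * real (Suc l)) ^ l" by simp
  qed
  have c: "0 < c" "c \<le> 1" "\<eta> c < 1 / 2"
  proof -
    show "0 < c" using B1 by (simp add: c_def)
    have "1 * 1 \<le> B * 4 ^ l" using B1 by (intro mult_mono) auto
    then show "c \<le> 1" by (simp add: c_def)
    have "B * c = (1 / 4) ^ l" using B1 by (simp add: c_def power_one_over)
    then have "\<eta> c = 1 / 4" unfolding \<eta>_def using l by (simp add: real_root_power_cancel del: power_one_over)
    then show "\<eta> c < 1 / 2" by simp
  qed
  have \<eta>: "\<eta> s \<le> \<eta> t" if "0 \<le> s" "s \<le> t" for s t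
    unfolding \<eta>_def using that B1 l by (simp add: mult_left_mono)
  have \<eta>0: "0 \<le> \<eta> 0" by (simp add: \<eta>_def)
  have C1: "0 < C1" by (simp add: C1_def)
  have \<kappa>: "0 < \<kappa>" "\<kappa> \<le> 1" "C0 * (C1 * \<kappa>) < 1"
  proof -
    show "0 < \<kappa>" "\<kappa> \<le> 1" using C0 C1 by (auto simp: \<kappa>_def)
    have "\<kappa> \<le> 1 / (2 * C0 * C1)" unfolding \<kappa>_def by (rule min.cobounded2)
    then have "C0 * C1 * \<kappa> \<le> C0 * C1 * (1 / (2 * C0 * C1))" using C0 C1 by (intro mult_left_mono) auto
    also have "\<dots> = 1 / 2" using C0 C1 by simp
    finally show "C0 * (C1 * \<kappa>) < 1" by (simp add: mult.assoc)
  qed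
  have "\<forall>\<tau>::nat. \<forall>E. \<forall>\<sigma>. \<exists>a b. \<forall>y. det (mix_rows (initial_indices (dim E)) (renorm (real \<tau>) y \<circ> minimal_basis E) (\<lambda>i. axis (\<sigma> i) 1))
      = a + b \<bullet> (y :: real^'n)" using det_renorm_affine by blast
  then obtain a b where ab: "\<And>\<tau>::nat. \<And>E \<sigma> y. det (mix_rows (initial_indices (dim E)) (renorm (real \<tau>) y \<circ> minimal_basis E) (\<lambda>i. axis (\<sigma> i) 1))
      = a \<tau> E \<sigma> + b \<tau> E \<sigma> \<bullet> (y :: real^'n)" by metis
  have \<psi>_ge: "\<bar>a \<tau> E \<sigma> + b \<tau> E \<sigma> \<bullet> G 0 s\<bar> \<le> \<psi> \<tau> E s" for \<tau> E \<sigma> s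
    unfolding \<psi>_def subspace_weight_def ab[symmetric] by (rule covol_ge)
  have \<psi>_att: "\<exists>\<sigma>. \<psi> \<tau> E s = \<bar>a \<tau> E \<sigma> + b \<tau> E \<sigma> \<bullet> G 0 s\<bar>" for \<tau> E s
    unfolding \<psi>_def subspace_weight_def ab[symmetric] by (rule covol_attained)
  have contG: "continuous_on {0..1} (G 0)"
  proof -
    have "G 0 differentiable at s" if "s \<in> {0..1}" for s
      using d[of 0 s] that l by (auto intro: differentiableI_vector)
    then show ?thesis
      by (intro continuous_at_imp_continuous_on ballI differentiable_imp_continuous_within) auto
  qed
  have cont: "continuous_on {0..<1} (\<psi> \<tau> E)" for \<tau> E
  proof -
    have "\<psi> \<tau> E = (\<lambda>s. Max ((\<lambda>\<sigma>. \<bar>a \<tau> E \<sigma> + b \<tau> E \<sigma> \<bullet> G 0 s\<bar>) ` UNIV))"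
      unfolding \<psi>_def subspace_weight_def covol_def ab ..
    moreover have "continuous_on {0..<1} (\<lambda>s. Max ((\<lambda>\<sigma>. \<bar>a \<tau> E \<sigma> + b \<tau> E \<sigma> \<bullet> G 0 s\<bar>) ` UNIV))"
      by (rule continuous_on_Max_image)
        (auto intro!: continuous_intros continuous_on_subset[OF contG])
    ultimately show ?thesis by simp
  qed
  have meas: "{x \<in> dyadic_cell k j. \<psi> \<tau> E x < s} \<in> sets borel" if "dyadic_cell k j \<subseteq> {0..<1}" for k j s \<tau> E
    by (rule borel_sublevel_continuous_on[OF continuous_on_subset[OF cont that]]) simp
  have good: "emeasure lborel {x \<in> dyadic_cell k j. \<psi> \<tau> E x < t * \<psi> \<tau> E y}
      \<le> ennreal (\<eta> t) * emeasure lborel (dyadic_cell k j)"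
    if cell: "dyadic_cell k j \<subseteq> {0..<1}" "y \<in> dyadic_cell k j" "0 \<le> t" for k j y t \<tau> E
  proof -
    \<comment> \<open>Goodness passes to a maximum of functions: one of them attains the maximum at
      y, and wherever the maximum is small so is this one.\<close>
    obtain \<sigma> where s: "\<psi> \<tau> E y = \<bar>a \<tau> E \<sigma> + b \<tau> E \<sigma> \<bullet> G 0 y\<bar>" using \<psi>_att by blast
    obtain k' w where kw: "k' \<le> l" "\<And>s. s\<in>{0..1} \<Longrightarrow> w \<le> \<bar>(if k' = 0 then a \<tau> E \<sigma> else 0) + b \<tau> E \<sigma> \<bullet> G k' s\<bar> \<and>
        \<bar>(if k' = 0 then a \<tau> E \<sigma> else 0) + b \<tau> E \<sigma> \<bullet> G k' s\<bar> \<le> 2 * w" using v[of "a \<tau> E \<sigma>" "b \<tau> E \<sigma>"] by blast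
    have "{x \<in> dyadic_cell k j. \<psi> \<tau> E x < t * \<psi> \<tau> E y}
       \<subseteq> {x \<in> dyadic_cell k j. \<bar>a \<tau> E \<sigma> + b \<tau> E \<sigma> \<bullet> G 0 x\<bar> < t * \<bar>a \<tau> E \<sigma> + b \<tau> E \<sigma> \<bullet> G 0 y\<bar>}"
      unfolding s using \<psi>_ge[of \<tau> E \<sigma>] by (auto intro: le_less_trans)
    moreover have "{x \<in> dyadic_cell k j. \<bar>a \<tau> E \<sigma> + b \<tau> E \<sigma> \<bullet> G 0 x\<bar> < t * \<bar>a \<tau> E \<sigma> + b \<tau> E \<sigma> \<bullet> G 0 y\<bar>} \<in> sets lborel"
    proof -
      have "continuous_on (dyadic_cell k j) (\<lambda>x. \<bar>a \<tau> E \<sigma> + b \<tau> E \<sigma> \<bullet> G 0 x\<bar>)"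
        by (intro continuous_intros continuous_on_subset[OF contG]) (use cell in auto)
      from borel_sublevel_continuous_on[OF this] show ?thesis by simp
    qed
    ultimately have "emeasure lborel {x \<in> dyadic_cell k j. \<psi> \<tau> E x < t * \<psi> \<tau> E y} \<le>
        emeasure lborel {x \<in> dyadic_cell k j. \<bar>a \<tau> E \<sigma> + b \<tau> E \<sigma> \<bullet> G 0 x\<bar> < t * \<bar>a \<tau> E \<sigma> + b \<tau> E \<sigma> \<bullet> G 0 y\<bar>}"
      by (rule emeasure_mono)
    also have "\<dots> \<le> ennreal (\<eta> t) * emeasure lborel (dyadic_cell k j)"
      unfolding \<eta>_def B_def by (rule affine_sublevel_good(1)[OF d kw(1) l kw(2) cell])
    finally show ?thesis .
  qed
  have cell0: "dyadic_cell 0 0 = {0..<1}" by (simp add: dyadic_cell_eq)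
  have large: "\<exists>s\<in>{0..<1}. \<kappa> * \<theta> \<le> \<psi> \<tau> E s" if th: "0 < \<theta>" "\<theta> \<le> subspace_weight (renorm (real \<tau>) y0) E" for \<tau> :: nat and E \<theta>
  proof (rule ccontr)
    assume a: "\<not> ?thesis"
    \<comment> \<open>If the covolume stayed below \<kappa> * \<theta> along the curve, so would the
      affine function attaining it at \<open>y0\<close>; then its derivative level w, and with it
      the value at \<open>y0\<close>, would be too small.\<close>
    obtain \<sigma> where "subspace_weight (renorm (real \<tau>) y0) E = \<bar>a \<tau> E \<sigma> + b \<tau> E \<sigma> \<bullet> y0\<bar>"
      unfolding subspace_weight_def ab[symmetric] using covol_attained by blast
    then have le: "\<theta> \<le> \<bar>a \<tau> E \<sigma> + b \<tau> E \<sigma> \<bullet> y0\<bar>" using th by simp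
    obtain k' w where kw: "k' \<le> l" "\<bar>a \<tau> E \<sigma> + b \<tau> E \<sigma> \<bullet> y0\<bar> \<le> C0 * w"
      "\<And>s. s\<in>{0..1} \<Longrightarrow> w \<le> \<bar>(if k' = 0 then a \<tau> E \<sigma> else 0) + b \<tau> E \<sigma> \<bullet> G k' s\<bar> \<and>
        \<bar>(if k' = 0 then a \<tau> E \<sigma> else 0) + b \<tau> E \<sigma> \<bullet> G k' s\<bar> \<le> 2 * w" using v[of "a \<tau> E \<sigma>" "b \<tau> E \<sigma>"] by blast
    have "w \<le> C1 * (\<kappa> * \<theta>)" unfolding C1_def
    proof (rule affine_sublevel_good(2)[OF d kw(1) l kw(3)])
      fix s :: real assume "s \<in> {0..<1}"
      then have "\<psi> \<tau> E s \<le> \<kappa> * \<theta>" using a by (meson le_cases)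
      then show "\<bar>a \<tau> E \<sigma> + b \<tau> E \<sigma> \<bullet> G 0 s\<bar> \<le> \<kappa> * \<theta>" using \<psi>_ge[of \<tau> E \<sigma> s] by linarith
    qed
    then have "C0 * w \<le> C0 * (C1 * (\<kappa> * \<theta>))" using C0 by (intro mult_left_mono) auto
    then have "1 * \<theta> \<le> (C0 * (C1 * \<kappa>)) * \<theta>" using le kw(2) by (simp add: mult_ac)
    then show False using \<kappa>(3) th(1) by (simp only: mult_le_cancel_right_pos)
  qed
  \<comment> \<open>\<epsilon> / \<rho> decays like \<open>exp (- (\<gamma> / 2) * \<tau>)\<close>,
    and the l-th root in \<eta> leaves the geometric ratio
    \<open>exp (- (\<gamma> / (2 * l)))\<close>. The factor 2 in \<epsilon> makes a short vector
    violate \<open>short_vector_bound\<close> strictly.\<close>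
  define \<rho> where "\<rho> \<tau> = \<kappa> * exp (- (\<gamma> / 2) * real \<tau>)" for \<tau> :: nat
  define \<epsilon> where "\<epsilon> \<tau> = 2 * ?N * exp (- \<gamma> * real \<tau>)" for \<tau> :: nat
  define M where "M \<tau> = real ?K * \<eta> (\<epsilon> \<tau> / (c ^ ?K * \<rho> \<tau>))" for \<tau> :: nat
  have \<rho>: "0 < \<rho> \<tau>" "\<rho> \<tau> \<le> 1" for \<tau>
    using \<kappa> g mult_mono[of \<kappa> 1 "exp (- (\<gamma> / 2) * real \<tau>)" 1] by (auto simp: \<rho>_def)
  have \<epsilon>: "0 < \<epsilon> \<tau>" for \<tau> by (simp add: \<epsilon>_def)
  have cK: "0 < c ^ ?K" using c by simp
  have "\<forall>\<^sub>F \<tau> in sequentially. 2 * ?N / (c ^ ?K * \<kappa>) \<le> exp (\<gamma> / 2 * real \<tau>)"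
    by (rule eventually_le_exp) (use g in simp)
  then have "\<forall>\<^sub>F \<tau> in sequentially. \<exists>A\<in>sets borel. A \<subseteq> {0..<1} \<and> emeasure lborel A \<le> ennreal (M \<tau>) \<and>
      (\<forall>s\<in>{0..<1}-A. \<not> bad \<tau> s)"
    using not_VWA_weight[OF y0 half_gt_zero[OF g]]
  proof eventually_elim
    case (elim \<tau>)
    note big = elim(1) and wt = elim(2)
    have "\<exists>Bad\<in>sets borel. Bad \<subseteq> dyadic_cell 0 0 \<and>
        emeasure lborel Bad \<le> ennreal (real ?K * \<eta> (\<epsilon> \<tau> / (c ^ ?K * \<rho> \<tau>))) * emeasure lborel (dyadic_cell 0 0) \<and>
        (\<forall>x\<in>dyadic_cell 0 0 - Bad. chain_protected comparable (Collect rational_subspace) (\<psi> \<tau>) {} (\<epsilon> \<tau>) (\<rho> \<tau>) (c ^ ?K * \<rho> \<tau>) x)"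
    proof (rule nondivergence_induction[where K = ?K and \<eta> = \<eta>])
      show "comparable D D" for D :: "(real^('n option)) set" by (simp add: comparable_def)
      show "comparable D E \<Longrightarrow> comparable E D" for D E :: "(real^('n option)) set" by (auto simp: comparable_def)
      show "card F \<le> ?K" if "finite F" "F \<subseteq> Collect rational_subspace" "pairwise_rel comparable F"
        for F :: "(real^('n option)) set set" by (rule subspace_chain_card[OF that])
      show "continuous_on {0..<1} (\<psi> \<tau> E)" for E by (rule cont)
      show "\<exists>y\<in>dyadic_cell 0 0. \<rho> \<tau> \<le> \<psi> \<tau> E y" if "E \<in> Collect rational_subspace - {}" for E
        unfolding cell0 \<rho>_def by (rule large) (use wt that in auto)
    qed (use meas good \<eta> \<eta>0 c \<rho> \<epsilon> cell0 in \<open>auto simp: pairwise_rel_def\<close>)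
    then obtain A where A: "A \<in> sets borel" "A \<subseteq> {0..<1}"
        "emeasure lborel A \<le> ennreal (M \<tau>)"
        "\<And>x. x\<in>{0..<1} - A \<Longrightarrow> chain_protected comparable (Collect rational_subspace) (\<psi> \<tau>) {} (\<epsilon> \<tau>) (\<rho> \<tau>) (c ^ ?K * \<rho> \<tau>) x"
      unfolding cell0 M_def by auto
    have "\<not> bad \<tau> s" if s: "s \<in> {0..<1} - A" for s
    proof
      assume "bad \<tau> s"
      then obtain v where v: "v\<in>int_vectors" "v \<noteq> 0" "\<And>m. \<bar>renorm (real \<tau>) (G 0 s) v $ m\<bar> \<le> exp (- \<gamma> * real \<tau>)"
        unfolding bad_def by blast
      have "chain_protected comparable (Collect rational_subspace) (\<lambda>E x. subspace_weight (renorm (real \<tau>) (G 0 x)) E)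
          {} (\<epsilon> \<tau>) (\<rho> \<tau>) (c ^ ?K * \<rho> \<tau>) s" using A(4)[OF s] unfolding \<psi>_def .
      from short_vector_bound[OF this linear_renorm \<rho>(2) v]
      have le: "min (\<epsilon> \<tau>) (c ^ ?K * \<rho> \<tau>) \<le> ?N * exp (- \<gamma> * real \<tau>)" .
      have Ne: "0 < ?N * exp (- \<gamma> * real \<tau>)" by simp
      have "2 * ?N \<le> c ^ ?K * \<kappa> * exp (\<gamma> / 2 * real \<tau>)"
        using big cK \<kappa>(1) by (simp only: pos_divide_le_eq mult_pos_pos mult.commute)
      then have "2 * ?N * exp (- \<gamma> * real \<tau>) \<le> c ^ ?K * \<kappa> * exp (\<gamma> / 2 * real \<tau>) * exp (- \<gamma> * real \<tau>)"
        by (rule mult_right_mono) simp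
      also have "\<dots> = c ^ ?K * \<rho> \<tau>"
      proof -
        have "exp (\<gamma> / 2 * real \<tau>) * exp (- \<gamma> * real \<tau>) = exp (- (\<gamma> / 2) * real \<tau>)"
          by (simp add: mult_exp_exp algebra_simps)
        then show ?thesis by (simp only: \<rho>_def mult.assoc)
      qed
      finally have "2 * (?N * exp (- \<gamma> * real \<tau>)) \<le> min (\<epsilon> \<tau>) (c ^ ?K * \<rho> \<tau>)"
        by (simp add: \<epsilon>_def mult.assoc)
      then show False using le Ne by linarith
    qed
    then show ?case using A by blast
  qed
  then obtain \<tau>0 where "\<forall>\<tau>\<ge>\<tau>0. \<exists>A\<in>sets borel. A \<subseteq> {0..<1} \<and> emeasure lborel A \<le> ennreal (M \<tau>) \<and>
      (\<forall>s\<in>{0..<1}-A. \<not> bad \<tau> s)" unfolding eventually_sequentially by blast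
  then have "\<forall>\<tau>. \<exists>A. \<tau> \<ge> \<tau>0 \<longrightarrow> A\<in>sets borel \<and> A \<subseteq> {0..<1} \<and> emeasure lborel A \<le> ennreal (M \<tau>) \<and>
      (\<forall>s\<in>{0..<1}-A. \<not> bad \<tau> s)" by blast
  then obtain A' where A': "\<And>\<tau>. \<tau> \<ge> \<tau>0 \<Longrightarrow> A' \<tau> \<in>sets borel \<and> A' \<tau> \<subseteq> {0..<1} \<and> emeasure lborel (A' \<tau>) \<le> ennreal (M \<tau>) \<and>
      (\<forall>s\<in>{0..<1}-A' \<tau>. \<not> bad \<tau> s)" by metis
  define A where "A \<tau> = (if \<tau> \<ge> \<tau>0 then A' \<tau> else {})" for \<tau>
  have M: "M \<tau> = real ?K * root l (B * (2 * ?N) / (c ^ ?K * \<kappa>)) * exp (- (\<gamma> / (2 * real l))) ^ \<tau>" for \<tau>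
  proof -
    have e: "exp (- \<gamma> * real \<tau>) / exp (- (\<gamma> / 2) * real \<tau>) = (exp (- (\<gamma> / (2 * real l))) ^ \<tau>) ^ l"
      using l by (simp add: exp_diff[symmetric] exp_of_nat_mult[symmetric] field_simps)
    have "B * (\<epsilon> \<tau> / (c ^ ?K * \<rho> \<tau>)) = B * (2 * ?N) / (c ^ ?K * \<kappa>) * (exp (- \<gamma> * real \<tau>) / exp (- (\<gamma> / 2) * real \<tau>))"
      by (simp add: \<epsilon>_def \<rho>_def)
    then have "\<eta> (\<epsilon> \<tau> / (c ^ ?K * \<rho> \<tau>)) =
        root l (B * (2 * ?N) / (c ^ ?K * \<kappa>)) * root l ((exp (- (\<gamma> / (2 * real l))) ^ \<tau>) ^ l)"
      unfolding \<eta>_def e by (simp only: real_root_mult)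
    also have "root l ((exp (- (\<gamma> / (2 * real l))) ^ \<tau>) ^ l) = exp (- (\<gamma> / (2 * real l))) ^ \<tau>"
      using l by (intro real_root_power_cancel) auto
    finally show ?thesis unfolding M_def by (simp only: mult.assoc)
  qed
  have "B * (2 * ?N) / (c ^ ?K * \<kappa>) \<ge> 0" using B1 cK \<kappa>(1) by (intro divide_nonneg_pos mult_nonneg_nonneg) auto
  then have M0: "0 \<le> M \<tau>" for \<tau> unfolding M using l by (intro mult_nonneg_nonneg real_root_ge_zero) auto
  have Ab: "A \<tau> \<in> sets borel" "emeasure lborel (A \<tau>) \<le> ennreal (M \<tau>)" for \<tau>
    using A'[of \<tau>] by (auto simp: A_def)
  have "AE s in lborel. eventually (\<lambda>\<tau>. s \<in> space lborel - A \<tau>) sequentially"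
  proof (rule borel_cantelli_AE1)
    show "A \<tau> \<in> sets lborel" for \<tau> using Ab by simp
    show "emeasure lborel (A \<tau>) < \<infinity>" for \<tau> using Ab(2)[of \<tau>] by (simp add: le_less_trans)
    have "summable M"
      unfolding M by (intro summable_mult summable_geometric) (use g l in auto)
    moreover have "norm (measure lborel (A \<tau>)) \<le> M \<tau>" for \<tau>
      using Ab(2)[of \<tau>] M0[of \<tau>] by (simp add: measure_def enn2real_leI)
    ultimately show "summable (\<lambda>\<tau>. measure lborel (A \<tau>))" by (rule summable_comparison_test'[where N = 0])
  qed
  then show ?thesis
  proof eventually_elim
    case (elim s)
    show ?case
    proof
      assume s: "s \<in> {0..<1}"
      show "\<forall>\<^sub>F \<tau> in sequentially. \<not> (\<exists>v\<in>int_vectors. v \<noteq> 0 \<and> (\<forall>m. \<bar>renorm (real \<tau>) (G 0 s) v $ m\<bar> \<le> exp (- \<gamma> * real \<tau>)))"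
        using elim eventually_ge_at_top[of \<tau>0]
      proof eventually_elim
        case (elim \<tau>)
        then have "s \<in> {0..<1} - A' \<tau>" using s by (simp add: A_def)
        then have "\<not> bad \<tau> s" using A'[OF elim(2)] by blast
        then show ?case unfolding bad_def .
      qed
    qed
  qed
qed

text \<open>The rate \<gamma> supplied by a very well approximable vector depends on the vector; the
  countably many rates 1 / (j + 1) reduce this to a countable union of null sets.\<close>

lemma unit_curve_extremal:
  fixes G :: "nat \<Rightarrow> real \<Rightarrow> real^'n::finite"
  assumes d: "\<And>i s. i < l \<Longrightarrow> s \<in> {0..1} \<Longrightarrow> (G i has_vector_derivative G (Suc i) s) (at s)"
    and l: "0 < l" and C0: "0 < C0"
    and v: "\<And>a b. \<exists>k\<le>l. \<exists>v. \<bar>a + b \<bullet> y0\<bar> \<le> C0 * v \<and> (\<forall>s\<in>{0..1}. v \<le> \<bar>(if k = 0 then a else 0) + b \<bullet> G k s\<bar> \<and>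
        \<bar>(if k = 0 then a else 0) + b \<bullet> G k s\<bar> \<le> 2 * v)"
    and y0: "\<not> VWA y0"
  shows "AE s in lborel. s \<in> {0..<1} \<longrightarrow> \<not> VWA (G 0 s)"
proof -
  have "AE s in lborel. \<forall>j::nat. s \<in> {0..<1} \<longrightarrow> (\<forall>\<^sub>F \<tau> in sequentially.
     \<not> (\<exists>v\<in>int_vectors. v \<noteq> 0 \<and> (\<forall>m. \<bar>renorm (real \<tau>) (G 0 s) v $ m\<bar> \<le> exp (- (1 / real (Suc j)) * real \<tau>))))"
    unfolding AE_all_countable by (intro allI unit_curve_no_short_vectors[OF d l C0 v y0]) auto
  then show ?thesis
  proof eventually_elim
    case (elim s)
    show ?case
    proof (intro impI notI)
      assume s: "s \<in> {0..<1}" and "VWA (G 0 s)"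
      then obtain \<gamma> where g: "\<gamma> > 0" "\<And>T. \<exists>\<tau>\<ge>T. \<exists>v\<in>int_vectors. v \<noteq> 0 \<and>
           (\<forall>m. \<bar>renorm (real \<tau>) (G 0 s) v $ m\<bar> \<le> exp (- \<gamma> * real \<tau>))"
        using VWA_short_vectors by blast
      obtain j where j: "1 / real (Suc j) < \<gamma>" using g(1) nat_approx_posE by metis
      obtain T where T: "\<And>\<tau>. \<tau> \<ge> T \<Longrightarrow> \<not> (\<exists>v\<in>int_vectors. v \<noteq> 0 \<and>
          (\<forall>m. \<bar>renorm (real \<tau>) (G 0 s) v $ m\<bar> \<le> exp (- (1 / real (Suc j)) * real \<tau>)))"
        using elim s unfolding eventually_sequentially by blast
      obtain \<tau> v where tv: "\<tau> \<ge> T" "v\<in>int_vectors" "v \<noteq> 0"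
         "\<And>m. \<bar>renorm (real \<tau>) (G 0 s) v $ m\<bar> \<le> exp (- \<gamma> * real \<tau>)" using g(2)[of T] by blast
      have "exp (- \<gamma> * real \<tau>) \<le> exp (- (1 / real (Suc j)) * real \<tau>)"
        unfolding exp_le_cancel_iff by (rule mult_right_mono) (use j in auto)
      then have "\<bar>renorm (real \<tau>) (G 0 s) v $ m\<bar> \<le> exp (- (1 / real (Suc j)) * real \<tau>)" for m
        using tv(4)[of m] by linarith
      then show False using T[OF tv(1)] tv(2,3) by blast
    qed
  qed
qed

text \<open>Quantifies injectivity: \<open>b \<bullet> f b\<close> is the sum of the squares of the
  \<open>b \<bullet> T k\<close>, so \<open>f\<close> is injective on \<open>L\<close>, and an
  injective linear map on a finite-dimensional space is bounded below.\<close>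

lemma subspace_inner_lower_bound:
  fixes T :: "nat \<Rightarrow> 'a::euclidean_space"
  assumes L: "subspace L" and inj: "\<And>b. b \<in> L \<Longrightarrow> (\<And>k. k \<in> {1..m} \<Longrightarrow> b \<bullet> T k = 0) \<Longrightarrow> b = 0"
  shows "\<exists>\<kappa>>0. \<forall>b\<in>L. \<forall>V. (\<forall>k\<in>{1..m}. \<bar>b \<bullet> T k\<bar> \<le> V) \<longrightarrow> 0 \<le> V \<longrightarrow> norm b \<le> \<kappa> * V"
proof -
  define f where "f b = (\<Sum>k\<in>{1..m}. (b \<bullet> T k) *\<^sub>R T k)" for b
  have "linear f" unfolding f_def
    by (rule linearI) (auto simp: inner_add_left algebra_simps sum.distrib scaleR_sum_right)
  then have bl: "bounded_linear f" by (simp add: linear_conv_bounded_linear)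
  have "b = 0" if "b \<in> L" "f b = 0" for b
  proof (rule inj[OF that(1)])
    have "b \<bullet> f b = (\<Sum>k\<in>{1..m}. (b \<bullet> T k)\<^sup>2)"
      by (simp add: f_def inner_sum_right power2_eq_square)
    then have "(\<Sum>k\<in>{1..m}. (b \<bullet> T k)\<^sup>2) = 0" using that(2) by simp
    then show "b \<bullet> T k = 0" if "k \<in> {1..m}" for k
      using that by (subst (asm) sum_nonneg_eq_0_iff) auto
  qed
  then obtain e where e: "e > 0" "\<And>b. b \<in> L \<Longrightarrow> e * norm b \<le> norm (f b)"
    using injective_imp_isometric[OF closed_subspace[OF L] L bl] by (auto simp: mult.commute)
  define A where "A = (\<Sum>k\<in>{1..m}. norm (T k))"
  have A: "A \<ge> 0" by (simp add: A_def sum_nonneg)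
  have "norm b \<le> (A / e + 1) * V" if "b \<in> L" "\<forall>k\<in>{1..m}. \<bar>b \<bullet> T k\<bar> \<le> V" "0 \<le> V" for b V
  proof -
    have "e * norm b \<le> norm (f b)" by (rule e(2)[OF that(1)])
    also have "\<dots> \<le> (\<Sum>k\<in>{1..m}. V * norm (T k))"
      unfolding f_def by (rule sum_norm_le) (use that in \<open>auto intro: mult_right_mono\<close>)
    also have "\<dots> = V * A" by (simp add: A_def sum_distrib_left)
    finally have "norm b \<le> V * A / e" using e(1) by (simp add: field_simps)
    also have "\<dots> \<le> (A / e + 1) * V" using that(3) by (simp add: algebra_simps)
    finally show ?thesis .
  qed
  then show ?thesis using A e(1) by (intro exI[of _ "A / e + 1"]) (auto intro: add_nonneg_pos)
qed

lemma AE_lborel_scale: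
  fixes P :: "real \<Rightarrow> bool"
  assumes "AE s in lborel. P (c * s)" "c \<noteq> 0"
  shows "AE t in lborel. P t"
proof -
  obtain N where N: "N \<in> null_sets lborel" "\<And>s. s \<notin> N \<Longrightarrow> P (c * s)"
    using assms(1) by (auto simp: eventually_ae_filter)
  have eq: "lborel = density (distr lborel borel (\<lambda>x. 0 + (1 / c) * x)) (\<lambda>_. ennreal \<bar>1 / c\<bar>)"
    by (rule lborel_real_affine) (use assms(2) in simp)
  have "AE s in density (distr lborel borel (\<lambda>x. 0 + (1 / c) * x)) (\<lambda>_. ennreal \<bar>1 / c\<bar>). s \<notin> N"
    by (subst eq[symmetric]) (rule AE_not_in[OF N(1)])
  then have "AE s in distr lborel borel (\<lambda>x. 0 + (1 / c) * x). s \<notin> N"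
    using assms(2) by (subst (asm) AE_density) auto
  then have "AE t in lborel. 0 + (1 / c) * t \<notin> N"
    using N(1) by (subst (asm) AE_distr_iff) auto
  then show ?thesis
  proof eventually_elim
    case (elim t)
    then show ?case using N(2)[OF elim] assms(2) by simp
  qed
qed

text \<open>Provides the uniform hypothesis of \<open>unit_curve_extremal\<close>. Split b into
  \<open>b'\<close> in \<open>L0\<close> and \<open>b''\<close> orthogonal to \<open>L0\<close>.
  Along the curve \<open>b''\<close> only adds its value at \<open>y0\<close>, and nondegeneracy
  bounds the norm of \<open>b'\<close> by \<kappa> * V, where V is the largest absolute value at 0
  among the derivatives of orders 0 to m of the affine function. The derivative realising V is the
  one that stays nearly constant.\<close>

lemma nondegenerate_curve_extremal:
  fixes F :: "nat \<Rightarrow> real \<Rightarrow> real^'n::finite"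
  assumes eta: "0 < \<eta>"
    and d: "\<And>k t. \<bar>t\<bar> < \<eta> \<Longrightarrow> (F k has_vector_derivative F (Suc k) t) (at t)"
    and L0: "subspace L0" and mem: "\<And>t. \<bar>t\<bar> < \<eta> \<Longrightarrow> F 0 t - y0 \<in> L0"
    and span: "\<And>b. b \<in> L0 \<Longrightarrow> (\<And>k. k \<in> {1..m} \<Longrightarrow> b \<bullet> F k 0 = 0) \<Longrightarrow> b = 0"
    and m: "0 < m" and y0: "\<not> VWA y0"
  shows "\<exists>\<delta>>0. AE t in lborel. t \<in> {0..<\<delta>} \<longrightarrow> \<not> VWA (F 0 t)"
proof -
  obtain \<kappa> where kap: "\<kappa> > 0" "\<And>b V. b \<in> L0 \<Longrightarrow> (\<forall>k\<in>{1..m}. \<bar>b \<bullet> F k 0\<bar> \<le> V) \<Longrightarrow> 0 \<le> V \<Longrightarrow> norm b \<le> \<kappa> * V"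
    using subspace_inner_lower_bound[OF L0, of m "\<lambda>k. F k 0"] span by blast
  have "\<forall>\<^sub>F t in nhds 0. norm (F k t - F k 0) < 1 / (3 * \<kappa>)" for k
  proof -
    have "isCont (F k) 0"
      using d[of 0 k] eta has_vector_derivative_continuous by auto
    then have "(F k \<longlongrightarrow> F k 0) (nhds 0)" by (simp add: continuous_at isCont_def tendsto_nhds_iff)
    then have "\<forall>\<^sub>F t in nhds 0. dist (F k t) (F k 0) < 1 / (3 * \<kappa>)"
      by (rule tendstoD) (use kap(1) in simp)
    then show ?thesis by (simp add: dist_norm)
  qed
  then have "\<forall>\<^sub>F t in nhds 0. \<forall>k\<in>{..m}. norm (F k t - F k 0) < 1 / (3 * \<kappa>)"
    by (intro eventually_ball_finite) auto
  then obtain \<delta>0 where d0: "\<delta>0 > 0" "\<And>t k. \<bar>t\<bar> < \<delta>0 \<Longrightarrow> k \<le> m \<Longrightarrow> norm (F k t - F k 0) < 1 / (3 * \<kappa>)"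
    unfolding eventually_nhds_metric by (auto simp: dist_real_def)
  define \<delta> where "\<delta> = min \<delta>0 (min \<eta> 1) / 2"
  have del: "0 < \<delta>" "\<delta> < \<delta>0" "\<delta> < \<eta>" "\<delta> \<le> 1" using d0(1) eta by (auto simp: \<delta>_def)
  define C where "C = (1 + \<kappa> * norm (F 0 0 - y0)) * (3 / 2)"
  have C: "0 < C" using kap(1) by (simp add: C_def add_pos_nonneg)
  have key: "\<exists>k\<le>m. \<exists>v. 0 \<le> v \<and> \<bar>a + b \<bullet> y0\<bar> \<le> C * v \<and>
      (\<forall>t\<in>{0..\<delta>}. v \<le> \<bar>(if k = 0 then a else 0) + b \<bullet> F k t\<bar> \<and> \<bar>(if k = 0 then a else 0) + b \<bullet> F k t\<bar> \<le> 2 * v)" for a b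
  proof -
    obtain b' b'' where bb: "b' \<in> span L0" "\<And>w. w \<in> span L0 \<Longrightarrow> orthogonal b'' w" "b = b' + b''"
      using orthogonal_subspace_decomp_exists[of L0 b] by blast
    then have b': "b' \<in> L0" and b'': "\<And>w. w \<in> L0 \<Longrightarrow> b'' \<bullet> w = 0"
      using L0 by (auto simp: span_eq_iff[THEN iffD2] orthogonal_def)
    have c0: "b'' \<bullet> F 0 t = b'' \<bullet> y0" if "\<bar>t\<bar> < \<eta>" for t
      using b''[OF mem[OF that]] by (simp add: inner_diff_right)
    have ck: "b'' \<bullet> F (Suc k) t = 0" if t: "\<bar>t\<bar> < \<eta>" for k t
      using t
    proof (induction k arbitrary: t)
      case (0 t)
      have "((\<lambda>t. b'' \<bullet> F 0 t) has_real_derivative b'' \<bullet> F (Suc 0) t) (at t)"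
        using bounded_linear.has_vector_derivative[OF bounded_linear_inner_right d[OF 0, of 0], of b'']
        by (simp add: has_real_derivative_iff_has_vector_derivative)
      then show ?case
        by (rule DERIV_local_const[where d = "\<eta> - \<bar>t\<bar>"]) (use 0 c0 in auto)
    next
      case (Suc k t)
      have "((\<lambda>t. b'' \<bullet> F (Suc k) t) has_real_derivative b'' \<bullet> F (Suc (Suc k)) t) (at t)"
        using bounded_linear.has_vector_derivative[OF bounded_linear_inner_right d[OF Suc.prems, of "Suc k"], of b'']
        by (simp add: has_real_derivative_iff_has_vector_derivative)
      then show ?case
        by (rule DERIV_local_const[where d = "\<eta> - \<bar>t\<bar>"]) (use Suc in auto)
    qed
    have bk: "b \<bullet> F k t = b' \<bullet> F k t" if "k \<noteq> 0" "\<bar>t\<bar> < \<eta>" for k t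
      using ck[OF that(2), of "k - 1"] that(1) by (simp add: bb(3) inner_add_left)
    have bdiff: "b \<bullet> (F k t - F k 0) = b' \<bullet> (F k t - F k 0)" if "\<bar>t\<bar> < \<eta>" for k t
    proof (cases "k = 0")
      case True
      then show ?thesis using c0[OF that] c0[of 0] eta by (simp add: bb(3) inner_add_left inner_diff_right)
    next
      case False
      then show ?thesis using bk[OF False that] bk[OF False, of 0] eta by (simp add: inner_diff_right)
    qed
    define \<Phi> where "\<Phi> k t = (if k = 0 then a else 0) + b \<bullet> F k t" for k t
    define V where "V = Max ((\<lambda>k. \<bar>\<Phi> k 0\<bar>) ` {..m})"
    have "V \<in> (\<lambda>k. \<bar>\<Phi> k 0\<bar>) ` {..m}" unfolding V_def by (rule Max_in) auto
    then obtain k where k: "k \<le> m" "V = \<bar>\<Phi> k 0\<bar>" by auto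
    have V: "\<bar>\<Phi> j 0\<bar> \<le> V" if "j \<le> m" for j
      unfolding V_def by (rule Max_ge) (use that in auto)
    have V0: "0 \<le> V" using k(2) by simp
    have nb: "norm b' \<le> \<kappa> * V"
    proof (rule kap(2)[OF b' _ V0], rule ballI)
      fix j assume j: "j \<in> {1..m}"
      then have "b \<bullet> F j 0 = b' \<bullet> F j 0" using eta by (intro bk) auto
      then show "\<bar>b' \<bullet> F j 0\<bar> \<le> V" using V[of j] j by (simp add: \<Phi>_def)
    qed
    \<comment> \<open>On the interval the derivative moves by at most V / 3, so its absolute value
      lies between 2 V / 3 and 4 V / 3, that is between v and 2 v.\<close>
    define v where "v = 2 / 3 * V"
    have "v \<le> \<bar>\<Phi> k t\<bar> \<and> \<bar>\<Phi> k t\<bar> \<le> 2 * v" if t: "t \<in> {0..\<delta>}" for t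
    proof -
      have tt: "\<bar>t\<bar> < \<eta>" "\<bar>t\<bar> < \<delta>0" using t del by auto
      have "\<bar>\<Phi> k t - \<Phi> k 0\<bar> = \<bar>b' \<bullet> (F k t - F k 0)\<bar>"
        using bdiff[OF tt(1), of k] by (simp add: \<Phi>_def inner_diff_right)
      also have "\<dots> \<le> norm b' * norm (F k t - F k 0)" by (rule Cauchy_Schwarz_ineq2)
      also have "\<dots> \<le> (\<kappa> * V) * (1 / (3 * \<kappa>))"
        using nb d0(2)[OF tt(2) k(1)] V0 kap(1) by (intro mult_mono) auto
      also have "\<dots> = V / 3" using kap(1) by simp
      finally show ?thesis using k(2) unfolding v_def by linarith
    qed
    moreover have "\<bar>a + b \<bullet> y0\<bar> \<le> C * v"
    proof -
      have "b'' \<bullet> F 0 0 = b'' \<bullet> y0" using c0[of 0] eta by simp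
      then have "a + b \<bullet> y0 = \<Phi> 0 0 - b' \<bullet> (F 0 0 - y0)"
        by (simp add: \<Phi>_def bb(3) inner_add_left inner_diff_right)
      moreover have "\<bar>b' \<bullet> (F 0 0 - y0)\<bar> \<le> \<kappa> * V * norm (F 0 0 - y0)"
        by (rule order.trans[OF Cauchy_Schwarz_ineq2 mult_right_mono[OF nb]]) simp
      ultimately have "\<bar>a + b \<bullet> y0\<bar> \<le> V + \<kappa> * V * norm (F 0 0 - y0)" using V[of 0] by linarith
      also have "\<dots> = C * v" by (simp add: C_def v_def algebra_simps)
      finally show ?thesis .
    qed
    ultimately show ?thesis using k(1) V0 unfolding \<Phi>_def by (intro exI[of _ k] conjI exI[of _ v]) (auto simp: v_def)
  qed
  \<comment> \<open>Rescaling to the unit interval multiplies the k-th derivative by \<delta> ^ k.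
    As \<delta> <= 1, replacing C by C / \<delta> ^ m compensates for every k <= m.\<close>
  define G where "G k s = \<delta> ^ k *\<^sub>R F k (\<delta> * s)" for k s
  have "AE s in lborel. s \<in> {0..<1} \<longrightarrow> \<not> VWA (G 0 s)"
  proof (rule unit_curve_extremal[where l = m and ?C0.0 = "C / \<delta> ^ m" and ?y0.0 = y0])
    fix i and s :: real assume "i < m" and s: "s \<in> {0..1}"
    have "\<delta> * s \<le> \<delta> * 1" using s del by (intro mult_left_mono) auto
    moreover have "0 \<le> \<delta> * s" using s del by simp
    ultimately have ds: "\<bar>\<delta> * s\<bar> < \<eta>" using del by linarith
    have "((\<lambda>s. \<delta> * s) has_vector_derivative \<delta>) (at s)"
      by (auto intro!: derivative_eq_intros simp: has_real_derivative_iff_has_vector_derivative[symmetric])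
    from vector_diff_chain_at[OF this d[OF ds]]
    have "((\<lambda>s. F i (\<delta> * s)) has_vector_derivative \<delta> *\<^sub>R F (Suc i) (\<delta> * s)) (at s)" by (simp add: o_def)
    from bounded_linear.has_vector_derivative[OF bounded_linear_scaleR_right this, of "\<delta> ^ i"]
    show "(G i has_vector_derivative G (Suc i) s) (at s)"
      unfolding G_def by (simp add: mult.commute)
  next
    fix a :: real and b :: "real^'n"
    obtain k v where kv: "k \<le> m" "0 \<le> v" "\<bar>a + b \<bullet> y0\<bar> \<le> C * v"
      "\<And>t. t\<in>{0..\<delta>} \<Longrightarrow> v \<le> \<bar>(if k = 0 then a else 0) + b \<bullet> F k t\<bar> \<and> \<bar>(if k = 0 then a else 0) + b \<bullet> F k t\<bar> \<le> 2 * v"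
      using key[of a b] by blast
    have G: "(if k = 0 then a else 0) + b \<bullet> G k s = \<delta> ^ k * ((if k = 0 then a else 0) + b \<bullet> F k (\<delta> * s))" for s
      by (simp add: G_def algebra_simps)
    have "\<bar>a + b \<bullet> y0\<bar> \<le> C / \<delta> ^ m * (\<delta> ^ k * v)"
    proof -
      have "\<delta> ^ m \<le> \<delta> ^ k" using del kv(1) by (intro power_decreasing) auto
      then have "1 \<le> \<delta> ^ k / \<delta> ^ m" using del(1) by simp
      then have "(C * v) * 1 \<le> (C * v) * (\<delta> ^ k / \<delta> ^ m)" using C kv(2) by (intro mult_left_mono) auto
      then show ?thesis using kv(3) by (simp add: mult_ac)
    qed
    moreover have "\<delta> ^ k * v \<le> \<bar>(if k = 0 then a else 0) + b \<bullet> G k s\<bar> \<and>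
        \<bar>(if k = 0 then a else 0) + b \<bullet> G k s\<bar> \<le> 2 * (\<delta> ^ k * v)" if s: "s \<in> {0..1}" for s
    proof -
      have "\<delta> * s \<le> \<delta> * 1" using s del by (intro mult_left_mono) auto
      then have "\<delta> * s \<in> {0..\<delta>}" using s del by simp
      from kv(4)[OF this] have b: "v \<le> \<bar>(if k = 0 then a else 0) + b \<bullet> F k (\<delta> * s)\<bar>"
        "\<bar>(if k = 0 then a else 0) + b \<bullet> F k (\<delta> * s)\<bar> \<le> 2 * v" by auto
      have dk: "0 \<le> \<delta> ^ k" using del by simp
      have "\<bar>(if k = 0 then a else 0) + b \<bullet> G k s\<bar> = \<delta> ^ k * \<bar>(if k = 0 then a else 0) + b \<bullet> F k (\<delta> * s)\<bar>"
        unfolding G using dk by (simp only: abs_mult abs_of_nonneg)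
      then show ?thesis using mult_left_mono[OF b(1) dk] mult_left_mono[OF b(2) dk] by (simp only: mult.left_commute)
    qed
    ultimately show "\<exists>k\<le>m. \<exists>v. \<bar>a + b \<bullet> y0\<bar> \<le> C / \<delta> ^ m * v \<and> (\<forall>s\<in>{0..1}. v \<le> \<bar>(if k = 0 then a else 0) + b \<bullet> G k s\<bar> \<and>
        \<bar>(if k = 0 then a else 0) + b \<bullet> G k s\<bar> \<le> 2 * v)" using kv(1) by blast
  qed (use m C del y0 in auto)
  then have "AE s in lborel. (\<lambda>t. t \<in> {0..<\<delta>} \<longrightarrow> \<not> VWA (F 0 t)) (\<delta> * s)"
  proof eventually_elim
    case (elim s)
    then show ?case using del(1) by (auto simp: G_def zero_le_mult_iff)
  qed
  then have "AE t in lborel. t \<in> {0..<\<delta>} \<longrightarrow> \<not> VWA (F 0 t)"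
    by (rule AE_lborel_scale) (use del(1) in simp)
  then show ?thesis using del(1) by blast
qed

section \<open>Smooth maps of several variables\<close>

declare partial_iter.simps(2) [simp del]

lemma linear_vec_expand:
  fixes g :: "real^'d::finite \<Rightarrow> 'a::real_vector"
  assumes "linear g"
  shows "g h = (\<Sum>i\<in>UNIV. h $ i *\<^sub>R g (axis i 1))"
proof -
  have "h = (\<Sum>i\<in>UNIV. h $ i *\<^sub>R axis i 1)"
    using basis_expansion[of h] by (simp add: scalar_mult_eq_scaleR)
  then have "g h = g (\<Sum>i\<in>UNIV. h $ i *\<^sub>R axis i 1)" by simp
  also have "\<dots> = (\<Sum>i\<in>UNIV. h $ i *\<^sub>R g (axis i 1))"
    by (simp add: linear_sum[OF assms] linear_scale[OF assms])
  finally show ?thesis .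
qed

lemma smooth_has_derivative:
  assumes "smooth_on U f" "x \<in> U"
  shows "(partial_iter f is has_derivative (\<lambda>h. \<Sum>i\<in>UNIV. h $ i *\<^sub>R partial_iter f (i # is) x)) (at x)"
proof -
  have d: "(partial_iter f is has_derivative frechet_derivative (partial_iter f is) (at x)) (at x)"
    using assms by (auto simp: smooth_on_def frechet_derivative_works[symmetric])
  then have lin: "linear (frechet_derivative (partial_iter f is) (at x))" by (rule has_derivative_linear)
  have "frechet_derivative (partial_iter f is) (at x) = (\<lambda>h. \<Sum>i\<in>UNIV. h $ i *\<^sub>R partial_iter f (i # is) x)"
    by (rule ext, subst linear_vec_expand[OF lin]) (simp add: partial_iter.simps)
  then show ?thesis using d by simp
qed

lemma smooth_compose_has_vector_derivative:
  assumes "smooth_on U f" "g t \<in> U" "(g has_vector_derivative g') (at t)"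
  shows "((\<lambda>t. partial_iter f is (g t)) has_vector_derivative (\<Sum>i\<in>UNIV. g' $ i *\<^sub>R partial_iter f (i # is) (g t))) (at t)"
proof -
  have "((\<lambda>t. partial_iter f is (g t)) has_derivative
      (\<lambda>s. \<Sum>i\<in>UNIV. (s *\<^sub>R g') $ i *\<^sub>R partial_iter f (i # is) (g t))) (at t)"
    using has_derivative_compose[OF assms(3)[unfolded has_vector_derivative_def] smooth_has_derivative[OF assms(1,2)]]
    by simp
  then show ?thesis by (simp add: has_vector_derivative_def scaleR_sum_right)
qed

lemma inner_smooth_line_derivative:
  assumes "smooth_on U f" "p + s *\<^sub>R v \<in> U"
  shows "((\<lambda>s. b \<bullet> partial_iter f is (p + s *\<^sub>R v)) has_real_derivative
           (\<Sum>i\<in>UNIV. v $ i * (b \<bullet> partial_iter f (i # is) (p + s *\<^sub>R v)))) (at s)"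
proof -
  have "((\<lambda>s. p + s *\<^sub>R v) has_vector_derivative v) (at s)"
    by (auto intro!: derivative_eq_intros simp: has_vector_derivative_def)
  from bounded_linear.has_vector_derivative[OF bounded_linear_inner_right
      smooth_compose_has_vector_derivative[OF assms(1) assms(2) this], of b "is"]
  show ?thesis by (simp add: has_real_derivative_iff_has_vector_derivative inner_sum_right)
qed

section \<open>Symmetry of iterated partial derivatives\<close>

lemma second_difference_mvt:
  fixes f :: "real^'d::finite \<Rightarrow> real^'n::finite"
  assumes sm: "smooth_on U f" and U: "ball x r \<subseteq> U" and h: "0 < h" "2 * h < r"
  shows "\<exists>z\<in>ball x (2 * h). b \<bullet> partial_iter f is (x + h *\<^sub>R axis i 1 + h *\<^sub>R axis j 1)
      - b \<bullet> partial_iter f is (x + h *\<^sub>R axis i 1) - b \<bullet> partial_iter f is (x + h *\<^sub>R axis j 1)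
      + b \<bullet> partial_iter f is x = h * (h * (b \<bullet> partial_iter f (j # i # is) z))"
proof -
  let ?ei = "axis i 1 :: real^'d" and ?ej = "axis j 1 :: real^'d"
  have ball_add: "y + w \<in> ball y e \<longleftrightarrow> norm w < e" for y w :: "real^'d" and e
    by (simp add: dist_norm)
  have inU: "x + s *\<^sub>R ?ei + t *\<^sub>R ?ej \<in> ball x (2 * h) \<inter> U" if "0 \<le> s" "s \<le> h" "0 \<le> t" "t \<le> h" "s < h \<or> t < h" for s t
  proof -
    have "norm (s *\<^sub>R ?ei + t *\<^sub>R ?ej) \<le> norm (s *\<^sub>R ?ei) + norm (t *\<^sub>R ?ej)" by (rule norm_triangle_ineq)
    also have "\<dots> = s + t" using that by (simp add: norm_axis_1)
    also have "\<dots> < 2 * h" using that by auto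
    finally have "x + (s *\<^sub>R ?ei + t *\<^sub>R ?ej) \<in> ball x (2 * h)" by (simp only: ball_add)
    moreover have "ball x (2 * h) \<subseteq> U" using U h by (auto simp: subset_iff)
    ultimately show ?thesis by (auto simp: add.assoc)
  qed
  have inU': "x + s *\<^sub>R ?ei + t *\<^sub>R ?ej \<in> U" if "0 \<le> s" "s \<le> h" "0 \<le> t" "t \<le> h" for s t
  proof -
    have "norm (s *\<^sub>R ?ei + t *\<^sub>R ?ej) \<le> norm (s *\<^sub>R ?ei) + norm (t *\<^sub>R ?ej)" by (rule norm_triangle_ineq)
    also have "\<dots> = s + t" using that by (simp add: norm_axis_1)
    also have "\<dots> < r" using that h by auto
    finally have "x + (s *\<^sub>R ?ei + t *\<^sub>R ?ej) \<in> ball x r" by (simp only: ball_add)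
    then show ?thesis using U by (auto simp: add.assoc)
  qed
  have der: "((\<lambda>s. b \<bullet> partial_iter f is (p + s *\<^sub>R axis k 1)) has_real_derivative
      b \<bullet> partial_iter f (k # is) (p + s *\<^sub>R axis k 1)) (at s)" if "p + s *\<^sub>R axis k 1 \<in> U" for p s k "is"
  proof -
    have "(\<Sum>i\<in>UNIV. axis k 1 $ i * (b \<bullet> partial_iter f (i # is) (p + s *\<^sub>R axis k 1))) =
       (\<Sum>i\<in>UNIV. if i = k then b \<bullet> partial_iter f (i # is) (p + s *\<^sub>R axis k 1) else 0)"
      by (rule sum.cong) (auto simp: axis_def)
    then show ?thesis using inner_smooth_line_derivative[OF sm that, of b "is"] by simp
  qed
  define u where "u s = b \<bullet> partial_iter f is (x + h *\<^sub>R ?ej + s *\<^sub>R ?ei) - b \<bullet> partial_iter f is (x + s *\<^sub>R ?ei)" for s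
  have "\<exists>s>0. s < h \<and> u h - u 0 = (h - 0) * (b \<bullet> partial_iter f (i # is) (x + h *\<^sub>R ?ej + s *\<^sub>R ?ei)
      - b \<bullet> partial_iter f (i # is) (x + s *\<^sub>R ?ei))"
  proof (rule MVT2[OF h(1)])
    fix s assume s: "0 \<le> s" "s \<le> h"
    have "x + h *\<^sub>R ?ej + s *\<^sub>R ?ei \<in> U" using inU'[of s h] s h by (simp add: algebra_simps)
    moreover have "x + s *\<^sub>R ?ei \<in> U" using inU'[of s 0] s h by simp
    ultimately show "(u has_real_derivative b \<bullet> partial_iter f (i # is) (x + h *\<^sub>R ?ej + s *\<^sub>R ?ei)
      - b \<bullet> partial_iter f (i # is) (x + s *\<^sub>R ?ei)) (at s)"
      unfolding u_def by (intro DERIV_diff der)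
  qed
  then obtain s where s: "0 < s" "s < h" "u h - u 0 = h * (b \<bullet> partial_iter f (i # is) (x + h *\<^sub>R ?ej + s *\<^sub>R ?ei)
      - b \<bullet> partial_iter f (i # is) (x + s *\<^sub>R ?ei))" by auto
  have "\<exists>t>0. t < h \<and> b \<bullet> partial_iter f (i # is) (x + s *\<^sub>R ?ei + h *\<^sub>R ?ej) - b \<bullet> partial_iter f (i # is) (x + s *\<^sub>R ?ei + 0 *\<^sub>R ?ej)
     = (h - 0) * (b \<bullet> partial_iter f (j # i # is) (x + s *\<^sub>R ?ei + t *\<^sub>R ?ej))"
    by (rule MVT2[OF h(1)]) (use der inU' s in auto)
  then obtain t where t: "0 < t" "t < h" "b \<bullet> partial_iter f (i # is) (x + s *\<^sub>R ?ei + h *\<^sub>R ?ej) - b \<bullet> partial_iter f (i # is) (x + s *\<^sub>R ?ei)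
     = h * (b \<bullet> partial_iter f (j # i # is) (x + s *\<^sub>R ?ei + t *\<^sub>R ?ej))" by auto
  have "x + h *\<^sub>R ?ej + s *\<^sub>R ?ei = x + s *\<^sub>R ?ei + h *\<^sub>R ?ej" for s by simp
  then have "b \<bullet> partial_iter f is (x + h *\<^sub>R ?ei + h *\<^sub>R ?ej) - b \<bullet> partial_iter f is (x + h *\<^sub>R ?ei)
      - b \<bullet> partial_iter f is (x + h *\<^sub>R ?ej) + b \<bullet> partial_iter f is x = u h - u 0"
    by (simp add: u_def add_ac)
  also have "\<dots> = h * (h * (b \<bullet> partial_iter f (j # i # is) (x + s *\<^sub>R ?ei + t *\<^sub>R ?ej)))"
    using s(3) t(3) by (simp add: add.commute add.left_commute)
  finally show ?thesis using inU[of s t] s t by (intro bexI[of _ "x + s *\<^sub>R ?ei + t *\<^sub>R ?ej"]) auto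
qed

text \<open>Schwarz's theorem: the second difference is symmetric in i and j, and it is h ^ 2 times
  either mixed derivative at some point near x. Pairing with the difference b of the two mixed
  derivatives reduces to real functions and makes their supposed gap at x positive.\<close>

lemma partial_iter_swap:
  fixes f :: "real^'d::finite \<Rightarrow> real^'n::finite"
  assumes sm: "smooth_on U f" and U: "open U" and x: "x \<in> U"
  shows "partial_iter f (i # j # is) x = partial_iter f (j # i # is) x"
proof (rule ccontr)
  assume ne: "partial_iter f (i # j # is) x \<noteq> partial_iter f (j # i # is) x"
  define b where "b = partial_iter f (i # j # is) x - partial_iter f (j # i # is) x"
  define g where "g z = b \<bullet> partial_iter f (i # j # is) z" for z
  define g' where "g' z = b \<bullet> partial_iter f (j # i # is) z" for z
  have pos: "g x - g' x > 0"
    using ne by (simp add: g_def g'_def b_def flip: inner_diff_right)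
  obtain r where r: "r > 0" "ball x r \<subseteq> U" using U x by (meson open_contains_ball)
  have contU: "continuous_on U (partial_iter f js)" for js using sm by (auto simp: smooth_on_def)
  have "isCont g x" "isCont g' x"
    unfolding g_def g'_def
    by (intro continuous_intros continuous_on_interior[OF contU] interiorI[OF U x order_refl])+
  then have tg: "(g \<longlongrightarrow> g x) (nhds x)" "(g' \<longlongrightarrow> g' x) (nhds x)"
    by (simp_all add: isCont_def tendsto_nhds_iff)
  have "(g x - g' x) / 2 > 0" using pos by simp
  from eventually_conj[OF tendstoD[OF tg(1) this] tendstoD[OF tg(2) this]]
  have "\<forall>\<^sub>F z in nhds x. dist (g z) (g x) < (g x - g' x) / 2 \<and> dist (g' z) (g' x) < (g x - g' x) / 2" .
  then obtain e where e: "e > 0" "\<And>z. dist z x < e \<Longrightarrow> dist (g z) (g x) < (g x - g' x) / 2 \<and> dist (g' z) (g' x) < (g x - g' x) / 2"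
    unfolding eventually_nhds_metric by blast
  define h where "h = min r e / 4"
  have h: "0 < h" "2 * h < r" "2 * h < e" using r e by (auto simp: h_def)
  obtain z where z: "z \<in> ball x (2 * h)" "b \<bullet> partial_iter f is (x + h *\<^sub>R axis i 1 + h *\<^sub>R axis j 1)
      - b \<bullet> partial_iter f is (x + h *\<^sub>R axis i 1) - b \<bullet> partial_iter f is (x + h *\<^sub>R axis j 1)
      + b \<bullet> partial_iter f is x = h * (h * g' z)"
    using second_difference_mvt[OF sm r(2) h(1,2), of b "is" i j] unfolding g'_def by blast
  obtain z' where z': "z' \<in> ball x (2 * h)" "b \<bullet> partial_iter f is (x + h *\<^sub>R axis j 1 + h *\<^sub>R axis i 1)
      - b \<bullet> partial_iter f is (x + h *\<^sub>R axis j 1) - b \<bullet> partial_iter f is (x + h *\<^sub>R axis i 1)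
      + b \<bullet> partial_iter f is x = h * (h * g z')"
    using second_difference_mvt[OF sm r(2) h(1,2), of b "is" j i] unfolding g_def by blast
  have "x + h *\<^sub>R axis j 1 + h *\<^sub>R axis i 1 = x + h *\<^sub>R axis i 1 + h *\<^sub>R axis j 1" by simp
  then have "h * (h * g' z) = h * (h * g z')" using z(2) z'(2) by (smt (verit))
  then have "g' z = g z'" using h by simp
  moreover have "\<bar>g' z - g' x\<bar> < (g x - g' x) / 2" "\<bar>g z' - g x\<bar> < (g x - g' x) / 2"
    using e(2)[of z] e(2)[of z'] z(1) z'(1) h by (auto simp: dist_commute dist_real_def[symmetric])
  ultimately have "\<bar>g z' - g' x\<bar> < (g x - g' x) / 2" "\<bar>g z' - g x\<bar> < (g x - g' x) / 2" by simp_all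
  then have "g z' - g' x < (g x - g' x) / 2" "- (g z' - g x) < (g x - g' x) / 2"
    by (simp_all only: abs_less_iff)
  then show False by (simp add: field_simps)
qed

lemma partial_iter_Cons_cong:
  assumes U: "open U" and sm: "smooth_on U f" and eq: "\<And>x. x \<in> U \<Longrightarrow> partial_iter f xs x = partial_iter f ys x" and x: "x \<in> U"
  shows "partial_iter f (i # xs) x = partial_iter f (i # ys) x"
proof -
  have "(partial_iter f xs has_derivative frechet_derivative (partial_iter f xs) (at x)) (at x)"
    using sm x by (auto simp: smooth_on_def frechet_derivative_works[symmetric])
  then have "(partial_iter f ys has_derivative frechet_derivative (partial_iter f xs) (at x)) (at x)"
    by (rule has_derivative_transform_within_open[OF _ U x]) (use eq in auto)
  then have "frechet_derivative (partial_iter f xs) (at x) = frechet_derivative (partial_iter f ys) (at x)"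
    by (rule frechet_derivative_at)
  then show ?thesis by (simp add: partial_iter.simps)
qed

lemma partial_iter_mset:
  fixes f :: "real^'d::finite \<Rightarrow> real^'n::finite"
  assumes sm: "smooth_on U f" and U: "open U" and x: "x \<in> U" and eq: "mset xs = mset ys"
  shows "partial_iter f xs x = partial_iter f ys x"
proof -
  have front: "partial_iter f (ys1 @ a # ys2) x = partial_iter f (a # ys1 @ ys2) x" if "x \<in> U" for a ys1 ys2 x
    using that
  proof (induction ys1 arbitrary: x)
    case (Cons y ys1)
    have "partial_iter f ((y # ys1) @ a # ys2) x = partial_iter f (y # a # ys1 @ ys2) x"
      using partial_iter_Cons_cong[OF U sm Cons.IH Cons.prems] by simp
    also have "\<dots> = partial_iter f (a # (y # ys1) @ ys2) x"
      using partial_iter_swap[OF sm U Cons.prems] by simp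
    finally show ?case .
  qed simp
  show ?thesis using eq x
  proof (induction xs arbitrary: ys x)
    case (Cons a xs)
    have "a \<in> set ys" using Cons.prems(1) by (metis list.set_intros(1) set_mset_mset)
    then obtain ys1 ys2 where ys: "ys = ys1 @ a # ys2" by (meson split_list)
    then have m: "mset xs = mset (ys1 @ ys2)" using Cons.prems(1) by simp
    have "partial_iter f (a # xs) x = partial_iter f (a # ys1 @ ys2) x"
      by (rule partial_iter_Cons_cong[OF U sm Cons.IH[OF m] Cons.prems(2)])
    then show ?case using front[OF Cons.prems(2)] ys by simp
  qed simp
qed

section \<open>Monomial curves and Taylor expansion along them\<close>

definition monomial_weight :: "('d \<Rightarrow> nat) \<Rightarrow> 'd list \<Rightarrow> nat" where
  "monomial_weight a is = sum_list (map a is)"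

definition power_curve :: "('d \<Rightarrow> nat) \<Rightarrow> real \<Rightarrow> real^'d" where
  "power_curve a t = (\<chi> i. t ^ a i)"

lemma prod_list_power_curve: "prod_list (map (\<lambda>i. power_curve a t $ i) is) = t ^ monomial_weight a is"
  by (induction "is") (auto simp: power_curve_def monomial_weight_def power_add)

lemma finite_lists_length: "finite {is :: 'd::finite list. length is = m}"
  using finite_lists_length_eq[of "UNIV :: 'd set" m] by simp

lemma sum_lists_Suc:
  "(\<Sum>is\<in>{is :: 'd::finite list. length is = Suc m}. g is) = (\<Sum>is\<in>{is. length is = m}. \<Sum>i\<in>UNIV. g (i # is))"
proof -
  have eq: "{is :: 'd list. length is = Suc m} = (\<lambda>(is, i). i # is) ` ({is. length is = m} \<times> UNIV)"
    by (auto simp: length_Suc_conv image_iff)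
  have "(\<Sum>is\<in>{is :: 'd list. length is = Suc m}. g is) = (\<Sum>p\<in>{is. length is = m} \<times> UNIV. g (snd p # fst p))"
    unfolding eq by (subst sum.reindex) (auto simp: inj_on_def intro!: sum.cong)
  also have "\<dots> = (\<Sum>is\<in>{is. length is = m}. \<Sum>i\<in>UNIV. g (i # is))"
    by (subst sum.cartesian_product) (simp add: case_prod_beta)
  finally show ?thesis .
qed

text \<open>The sums run over words of indices instead of multi-indices: a monomial occurs once for
  each ordering of its factors, which accounts for the multinomial coefficients.\<close>

lemma smooth_taylor:
  fixes f :: "real^'d::finite \<Rightarrow> real^'n::finite"
  assumes sm: "smooth_on U f" and U: "\<And>s. s \<in> {0..1} \<Longrightarrow> x + s *\<^sub>R h \<in> U"
  shows "\<exists>s\<in>{0..1}. b \<bullet> f (x + h) = (\<Sum>m\<le>l. \<Sum>is\<in>{is. length is = m}.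
      prod_list (map (\<lambda>i. h $ i) is) * (b \<bullet> partial_iter f is x) / fact m)
     + (\<Sum>is\<in>{is. length is = Suc l}. prod_list (map (\<lambda>i. h $ i) is) * (b \<bullet> partial_iter f is (x + s *\<^sub>R h))) / fact (Suc l)"
proof -
  define T where "T m s = (\<Sum>is\<in>{is. length is = m}. prod_list (map (\<lambda>i. h $ i) is) * (b \<bullet> partial_iter f is (x + s *\<^sub>R h)))" for m s
  have dT: "(T m has_real_derivative T (Suc m) s) (at s)" if "s \<in> {0..1}" for m s
  proof -
    have "((\<lambda>s. T m s) has_real_derivative (\<Sum>is\<in>{is. length is = m}. prod_list (map (\<lambda>i. h $ i) is) *
        (\<Sum>i\<in>UNIV. h $ i * (b \<bullet> partial_iter f (i # is) (x + s *\<^sub>R h))))) (at s)"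
      unfolding T_def
      by (intro DERIV_sum DERIV_cmult inner_smooth_line_derivative[OF sm U[OF that]])
    also have "(\<Sum>is\<in>{is. length is = m}. prod_list (map (\<lambda>i. h $ i) is) *
        (\<Sum>i\<in>UNIV. h $ i * (b \<bullet> partial_iter f (i # is) (x + s *\<^sub>R h)))) = T (Suc m) s"
      unfolding T_def sum_lists_Suc by (simp add: sum_distrib_left mult_ac)
    finally show ?thesis .
  qed
  have "\<exists>s>0. s < 1 \<and> T 0 1 = (\<Sum>m<Suc l. T m 0 / fact m * 1 ^ m) + T (Suc l) s / fact (Suc l) * 1 ^ Suc l"
    by (rule Maclaurin) (use dT in auto)
  then obtain s where s: "0 < s" "s < 1" "T 0 1 = (\<Sum>m<Suc l. T m 0 / fact m) + T (Suc l) s / fact (Suc l)"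
    by auto
  have T0: "T 0 1 = b \<bullet> f (x + h)" by (simp add: T_def)
  have "(\<Sum>m<Suc l. T m 0 / fact m) = (\<Sum>m\<le>l. \<Sum>is\<in>{is. length is = m}.
      prod_list (map (\<lambda>i. h $ i) is) * (b \<bullet> partial_iter f is x) / fact m)"
    unfolding lessThan_Suc_atMost by (simp add: T_def sum_divide_distrib)
  then show ?thesis using s T0 by (intro bexI[of _ s]) (auto simp: T_def)
qed

text \<open>Letting t tend to 0 kills the constant coefficient; then divide by t.\<close>

lemma poly_coeffs_zero_of_small:
  fixes p :: "real poly"
  assumes "0 < r" "\<And>t. 0 < t \<Longrightarrow> t < r \<Longrightarrow> \<bar>poly p t\<bar> \<le> C * t ^ n" "e < n"
  shows "coeff p e = 0"
  using assms(2,3)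
proof (induction n arbitrary: p e)
  case (Suc n)
  have "(poly p \<longlongrightarrow> poly p 0) (at 0)" using DERIV_isCont[OF poly_DERIV[of p 0]] by (simp add: isCont_def)
  then have lp: "((\<lambda>t. \<bar>poly p t\<bar>) \<longlongrightarrow> \<bar>poly p 0\<bar>) (at_right 0)"
    by (intro tendsto_rabs) (auto simp: filterlim_at_split)
  have lC: "((\<lambda>t. C * t ^ Suc n) \<longlongrightarrow> C * 0 ^ Suc n) (at_right 0)"
    by (intro tendsto_intros)
  have ev: "\<forall>\<^sub>F t in at_right 0. \<bar>poly p t\<bar> \<le> C * t ^ Suc n"
    using Suc.prems(1) assms(1) by (auto simp: eventually_at_right_field intro!: exI[of _ r])
  have "\<bar>poly p 0\<bar> \<le> C * 0 ^ Suc n"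
    by (rule tendsto_le[OF trivial_limit_at_right_real lC lp ev])
  then have p0: "coeff p 0 = 0" by (simp add: poly_0_coeff_0)
  obtain q where q: "p = pCons 0 q" using p0 by (metis coeff_pCons_0 pCons_cases)
  show ?case
  proof (cases e)
    case 0
    then show ?thesis using p0 by simp
  next
    case (Suc e')
    have "coeff q e' = 0"
    proof (rule Suc.IH)
      show "\<bar>poly q t\<bar> \<le> C * t ^ n" if "0 < t" "t < r" for t
      proof -
        have "t * \<bar>poly q t\<bar> \<le> t * (C * t ^ n)" using Suc.prems(1)[OF that] that by (simp add: q abs_mult mult_ac)
        then show ?thesis using that(1) by simp
      qed
      show "e' < n" using Suc Suc.prems(2) by simp
    qed
    then show ?thesis using Suc q by simp
  qed
qed simp

lemma digits_unique:
  fixes B :: nat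
  assumes "\<And>j. j < n \<Longrightarrow> c j < B" "\<And>j. j < n \<Longrightarrow> c' j < B"
    and "(\<Sum>j<n. c j * B ^ j) + C * B ^ n = (\<Sum>j<n. c' j * B ^ j) + C' * B ^ n"
  shows "(\<forall>j<n. c j = c' j) \<and> C = C'"
  using assms
proof (induction n arbitrary: C C')
  case (Suc n)
  have "(\<forall>j<n. c j = c' j) \<and> c n + C * B = c' n + C' * B"
    by (rule Suc.IH) (use Suc.prems in \<open>auto simp: algebra_simps\<close>)
  then have IH: "\<forall>j<n. c j = c' j" and eq: "c n + C * B = c' n + C' * B" by auto
  have lt: "c n < B" "c' n < B" using Suc.prems(1,2) by auto
  have "(c n + C * B) mod B = c n" "(c' n + C' * B) mod B = c' n" using lt by simp_all
  then have "c n = c' n" using eq by metis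
  moreover have "C = C'" using eq calculation lt by simp
  ultimately show ?case using IH by (auto simp: less_Suc_eq)
qed simp

text \<open>Along \<open>power_curve a\<close> the monomials of degree at most \<open>l\<close> become distinct powers of \<open>t\<close> below
  \<open>t ^ M\<close>, and a Taylor remainder of order \<open>l + 1\<close> is \<open>O(t ^ M)\<close>.\<close>

definition separating_exponents :: "nat \<Rightarrow> ('d \<Rightarrow> nat) \<Rightarrow> nat \<Rightarrow> bool" where
  "separating_exponents l a M \<longleftrightarrow> 0 < M \<and> (\<forall>i. 0 < a i) \<and>
     (\<forall>is. length is \<le> l \<longrightarrow> monomial_weight a is < M) \<and>
     (\<forall>is. length is = Suc l \<longrightarrow> M \<le> monomial_weight a is) \<and>
     (\<forall>is js. length is \<le> l \<longrightarrow> length js \<le> l \<longrightarrow> monomial_weight a is = monomial_weight a js \<longrightarrow> mset is = mset js)"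

lemma separating_exponents_exist: "\<exists>(a :: 'd::finite \<Rightarrow> nat) M. separating_exponents l a M"
proof -
  let ?d = "CARD('d)" and ?B = "Suc l"
  obtain idx :: "'d \<Rightarrow> nat" where idx: "bij_betw idx UNIV {..<?d}"
    using ex_bij_betw_finite_nat[of "UNIV :: 'd set"] by (auto simp: atLeast0LessThan)
  \<comment> \<open>In base \<open>?B\<close> = l + 1 the weight of a word has the letter counts as
    lower digits and the length as leading part. For words of length at most l the counts are below
    \<open>?B\<close>, so the weight determines the multiset. The common summand
    \<open>?B ^ ?d\<close> makes the length dominate, which separates length l + 1 from the
    rest.\<close>
  define a where "a i = ?B ^ ?d + ?B ^ idx i" for i
  define M where "M = ?B * ?B ^ ?d"
  have idx_lt: "idx i < ?d" for i using idx by (auto simp: bij_betw_def)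
  have weight: "monomial_weight a is = (\<Sum>j<?d. count (mset is) (inv_into UNIV idx j) * ?B ^ j) + length is * ?B ^ ?d" for "is"
  proof (induction "is")
    case (Cons x xs)
    have "(\<Sum>j<?d. count (mset (x # xs)) (inv_into UNIV idx j) * ?B ^ j) =
       (\<Sum>j<?d. count (mset xs) (inv_into UNIV idx j) * ?B ^ j + (if j = idx x then ?B ^ j else 0))"
    proof (rule sum.cong)
      fix j assume "j \<in> {..<?d}"
      then have "inv_into UNIV idx j = x \<longleftrightarrow> j = idx x"
        using idx by (metis bij_betw_inv_into_right bij_betw_inv_into_left UNIV_I)
      then show "count (mset (x # xs)) (inv_into UNIV idx j) * ?B ^ j =
          count (mset xs) (inv_into UNIV idx j) * ?B ^ j + (if j = idx x then ?B ^ j else 0)"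
        by (auto simp: algebra_simps)
    qed simp
    also have "\<dots> = (\<Sum>j<?d. count (mset xs) (inv_into UNIV idx j) * ?B ^ j) + ?B ^ idx x"
      using idx_lt[of x] by (simp add: sum.distrib)
    finally show ?case using Cons by (simp add: monomial_weight_def a_def algebra_simps)
  qed (simp add: monomial_weight_def)
  have lt: "monomial_weight a is < M" if "length is \<le> l" for "is"
  proof -
    have d0: "0 < ?d" by simp
    have "monomial_weight a is \<le> length is * (?B ^ ?d + ?B ^ (?d - 1))"
    proof (induction "is")
      case (Cons x xs)
      have "?B ^ idx x \<le> ?B ^ (?d - 1)" using idx_lt[of x] by (intro power_increasing) auto
      then show ?case using Cons by (simp add: monomial_weight_def a_def)
    qed (simp add: monomial_weight_def)
    also have "\<dots> \<le> l * (?B ^ ?d + ?B ^ (?d - 1))" using that by (rule mult_right_mono) simp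
    also have "\<dots> = l * ?B ^ ?d + l * ?B ^ (?d - 1)" by (rule distrib_left)
    also have "\<dots> < l * ?B ^ ?d + ?B * ?B ^ (?d - 1)" by simp
    also have "?B * ?B ^ (?d - 1) = ?B ^ ?d" using d0 by (cases ?d) auto
    finally show ?thesis by (simp add: M_def)
  qed
  have ge: "M \<le> monomial_weight a is" if "length is = Suc l" for "is"
    unfolding weight M_def that by simp
  have inj: "mset is = mset js" if l: "length is \<le> l" "length js \<le> l" and eq: "monomial_weight a is = monomial_weight a js" for "is" js
  proof -
    have cnt: "count (mset xs) y < ?B" if "length xs \<le> l" for xs and y :: 'd
      using that count_le_size[of "mset xs" y] by simp
    have *: "count (mset is) (inv_into UNIV idx j) = count (mset js) (inv_into UNIV idx j)" if "j < ?d" for j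
      using digits_unique[of ?d "\<lambda>j. count (mset is) (inv_into UNIV idx j)" ?B "\<lambda>j. count (mset js) (inv_into UNIV idx j)" "length is" "length js"]
        eq cnt[OF l(1)] cnt[OF l(2)] that unfolding weight by blast
    have "count (mset is) y = count (mset js) y" for y
      using *[OF idx_lt[of y]] idx by (simp add: bij_betw_inv_into_left)
    then show ?thesis by (simp add: multiset_eq_iff)
  qed
  show ?thesis
    unfolding separating_exponents_def
  proof (intro exI[of _ a] exI[of _ M] conjI allI impI)
    show "0 < M" by (simp add: M_def)
    show "0 < a i" for i by (simp add: a_def)
    show "monomial_weight a is < M" if "length is \<le> l" for "is" by (rule lt[OF that])
    show "M \<le> monomial_weight a is" if "length is = Suc l" for "is" by (rule ge[OF that])
    show "mset is = mset js" if "length is \<le> l" "length js \<le> l" "monomial_weight a is = monomial_weight a js"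
      for "is" js by (rule inj[OF that])
  qed
qed

text \<open>A class of curves closed under differentiation: it yields derivatives of all orders of
  \<open>f\<close> along the monomial curve without an explicit higher chain rule.\<close>

inductive curve_sum :: "(real^'d::finite \<Rightarrow> real^'n::finite) \<Rightarrow> real^'d \<Rightarrow> ('d \<Rightarrow> nat) \<Rightarrow> (real \<Rightarrow> real^'n) \<Rightarrow> bool"
  for f x a where
  base: "curve_sum f x a (\<lambda>t. poly p t *\<^sub>R partial_iter f is (x + power_curve a t))"
| add: "curve_sum f x a g \<Longrightarrow> curve_sum f x a h \<Longrightarrow> curve_sum f x a (\<lambda>t. g t + h t)"

lemma curve_sum_sum:
  assumes "finite A" "\<And>i. i \<in> A \<Longrightarrow> curve_sum f x a (g i)"
  shows "curve_sum f x a (\<lambda>t. \<Sum>i\<in>A. g i t)"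
  using assms
proof (induction A rule: finite_induct)
  case empty
  then show ?case using curve_sum.base[of f x a 0 "[]"] by simp
next
  case (insert i A)
  then show ?case using curve_sum.add[of f x a "g i" "\<lambda>t. \<Sum>i\<in>A. g i t"] by simp
qed

lemma power_curve_has_vector_derivative:
  "(power_curve a has_vector_derivative (\<chi> i. real (a i) * t ^ (a i - 1))) (at t)"
  unfolding has_vector_derivative_def power_curve_def
  by (rule has_derivative_componentwise_within[THEN iffD2])
    (auto simp: Basis_vec_def inner_axis intro!: derivative_eq_intros)

lemma curve_sum_has_derivative:
  assumes sm: "smooth_on U f" and "curve_sum f x a g"
  shows "\<exists>g'. curve_sum f x a g' \<and> (\<forall>t. x + power_curve a t \<in> U \<longrightarrow> (g has_vector_derivative g' t) (at t))"
  using assms(2)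
proof induction
  case (base p "is")
  define g' where "g' t = (\<Sum>i\<in>UNIV. poly (p * monom (real (a i)) (a i - 1)) t *\<^sub>R partial_iter f (i # is) (x + power_curve a t))
     + poly (pderiv p) t *\<^sub>R partial_iter f is (x + power_curve a t)" for t
  have "curve_sum f x a g'"
    unfolding g'_def by (intro curve_sum.add curve_sum_sum curve_sum.base) simp
  moreover have "((\<lambda>t. poly p t *\<^sub>R partial_iter f is (x + power_curve a t)) has_vector_derivative g' t) (at t)"
    if "x + power_curve a t \<in> U" for t
  proof -
    have "((\<lambda>t. x + power_curve a t) has_vector_derivative (\<chi> i. real (a i) * t ^ (a i - 1))) (at t)"
      using has_vector_derivative_add[OF has_vector_derivative_const power_curve_has_vector_derivative] by simp
    from smooth_compose_has_vector_derivative[OF sm that this]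
    have d: "((\<lambda>t. partial_iter f is (x + power_curve a t)) has_vector_derivative
      (\<Sum>i\<in>UNIV. (real (a i) * t ^ (a i - 1)) *\<^sub>R partial_iter f (i # is) (x + power_curve a t))) (at t)" by simp
    have "(poly p has_real_derivative poly (pderiv p) t) (at t)" by (rule poly_DERIV)
    from has_vector_derivative_scaleR[OF this d]
    show ?thesis by (simp add: g'_def scaleR_sum_right poly_monom)
  qed
  ultimately show ?case by blast
next
  case (add g h)
  then obtain g' h' where "curve_sum f x a g'" "\<forall>t. x + power_curve a t \<in> U \<longrightarrow> (g has_vector_derivative g' t) (at t)"
    "curve_sum f x a h'" "\<forall>t. x + power_curve a t \<in> U \<longrightarrow> (h has_vector_derivative h' t) (at t)" by blast
  then show ?case
    by (intro exI[of _ "\<lambda>t. g' t + h' t"]) (auto intro: curve_sum.add has_vector_derivative_add)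
qed

lemma curve_derivative_chain:
  fixes f :: "real^'d::finite \<Rightarrow> real^'n::finite"
  assumes sm: "smooth_on U f"
  shows "\<exists>F. F 0 = (\<lambda>t. f (x + power_curve a t)) \<and>
     (\<forall>k t. x + power_curve a t \<in> U \<longrightarrow> (F k has_vector_derivative F (Suc k) t) (at t))"
proof -
  have "\<exists>F. \<forall>k. (curve_sum f x a (F k) \<and> (k = 0 \<longrightarrow> F k = (\<lambda>t. f (x + power_curve a t)))) \<and>
     (\<forall>t. x + power_curve a t \<in> U \<longrightarrow> (F k has_vector_derivative F (Suc k) t) (at t))"
  proof (rule dependent_nat_choice)
    show "\<exists>g. curve_sum f x a g \<and> (0 = (0::nat) \<longrightarrow> g = (\<lambda>t. f (x + power_curve a t)))"
      using curve_sum.base[of f x a 1 "[]"] by auto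
    show "\<exists>h. (curve_sum f x a h \<and> (Suc k = 0 \<longrightarrow> h = (\<lambda>t. f (x + power_curve a t)))) \<and>
       (\<forall>t. x + power_curve a t \<in> U \<longrightarrow> (g has_vector_derivative h t) (at t))"
      if "curve_sum f x a g \<and> (k = 0 \<longrightarrow> g = (\<lambda>t. f (x + power_curve a t)))" for g and k :: nat
      using curve_sum_has_derivative[OF sm, of x a g] that by auto
  qed
  then show ?thesis by blast
qed

section \<open>Reduction to curves\<close>

lemma sum_lists_le:
  "(\<Sum>m\<le>l. \<Sum>is\<in>{is :: 'd::finite list. length is = m}. g m is) = (\<Sum>is\<in>{is. length is \<le> l}. g (length is) is)"
proof (induction l)
  case (Suc l)
  have fin: "finite {is :: 'd list. length is \<le> l}"
    using finite_lists_length_le[of "UNIV :: 'd set" l] by simp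
  have eq: "{is :: 'd list. length is \<le> Suc l} = {is. length is \<le> l} \<union> {is. length is = Suc l}" by auto
  have "(\<Sum>is\<in>{is :: 'd list. length is \<le> Suc l}. g (length is) is) =
     (\<Sum>is\<in>{is. length is \<le> l}. g (length is) is) + (\<Sum>is\<in>{is. length is = Suc l}. g (length is) is)"
    unfolding eq by (rule sum.union_disjoint) (auto simp: fin finite_lists_length)
  then show ?case using Suc by simp
qed simp

lemma power_curve_0: "(\<And>i. 0 < a i) \<Longrightarrow> power_curve a 0 = 0"
  by (simp add: power_curve_def vec_eq_iff)

lemma power_curve_near_0:
  assumes a: "\<And>i. 0 < a i" and r: "0 < r"
  obtains \<eta> where "0 < \<eta>" "\<And>t. \<bar>t\<bar> < \<eta> \<Longrightarrow> norm (power_curve a t) < r"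
proof -
  have "isCont (power_curve a) 0"
    using has_vector_derivative_continuous[OF power_curve_has_vector_derivative] .
  then have "\<exists>d>0. \<forall>t. dist t 0 < d \<longrightarrow> dist (power_curve a t) (power_curve a 0) < r"
    using r unfolding continuous_at_eps_delta by (auto simp: dist_commute)
  then obtain d where "0 < d" "\<And>t. \<bar>t\<bar> < d \<Longrightarrow> norm (power_curve a t) < r"
    by (auto simp: power_curve_0[OF a] dist_norm)
  then show thesis by (rule that)
qed

text \<open>If b kills the derivatives of orders 1 to \<open>M\<close> at 0, then
  \<open>b \<bullet> f (x + power_curve a t) - b \<bullet> f x\<close> is O(t ^ M). By the Taylor
  expansion of \<open>f\<close> the same quantity is, up to O(t ^ M), a polynomial in t with
  exponents below \<open>M\<close>; so all coefficients of that polynomial vanish.\<close>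

lemma curve_derivatives_detect_partials:
  fixes f :: "real^'d::finite \<Rightarrow> real^'n::finite"
  assumes sm: "smooth_on U f" and U: "open U" "x \<in> U"
    and sep: "separating_exponents l a M" and eta: "0 < \<eta>"
    and F: "F 0 = (\<lambda>t. f (x + power_curve a t))"
      "\<And>k t. \<bar>t\<bar> < \<eta> \<Longrightarrow> (F k has_vector_derivative F (Suc k) t) (at t)"
    and b: "\<And>k. k \<in> {1..M} \<Longrightarrow> b \<bullet> F k 0 = 0"
    and len: "1 \<le> length is" "length is \<le> l"
  shows "b \<bullet> partial_iter f is x = 0"
proof -
  have a: "\<And>i. 0 < a i" "\<And>is. length is \<le> l \<Longrightarrow> monomial_weight a is < M"
      "\<And>is. length is = Suc l \<Longrightarrow> M \<le> monomial_weight a is"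
      "\<And>is js. length is \<le> l \<Longrightarrow> length js \<le> l \<Longrightarrow> monomial_weight a is = monomial_weight a js \<Longrightarrow> mset is = mset js"
    and M: "0 < M" using sep unfolding separating_exponents_def by blast+
  obtain r where r: "0 < r" "cball x r \<subseteq> U" using U open_contains_cball by blast
  obtain \<eta>2 where eta2: "0 < \<eta>2" "\<And>t. \<bar>t\<bar> < \<eta>2 \<Longrightarrow> norm (power_curve a t) < r"
    using power_curve_near_0[of a r, OF a(1) r(1)] by blast
  define t0 where "t0 = min (\<eta> / 2) (min \<eta>2 1)"
  have t0: "0 < t0" "t0 \<le> \<eta> / 2" "t0 \<le> \<eta>2" "t0 \<le> 1" using eta eta2 by (auto simp: t0_def)
  have "continuous_on {0..\<eta> / 2} (\<lambda>t. b \<bullet> F M t)"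
  proof (intro continuous_intros continuous_at_imp_continuous_on ballI)
    fix t assume "t \<in> {0..\<eta> / 2}"
    then have "\<bar>t\<bar> < \<eta>" using eta by auto
    then show "isCont (F M) t" using F(2)[of t M] has_vector_derivative_continuous by blast
  qed
  then have "bounded ((\<lambda>t. b \<bullet> F M t) ` {0..\<eta> / 2})"
    by (intro compact_imp_bounded compact_continuous_image) auto
  then obtain C1 where C1: "0 < C1" "\<And>t. t \<in> {0..\<eta> / 2} \<Longrightarrow> \<bar>b \<bullet> F M t\<bar> \<le> C1"
    unfolding bounded_pos by auto
  have one: "\<bar>b \<bullet> f (x + power_curve a t) - b \<bullet> f x\<bar> \<le> C1 * t ^ M" if t: "0 < t" "t < t0" for t
  proof -
    have "\<exists>s>0. s < t \<and> b \<bullet> F 0 t = (\<Sum>m<M. b \<bullet> F m 0 / fact m * t ^ m) + b \<bullet> F M s / fact M * t ^ M"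
    proof (rule Maclaurin[OF t(1) M, of "\<lambda>m t. b \<bullet> F m t" "\<lambda>t. b \<bullet> F 0 t"])
      show "\<forall>m s. m < M \<and> 0 \<le> s \<and> s \<le> t \<longrightarrow> ((\<lambda>t. b \<bullet> F m t) has_real_derivative b \<bullet> F (Suc m) s) (at s)"
      proof (intro allI impI)
        fix m s assume "m < M \<and> 0 \<le> s \<and> s \<le> t"
        then have "\<bar>s\<bar> < \<eta>" using t t0 eta by auto
        from bounded_linear.has_vector_derivative[OF bounded_linear_inner_right F(2)[OF this, of m], of b]
        show "((\<lambda>t. b \<bullet> F m t) has_real_derivative b \<bullet> F (Suc m) s) (at s)"
          by (simp add: has_real_derivative_iff_has_vector_derivative)
      qed
    qed simp
    then obtain s where s: "0 < s" "s < t" "b \<bullet> F 0 t = (\<Sum>m<M. b \<bullet> F m 0 / fact m * t ^ m) + b \<bullet> F M s / fact M * t ^ M"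
      by blast
    have "(\<Sum>m<M. b \<bullet> F m 0 / fact m * t ^ m) = (\<Sum>m\<in>{0}. b \<bullet> F m 0 / fact m * t ^ m)"
      using M b by (intro sum.mono_neutral_right) auto
    then have eq: "b \<bullet> f (x + power_curve a t) - b \<bullet> f x = (b \<bullet> F M s / fact M) * t ^ M"
      using s(3) by (simp add: F(1) power_curve_0[OF a(1)])
    have "\<bar>b \<bullet> F M s\<bar> \<le> C1 * 1" using C1(2)[of s] s t t0 by auto
    also have "\<dots> \<le> C1 * fact M" using C1(1) by (intro mult_left_mono) auto
    finally have "\<bar>b \<bullet> F M s / fact M\<bar> \<le> C1" by (simp add: abs_divide divide_le_eq)
    then show ?thesis unfolding eq abs_mult using t(1) C1(1) by (intro mult_mono) auto
  qed
  have "\<exists>C. \<forall>z\<in>cball x r. \<bar>b \<bullet> partial_iter f js z\<bar> \<le> C" for js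
  proof -
    have "continuous_on (cball x r) (\<lambda>z. b \<bullet> partial_iter f js z)"
      using sm r(2) by (intro continuous_intros) (auto simp: smooth_on_def intro: continuous_on_subset)
    then have "bounded ((\<lambda>z. b \<bullet> partial_iter f js z) ` cball x r)"
      by (intro compact_imp_bounded compact_continuous_image) auto
    then show ?thesis unfolding bounded_iff by auto
  qed
  then obtain C where C: "\<And>js z. z \<in> cball x r \<Longrightarrow> \<bar>b \<bullet> partial_iter f js z\<bar> \<le> C js" by metis
  define C2 where "C2 = (\<Sum>js\<in>{js. length js = Suc l}. C js)"
  define A where "A = {js :: 'd list. length js \<le> l}"
  have fA: "finite A" unfolding A_def using finite_lists_length_le[of "UNIV :: 'd set" l] by simp
  define c where "c js = b \<bullet> partial_iter f js x / fact (length js)" for js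
  \<comment> \<open>The empty word is left out, since it contributes the constant
    \<open>b \<bullet> f x\<close>.\<close>
  define p where "p = (\<Sum>js\<in>A - {[]}. monom (c js) (monomial_weight a js))"
  have two: "\<bar>b \<bullet> f (x + power_curve a t) - b \<bullet> f x - poly p t\<bar> \<le> C2 * t ^ M" if t: "0 < t" "t < t0" for t
  proof -
    have n: "norm (power_curve a t) < r" using eta2(2)[of t] t t0 by simp
    have seg: "x + s *\<^sub>R power_curve a t \<in> cball x r" if "s \<in> {0..1}" for s
    proof -
      have "norm (s *\<^sub>R power_curve a t) \<le> 1 * norm (power_curve a t)"
        unfolding norm_scaleR using that by (intro mult_right_mono) auto
      then show ?thesis using n by (simp add: dist_norm)
    qed
    obtain s where s: "s \<in> {0..1}" "b \<bullet> f (x + power_curve a t) = (\<Sum>m\<le>l. \<Sum>js\<in>{js. length js = m}.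
      prod_list (map (\<lambda>i. power_curve a t $ i) js) * (b \<bullet> partial_iter f js x) / fact m)
     + (\<Sum>js\<in>{js. length js = Suc l}. prod_list (map (\<lambda>i. power_curve a t $ i) js) *
         (b \<bullet> partial_iter f js (x + s *\<^sub>R power_curve a t))) / fact (Suc l)"
      using smooth_taylor[OF sm, of x "power_curve a t" b l] seg r(2) by blast
    have "(\<Sum>m\<le>l. \<Sum>js\<in>{js. length js = m}.
      prod_list (map (\<lambda>i. power_curve a t $ i) js) * (b \<bullet> partial_iter f js x) / fact m)
      = (\<Sum>js\<in>A. c js * t ^ monomial_weight a js)"
      unfolding sum_lists_le prod_list_power_curve A_def by (simp add: c_def mult.commute)
    also have "\<dots> = b \<bullet> f x + poly p t"
      using fA by (subst sum.remove[of _ "[]"]) (auto simp: A_def p_def c_def poly_sum poly_monom monomial_weight_def)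
    finally have "b \<bullet> f (x + power_curve a t) - b \<bullet> f x - poly p t =
      (\<Sum>js\<in>{js. length js = Suc l}. t ^ monomial_weight a js *
         (b \<bullet> partial_iter f js (x + s *\<^sub>R power_curve a t))) / fact (Suc l)"
      using s(2) unfolding prod_list_power_curve by linarith
    also have "\<bar>\<dots>\<bar> \<le> \<bar>\<Sum>js\<in>{js. length js = Suc l}. t ^ monomial_weight a js *
         (b \<bullet> partial_iter f js (x + s *\<^sub>R power_curve a t))\<bar> / 1"
      unfolding abs_divide by (rule divide_left_mono) (use fact_ge_1[of "Suc l", where 'a=real] in auto)
    also have "\<dots> \<le> (\<Sum>js\<in>{js. length js = Suc l}. t ^ M * C js)"
      unfolding div_by_1
    proof (rule order.trans[OF sum_abs sum_mono])
      fix js :: "'d list" assume "js \<in> {js. length js = Suc l}"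
      then have "t ^ monomial_weight a js \<le> t ^ M" using a(3) t t0 by (intro power_decreasing) auto
      then show "\<bar>t ^ monomial_weight a js * (b \<bullet> partial_iter f js (x + s *\<^sub>R power_curve a t))\<bar> \<le> t ^ M * C js"
        unfolding abs_mult using C[OF seg[OF s(1)], of js] t by (intro mult_mono) auto
    qed
    also have "\<dots> = C2 * t ^ M" by (simp add: C2_def sum_distrib_left mult.commute)
    finally show ?thesis .
  qed
  have "coeff p (monomial_weight a is) = 0"
  proof (rule poly_coeffs_zero_of_small[OF t0(1), of _ "C1 + C2" M])
    show "\<bar>poly p t\<bar> \<le> (C1 + C2) * t ^ M" if "0 < t" "t < t0" for t
      using one[OF that] two[OF that] by (simp add: distrib_right abs_le_iff)
    show "monomial_weight a is < M" using a(2) len by simp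
  qed
  \<comment> \<open>Only rearrangements of \<open>is\<close> share its exponent, and by symmetry
    they have the same partial derivative, so the coefficient is \<open>c is\<close> times a
    positive count.\<close>
  moreover have "coeff p (monomial_weight a is) = (\<Sum>js\<in>A - {[]}. if mset js = mset is then c is else 0)"
    unfolding p_def coeff_sum coeff_monom
  proof (rule sum.cong[OF refl])
    fix js assume js: "js \<in> A - {[]}"
    show "(if monomial_weight a js = monomial_weight a is then c js else 0) = (if mset js = mset is then c is else 0)"
    proof (cases "mset js = mset is")
      case True
      have "monomial_weight a js = sum_mset (image_mset a (mset js))"
        by (simp add: monomial_weight_def flip: sum_mset_sum_list)
      also have "\<dots> = monomial_weight a is" unfolding True
        by (simp add: monomial_weight_def flip: sum_mset_sum_list)
      finally have "monomial_weight a js = monomial_weight a is" .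
      moreover have "c js = c is"
        by (simp add: c_def partial_iter_mset[OF sm U True] mset_eq_length[OF True])
      ultimately show ?thesis using True by simp
    next
      case False
      then have "monomial_weight a js \<noteq> monomial_weight a is" using a(4)[of js "is"] js len by (auto simp: A_def)
      then show ?thesis using False by simp
    qed
  qed
  ultimately have "c is * (\<Sum>js\<in>A - {[]}. if mset js = mset is then 1 else 0) = 0"
    by (simp add: sum_distrib_left if_distrib cong: if_cong)
  moreover have "0 < (\<Sum>js\<in>A - {[]}. if mset js = mset is then 1 else (0::real))"
    by (rule sum_pos2[of _ "is"]) (use fA len in \<open>auto simp: A_def\<close>)
  ultimately show ?thesis by (auto simp: c_def)
qed

text \<open>Nondegeneracy of \<open>f\<close> at x passes to the curve: a vector of
  \<open>L0\<close> orthogonal to the derivatives of the curve is orthogonal to the partial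
  derivatives, which span \<open>L0\<close>, hence to itself.\<close>

lemma curve_extremal_at_nondegenerate_point:
  fixes f :: "real^'d::finite \<Rightarrow> real^'n::finite"
  assumes sep: "separating_exponents l a M"
    and sm: "smooth_on U f" and U: "open U" "x \<in> U" and L0: "subspace L0" and mem: "\<And>z. z \<in> U \<Longrightarrow> f z - y0 \<in> L0"
    and sp: "span {partial_iter f is x | is. 1 \<le> length is \<and> length is \<le> l} = L0" and y0: "\<not> VWA y0"
  shows "\<exists>\<delta>>0. AE t in lborel. t \<in> {0..<\<delta>} \<longrightarrow> \<not> VWA (f (x + power_curve a t))"
proof -
  have a: "\<And>i. 0 < a i" and M: "0 < M" using sep by (auto simp: separating_exponents_def)
  obtain r where r: "0 < r" "ball x r \<subseteq> U" using U open_contains_ball by blast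
  obtain \<eta> where eta: "0 < \<eta>" "\<And>t. \<bar>t\<bar> < \<eta> \<Longrightarrow> norm (power_curve a t) < r"
    using power_curve_near_0[of a r, OF a r(1)] by blast
  have inU: "x + power_curve a t \<in> U" if "\<bar>t\<bar> < \<eta>" for t
    using eta(2)[OF that] r(2) by (auto simp: subset_iff dist_norm)
  obtain F where F: "F 0 = (\<lambda>t. f (x + power_curve a t))"
    "\<And>k t. x + power_curve a t \<in> U \<Longrightarrow> (F k has_vector_derivative F (Suc k) t) (at t)"
    using curve_derivative_chain[OF sm, of x a] by blast
  have dF: "(F k has_vector_derivative F (Suc k) t) (at t)" if "\<bar>t\<bar> < \<eta>" for k t
    by (rule F(2)[OF inU[OF that]])
  have "\<exists>\<delta>>0. AE t in lborel. t \<in> {0..<\<delta>} \<longrightarrow> \<not> VWA (F 0 t)"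
  proof (rule nondegenerate_curve_extremal[where \<eta> = \<eta> and F = F and m = M])
    show "0 < \<eta>" "0 < M" "subspace L0" "\<not> VWA y0" by (fact eta(1) M L0 y0)+
    show "(F k has_vector_derivative F (Suc k) t) (at t)" if "\<bar>t\<bar> < \<eta>" for k t by (rule dF[OF that])
    show "F 0 t - y0 \<in> L0" if "\<bar>t\<bar> < \<eta>" for t using mem inU[OF that] by (simp add: F(1))
    fix b assume b: "b \<in> L0" "\<And>k. k \<in> {1..M} \<Longrightarrow> b \<bullet> F k 0 = 0"
    have orth: "b \<bullet> v = 0" if v: "v \<in> {partial_iter f is x | is. 1 \<le> length is \<and> length is \<le> l}" for v
    proof -
      obtain "is" where "v = partial_iter f is x" "1 \<le> length is" "length is \<le> l" using v by blast
      then show ?thesis using curve_derivatives_detect_partials[OF sm U sep eta(1) F(1) dF b(2)] by simp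
    qed
    have "b \<in> span {partial_iter f is x | is. 1 \<le> length is \<and> length is \<le> l}" using b(1) sp by simp
    then have "orthogonal b b" by (rule orthogonal_to_span) (unfold orthogonal_def, rule orth)
    then show "b = 0" by (simp add: orthogonal_def)
  qed
  then show ?thesis by (simp add: F(1))
qed

text \<open>A form of Steinhaus's theorem. Take a compact T inside P and an open V around T of
  measure below twice that of T. For small h both T and its translate lie in V, so they overlap in
  positive measure.\<close>

lemma translate_overlap:
  fixes P :: "'a::euclidean_space set"
  assumes P: "P \<in> sets borel" "emeasure lborel P \<noteq> 0"
  shows "\<exists>\<epsilon>>0. \<forall>h. norm h < \<epsilon> \<longrightarrow> emeasure lborel {x\<in>P. x + h \<in> P} \<noteq> 0"
proof -
  have "\<exists>n::nat. emeasure lborel (P \<inter> cball 0 (real n)) \<noteq> 0"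
  proof (rule ccontr)
    assume "\<not> ?thesis"
    then have "(\<Union>n::nat. P \<inter> cball 0 (real n)) \<in> null_sets lborel"
      using P(1) by (intro null_sets_UN') (auto simp: null_sets_def)
    moreover have "(\<Union>n::nat. P \<inter> cball 0 (real n)) = P"
      using real_arch_simple by (auto simp: dist_norm)
    ultimately show False using P(2) by (simp add: null_sets_def)
  qed
  then obtain n :: nat where n: "emeasure lborel (P \<inter> cball 0 (real n)) \<noteq> 0" by blast
  define Q where "Q = P \<inter> cball 0 (real n)"
  have Qb: "Q \<in> sets borel" using P(1) by (simp add: Q_def)
  have Ql: "Q \<in> lmeasurable" using Qb by (intro bounded_set_imp_lmeasurable) (auto simp: Q_def intro: bounded_Int)
  have m: "0 < measure lebesgue Q"
    using n emeasure_eq_measure2[OF Ql] Qb by (simp add: Q_def zero_less_measure_iff)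
  obtain T where T: "closed T" "T \<subseteq> Q" "(Q - T) \<in> lmeasurable" "measure lebesgue (Q - T) < measure lebesgue Q"
  proof -
    obtain T where "closed T" "T \<subseteq> Q" "Q - T \<in> lmeasurable" "emeasure lebesgue (Q - T) < ennreal (measure lebesgue Q)"
      using sets_lebesgue_inner_closed[OF fmeasurableD[OF Ql] m] by blast
    then show thesis using that emeasure_eq_measure2[of "Q - T" lebesgue] by (simp add: ennreal_less_iff)
  qed
  have Tb: "bounded T" using T(2) by (auto simp: Q_def intro: bounded_subset[of "cball 0 (real n)"])
  have Tc: "compact T" using T(1) Tb by (simp add: compact_eq_bounded_closed)
  have Tl: "T \<in> lmeasurable" by (rule lmeasurable_compact[OF Tc])
  have mT: "0 < measure lebesgue T"
    using measurable_measure_Diff[OF Ql fmeasurableD[OF Tl] T(2)] T(4) by simp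
  obtain V where V: "open V" "T \<subseteq> V" "V \<in> lmeasurable" "measure lebesgue V < measure lebesgue T + measure lebesgue T"
  proof -
    obtain V where V: "open V" "T \<subseteq> V" "V - T \<in> lmeasurable" "emeasure lebesgue (V - T) < ennreal (measure lebesgue T)"
      using sets_lebesgue_outer_open[OF fmeasurableD[OF Tl] mT] by blast
    have eq: "V = T \<union> (V - T)" using V(2) by auto
    have Vl: "V \<in> lmeasurable" using fmeasurable.Un[OF Tl V(3)] eq by simp
    have "measure lebesgue (V - T) < measure lebesgue T"
      using V(4) emeasure_eq_measure2[OF V(3)] by (simp add: ennreal_less_iff)
    moreover have "measure lebesgue (V - T) = measure lebesgue V - measure lebesgue T"
      by (rule measurable_measure_Diff[OF Vl fmeasurableD[OF Tl] V(2)])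
    ultimately show thesis using that[OF V(1,2) Vl] by simp
  qed
  obtain \<epsilon> where e: "\<epsilon> > 0" "(\<Union>x\<in>T. ball x \<epsilon>) \<subseteq> V"
    using compact_subset_open_imp_ball_epsilon_subset[OF Tc V(1,2)] by blast
  have "emeasure lborel {x\<in>P. x + h \<in> P} \<noteq> 0" if h: "norm h < \<epsilon>" for h
  proof
    assume z: "emeasure lborel {x\<in>P. x + h \<in> P} = 0"
    let ?T = "(+) h ` T"
    have TV: "T \<union> ?T \<subseteq> V"
    proof -
      have "h + x \<in> ball x \<epsilon>" for x using h by (simp add: dist_norm)
      then show ?thesis using e(2) V(2) by blast
    qed
    have T'l: "?T \<in> lmeasurable" "measure lebesgue ?T = measure lebesgue T"
      using Tl by (simp_all add: measurable_translation measure_translation)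
    have P2: "{x\<in>P. x + h \<in> P} \<in> sets borel"
    proof -
      have "(\<lambda>x. x + h) -` P \<inter> space borel \<in> sets borel"
        by (rule measurable_sets[OF _ P(1)]) (intro borel_measurable_continuous_onI continuous_intros)
      moreover have "{x\<in>P. x + h \<in> P} = P \<inter> ((\<lambda>x. x + h) -` P \<inter> space borel)" by auto
      ultimately show ?thesis using P(1) by simp
    qed
    have "{x\<in>P. x + h \<in> P} \<in> null_sets lborel" using z P2 by (simp add: null_sets_def)
    then have "{x\<in>P. x + h \<in> P} \<in> null_sets lebesgue" by (rule null_sets_completionI)
    then have "negligible {x\<in>P. x + h \<in> P}" by (simp add: negligible_iff_null_sets)
    then have "negligible ((+) h ` {x\<in>P. x + h \<in> P})" by (rule negligible_translation)
    then have "negligible (T \<inter> ?T)"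
      by (rule negligible_subset) (use T(2) in \<open>auto simp: Q_def add.commute\<close>)
    then have "measure lebesgue (T \<inter> ?T) = 0" by (rule negligible_imp_measure0)
    then have "measure lebesgue (T \<union> ?T) = measure lebesgue T + measure lebesgue T"
      using measure_Un3[OF Tl T'l(1)] T'l(2) by simp
    moreover have "measure lebesgue (T \<union> ?T) \<le> measure lebesgue V"
      by (rule measure_mono_fmeasurable[OF TV]) (use Tl T'l V in \<open>auto simp: fmeasurableD\<close>)
    ultimately show False using V(4) by simp
  qed
  then show ?thesis using e(1) by blast
qed

text \<open>Infinitude is expressed by countable quantifiers, as a solution outside every finite
  list, and the exponents are reduced to n + 1 / (j + 1).\<close>

lemma borel_VWA: "{y :: real^'n::finite. VWA y} \<in> sets borel"
proof -
  define W where "W j y \<longleftrightarrow> (\<forall>qs :: (int^'n) list. \<exists>q. q \<notin> set qs \<and>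
      (\<exists>p::int. \<bar>ydotq y q + real_of_int p\<bar> \<le> supnorm_int q powr (- (real CARD('n) + 1 / real (Suc j)))))"
    for j :: nat and y :: "real^'n"
  have W_iff: "y \<in> W_set (real CARD('n) + 1 / real (Suc j)) \<longleftrightarrow> W j y" for j y
  proof -
    have inf: "infinite A \<longleftrightarrow> (\<forall>qs. \<exists>q. q \<notin> set qs \<and> q \<in> A)" for A :: "(int^'n) set"
    proof
      assume "infinite A"
      then show "\<forall>qs. \<exists>q. q \<notin> set qs \<and> q \<in> A" by (metis List.finite_set finite_subset subsetI)
    next
      assume a: "\<forall>qs. \<exists>q. q \<notin> set qs \<and> q \<in> A"
      show "infinite A"
      proof
        assume "finite A"
        then obtain qs where "set qs = A" using finite_list by blast
        then show False using a by blast
      qed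
    qed
    show ?thesis unfolding W_set_def mem_Collect_eq inf W_def by simp
  qed
  have VWA_iff: "VWA y \<longleftrightarrow> (\<exists>j. W j y)" for y
  proof
    assume "VWA y"
    then obtain v where v: "v > real CARD('n)" "y \<in> W_set v" by (auto simp: VWA_def)
    obtain j where j: "1 / real (Suc j) < v - real CARD('n)" using v(1) nat_approx_posE[of "v - real CARD('n)"] by auto
    have le: "supnorm_int q powr (- v) \<le> supnorm_int q powr (- (real CARD('n) + 1 / real (Suc j)))" for q :: "int^'n"
    proof (cases "q = 0")
      case True
      \<comment> \<open>At base 0 both powers are 0 by convention, so the comparison of exponents
        also covers q = 0.\<close>
      then have "supnorm_int q = 0" using supnorm_int_attained[of q] by auto
      then show ?thesis by simp
    next
      case False
      then show ?thesis using supnorm_int_ge_1[of q] j by (intro powr_mono) auto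
    qed
    have "y \<in> W_set (real CARD('n) + 1 / real (Suc j))"
      using v(2) unfolding W_set_def mem_Collect_eq
      by (rule infinite_super[rotated]) (use le in \<open>auto intro: order_trans\<close>)
    then show "\<exists>j. W j y" using W_iff by blast
  next
    assume "\<exists>j. W j y"
    then obtain j where "y \<in> W_set (real CARD('n) + 1 / real (Suc j))" using W_iff by blast
    then show "VWA y" unfolding VWA_def by (intro exI[of _ "real CARD('n) + 1 / real (Suc j)"]) auto
  qed
  have [measurable]: "(\<lambda>y :: real^'n. ydotq y q) \<in> borel_measurable borel" for q
    unfolding ydotq_def by (intro borel_measurable_continuous_onI continuous_intros)
  have "{y \<in> space borel. \<exists>j. W j y} \<in> sets borel" unfolding W_def by measurable
  then show ?thesis by (simp add: VWA_iff)
qed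

lemma lin_part_eq:
  assumes "affine L" "y \<in> L"
  shows "lin_part L = (\<lambda>x. x - y) ` L"
proof
  show "lin_part L \<subseteq> (\<lambda>x. x - y) ` L"
  proof
    fix z assume "z \<in> lin_part L"
    then obtain u v where uv: "u \<in> L" "v \<in> L" "z = u - v" by (auto simp: lin_part_def)
    have "y + 1 *\<^sub>R (u - v) \<in> L" by (rule mem_affine_3_minus[OF assms uv(1,2)])
    then show "z \<in> (\<lambda>x. x - y) ` L" using uv(3) by (intro image_eqI[of _ _ "y + (u - v)"]) auto
  qed
  show "(\<lambda>x. x - y) ` L \<subseteq> lin_part L" using assms(2) by (auto simp: lin_part_def)
qed

lemma subspace_lin_part: "affine L \<Longrightarrow> y \<in> L \<Longrightarrow> subspace (lin_part L)"
  using affine_diffs_subspace_subtract by (simp add: lin_part_eq)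

text \<open>\<open>N l m\<close> collects the points of the exceptional set \<open>E\<close> whose
  curve of level l meets \<open>E\<close> only for a null set of times in [0, 1 / (m + 1)). The
  result for curves puts every nondegenerate point of \<open>E\<close> into some
  \<open>N l m\<close>. By Fubini, for almost every small t almost no x has both x and
  \<open>x + power_curve (a l) t\<close> in \<open>N l m\<close>; as t tends to 0 this contradicts
  \<open>translate_overlap\<close> unless \<open>N l m\<close> is null.\<close>

lemma nondegenerate_extremal:
  fixes f :: "real^'d::finite \<Rightarrow> real^'n::finite"
  assumes L: "affine L" "y0 \<in> L" "\<not> VWA y0"
    and U: "open U" and sm: "smooth_on U f" and fL: "f ` U \<subseteq> L" and nd: "nondegenerate_in L f U"
  shows "extremal_map f U"
proof -
  note lin = lin_part_eq[OF L(1,2)] and subL = subspace_lin_part[OF L(1,2)]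
  have mem: "f z - y0 \<in> lin_part L" if "z \<in> U" for z unfolding lin using fL that by auto
  define E where "E = {x\<in>U. VWA (f x)}"
  have E: "E \<in> sets borel"
  proof -
    have "continuous_on U f" using sm by (metis partial_iter.simps(1) smooth_on_def)
    then have "f \<in> borel_measurable (restrict_space borel U)" by (rule borel_measurable_continuous_on_restrict)
    from measurable_sets[OF this borel_VWA]
    have "f -` {y. VWA y} \<inter> U \<in> sets (restrict_space borel U)" by (simp add: space_restrict_space)
    then have "f -` {y. VWA y} \<inter> U \<in> sets borel" using U by (subst (asm) sets_restrict_space_iff) auto
    moreover have "E = f -` {y. VWA y} \<inter> U" by (auto simp: E_def)
    ultimately show ?thesis by simp
  qed
  have "\<forall>l. \<exists>(a :: 'd \<Rightarrow> nat) M. separating_exponents l a M" using separating_exponents_exist by blast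
  then obtain a :: "nat \<Rightarrow> 'd \<Rightarrow> nat" and M where sep: "\<And>l. separating_exponents l (a l) (M l)" by metis
  have a: "0 < a l i" for l i using sep[of l] by (simp add: separating_exponents_def)
  define Q where "Q l m = {(x, t). 0 \<le> t \<and> t < 1 / real (Suc m) \<and> x + power_curve (a l) t \<in> E}" for l m :: nat
  have Qm: "Q l m \<in> sets (lborel \<Otimes>\<^sub>M lborel)" for l m
  proof -
    have pc: "continuous_on UNIV (power_curve (a l))"
      using has_vector_derivative_continuous[OF power_curve_has_vector_derivative]
      by (intro continuous_at_imp_continuous_on) auto
    have "continuous_on UNIV (\<lambda>p :: (real^'d) \<times> real. fst p + power_curve (a l) (snd p))"
      by (intro continuous_intros continuous_on_compose2[OF pc]) auto
    then have "(\<lambda>p :: (real^'d) \<times> real. fst p + power_curve (a l) (snd p)) \<in> borel_measurable borel"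
      by (rule borel_measurable_continuous_onI)
    from measurable_sets[OF this E]
    have 1: "(\<lambda>p. fst p + power_curve (a l) (snd p)) -` E \<in> sets borel" by simp
    have "(snd :: (real^'d) \<times> real \<Rightarrow> real) \<in> borel_measurable borel"
      by (intro borel_measurable_continuous_onI continuous_intros)
    from measurable_sets[OF this, of "{0..<1 / real (Suc m)}"]
    have 2: "snd -` {0..<1 / real (Suc m)} \<in> sets (borel :: ((real^'d) \<times> real) measure)" by simp
    have "Q l m = (\<lambda>p. fst p + power_curve (a l) (snd p)) -` E \<inter> snd -` {0..<1 / real (Suc m)}"
      by (auto simp: Q_def)
    then have "Q l m \<in> sets borel" using 1 2 by simp
    then show ?thesis by (simp add: borel_prod[symmetric])
  qed
  define N where "N l m = {x\<in>E. emeasure lborel (Pair x -` Q l m) = 0}" for l m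
  have Nb: "N l m \<in> sets borel" for l m
  proof -
    have "(\<lambda>x. emeasure lborel (Pair x -` Q l m)) \<in> borel_measurable lborel"
      by (rule lborel.measurable_emeasure_Pair[OF Qm])
    then have "{x \<in> space lborel. emeasure lborel (Pair x -` Q l m) = 0} \<in> sets lborel" by measurable
    moreover have "N l m = E \<inter> {x \<in> space lborel. emeasure lborel (Pair x -` Q l m) = 0}" by (auto simp: N_def)
    ultimately show ?thesis using E by auto
  qed
  have Nnull: "emeasure lborel (N l m) = 0" for l m
  proof (rule ccontr)
    assume "emeasure lborel (N l m) \<noteq> 0"
    from translate_overlap[OF Nb this] obtain \<epsilon> where e: "\<epsilon> > 0"
      "\<And>h. norm h < \<epsilon> \<Longrightarrow> emeasure lborel {x\<in>N l m. x + h \<in> N l m} \<noteq> 0" by blast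
    have slice: "Pair x -` Q l m \<in> sets borel" for x
      using sets_Pair1[OF Qm, of x] by simp
    have "AE x in lborel. AE t in lborel. x \<in> N l m \<longrightarrow> (x, t) \<notin> Q l m"
    proof (rule AE_I2)
      fix x :: "real^'d"
      show "AE t in lborel. x \<in> N l m \<longrightarrow> (x, t) \<notin> Q l m"
      proof (cases "x \<in> N l m")
        case True
        then have "Pair x -` Q l m \<in> null_sets lborel" using slice by (simp add: N_def null_sets_def)
        from AE_not_in[OF this] show ?thesis by simp
      qed simp
    qed
    moreover have "{p \<in> space (lborel \<Otimes>\<^sub>M lborel). fst p \<in> N l m \<longrightarrow> (fst p, snd p) \<notin> Q l m} \<in> sets (lborel \<Otimes>\<^sub>M lborel)"
    proof -
      have "N l m \<times> UNIV \<in> sets (lborel \<Otimes>\<^sub>M (lborel :: real measure))"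
        using pair_measureI[of "N l m" lborel UNIV lborel] Nb by simp
      then have "space (lborel \<Otimes>\<^sub>M lborel) - (Q l m \<inter> (N l m \<times> UNIV)) \<in> sets (lborel \<Otimes>\<^sub>M lborel)"
        using Qm by (intro sets.compl_sets sets.Int) auto
      moreover have "{p \<in> space (lborel \<Otimes>\<^sub>M lborel). fst p \<in> N l m \<longrightarrow> (fst p, snd p) \<notin> Q l m} =
          space (lborel \<Otimes>\<^sub>M lborel) - (Q l m \<inter> (N l m \<times> UNIV))" by auto
      ultimately show ?thesis by simp
    qed
    ultimately have "AE t in lborel. AE x in lborel. x \<in> N l m \<longrightarrow> (x, t) \<notin> Q l m"
      by (subst (asm) lborel_pair.AE_commute) auto
    then obtain Z where Z: "Z \<in> null_sets lborel" "\<And>t. t \<notin> Z \<Longrightarrow> AE x in lborel. x \<in> N l m \<longrightarrow> (x, t) \<notin> Q l m"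
      by (rule AE_E3) simp
    obtain \<eta> where eta: "0 < \<eta>" "\<And>t. \<bar>t\<bar> < \<eta> \<Longrightarrow> norm (power_curve (a l) t) < \<epsilon>"
      using power_curve_near_0[of "a l" \<epsilon>, OF a e(1)] by blast
    define \<theta> where "\<theta> = min \<eta> (1 / real (Suc m))"
    have th: "0 < \<theta>" using eta(1) by (simp add: \<theta>_def)
    have "\<not> {0<..<\<theta>} \<subseteq> Z"
    proof
      assume "{0<..<\<theta>} \<subseteq> Z"
      then have "emeasure lborel {0<..<\<theta>} \<le> emeasure lborel Z"
        by (rule emeasure_mono) (use Z(1) in auto)
      then show False using Z(1) th by (simp add: null_sets_def)
    qed
    then obtain t where "t \<in> {0<..<\<theta>}" and tZ: "t \<notin> Z" by blast
    then have t: "0 < t" "t < \<theta>" "t \<notin> Z" by auto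
    let ?h = "power_curve (a l) t"
    have h: "norm ?h < \<epsilon>" using eta(2)[of t] t by (simp add: \<theta>_def)
    have "AE x in lborel. \<not> (x \<in> N l m \<and> x + ?h \<in> N l m)"
      using Z(2)[OF t(3)]
    proof eventually_elim
      case (elim x)
      have "(x, t) \<in> Q l m" if "x + ?h \<in> N l m" using that t by (auto simp: Q_def N_def \<theta>_def)
      then show ?case using elim by blast
    qed
    then obtain Y where Y: "Y \<in> null_sets lborel" "{x. x \<in> N l m \<and> x + ?h \<in> N l m} \<subseteq> Y"
      by (auto simp: eventually_ae_filter)
    have "emeasure lborel {x\<in>N l m. x + ?h \<in> N l m} \<le> emeasure lborel Y"
      by (rule emeasure_mono) (use Y in auto)
    then show False using e(2)[OF h] Y(1) by (simp add: null_sets_def)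
  qed
  \<comment> \<open>The order l of nondegeneracy and the length of the good piece of curve vary with
    x; countably many l and m cover all cases.\<close>
  have "AE x in lborel. \<forall>l m. x \<notin> N l m"
    unfolding AE_all_countable using Nb Nnull by (intro allI AE_not_in) (simp add: null_sets_def)
  then show ?thesis
    using nd unfolding extremal_map_def nondegenerate_in_def
  proof eventually_elim
    case (elim x)
    show ?case
    proof (intro impI notI)
      assume x: "x \<in> U" and vwa: "VWA (f x)"
      obtain l where sp: "span {partial_iter f is x | is. 1 \<le> length is \<and> length is \<le> l} = lin_part L"
        using elim(2) x unfolding nondegenerate_at_def by blast
      from curve_extremal_at_nondegenerate_point[OF sep sm U x subL mem sp L(3)] obtain \<delta> where d: "\<delta> > 0" "AE t in lborel. t \<in> {0..<\<delta>} \<longrightarrow> \<not> VWA (f (x + power_curve (a l) t))"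
        by blast
      obtain m where m: "1 / real (Suc m) < \<delta>" using d(1) nat_approx_posE by metis
      have "AE t in lborel. (x, t) \<notin> Q l m"
        using d(2) by eventually_elim (use m in \<open>auto simp: Q_def E_def\<close>)
      moreover have "Pair x -` Q l m \<in> sets lborel" using sets_Pair1[OF Qm, of x] by simp
      ultimately have "emeasure lborel (Pair x -` Q l m) = 0"
        using AE_iff_measurable[of "Pair x -` Q l m" lborel "\<lambda>t. (x, t) \<notin> Q l m"] by (auto simp: vimage_def)
      then have "x \<in> N l m" using x vwa by (simp add: N_def E_def)
      then show False using elim(1) by blast
    qed
  qed
qed

section \<open>Affine parametrisations and the two claims\<close>

lemma frechet_derivative_affine:
  assumes "linear T"
  shows "frechet_derivative (\<lambda>x. c + T x) (at (x :: real^'d::finite)) = (T :: real^'d \<Rightarrow> real^'n::finite)"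
proof -
  have "bounded_linear T" using assms by (simp add: linear_conv_bounded_linear)
  then have "(T has_derivative T) (at x)" by (rule bounded_linear_imp_has_derivative)
  then have "((\<lambda>x. c + T x) has_derivative T) (at x)"
    using has_derivative_add[OF has_derivative_const[of c "at x"]] by simp
  then show ?thesis by (rule frechet_derivative_at[symmetric])
qed

lemma partial_iter_affine:
  fixes T :: "real^'d::finite \<Rightarrow> real^'n::finite"
  assumes "linear T"
  shows "partial_iter (\<lambda>x. c + T x) (i # is) = (\<lambda>x. if is = [] then T (axis i 1) else 0)"
proof (induction "is" arbitrary: i)
  case Nil
  then show ?case by (simp add: partial_iter.simps frechet_derivative_affine[OF assms])
next
  case (Cons j js)
  have "partial_iter (\<lambda>x. c + T x) (i # j # js) =
     (\<lambda>x. frechet_derivative (partial_iter (\<lambda>x. c + T x) (j # js)) (at x) (axis i 1))"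
    by (rule partial_iter.simps(2))
  then show ?case unfolding Cons.IH by simp
qed

lemma smooth_on_affine:
  fixes T :: "real^'d::finite \<Rightarrow> real^'n::finite"
  assumes "linear T"
  shows "smooth_on U (\<lambda>x. c + T x)"
  unfolding smooth_on_def
proof (intro allI conjI ballI)
  fix "is" :: "'d list"
  have bl: "bounded_linear T" using assms by (simp add: linear_conv_bounded_linear)
  show "continuous_on U (partial_iter (\<lambda>x. c + T x) is)"
  proof (cases "is")
    case Nil
    then show ?thesis by (auto intro!: continuous_intros linear_continuous_on[OF bl])
  qed (simp add: partial_iter_affine[OF assms])
  show "partial_iter (\<lambda>x. c + T x) is differentiable at x" for x
  proof (cases "is")
    case Nil
    then show ?thesis by (auto intro!: derivative_intros bounded_linear_imp_differentiable[OF bl])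
  qed (simp add: partial_iter_affine[OF assms])
qed

lemma linear_projection_exists:
  fixes S :: "(real^'n::finite) set"
  assumes "subspace S"
  shows "\<exists>T :: real^'n \<Rightarrow> real^'n. linear T \<and> range T = S"
proof -
  obtain B where B: "B \<subseteq> S" "pairwise orthogonal B" "\<And>x. x \<in> B \<Longrightarrow> norm x = 1" "independent B" "span B = S"
    using orthonormal_basis_subspace[OF assms] by metis
  have fB: "finite B" using B(4) by (rule independent_imp_finite)
  define T where "T x = (\<Sum>b\<in>B. (x \<bullet> b) *\<^sub>R b)" for x
  have "linear T" unfolding T_def
    by (rule linearI) (auto simp: inner_add_left algebra_simps sum.distrib scaleR_sum_right)
  moreover have "range T = S"
  proof
    have "T x \<in> span B" for x unfolding T_def by (intro span_sum span_scale span_base)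
    then show "range T \<subseteq> S" using B(5) by auto
    show "S \<subseteq> range T"
    proof
      fix x assume "x \<in> S"
      then have "T x = x" unfolding T_def using B fB by (intro orthonormal_basis_expand) auto
      then show "x \<in> range T" by (metis rangeI)
    qed
  qed
  ultimately show ?thesis by blast
qed

theorem theorem1p2:
  fixes L :: "(real ^ 'n) set"
    and U :: "(real ^ 'd) set"
    and f :: "real ^ 'd \<Rightarrow> real ^ 'n"
  assumes "affine L" and "L \<noteq> {}"
  shows "(extremal_affine L \<and> open U \<and> smooth_on U f \<and> f ` U \<subseteq> L \<and> nondegenerate_in L f U
            \<longrightarrow> extremal_map f U)
       \<and> (\<not> extremal_affine L \<longrightarrow> (\<forall>y\<in>L. VWA y))"
proof (intro conjI impI ballI)
  assume a: "extremal_affine L \<and> open U \<and> smooth_on U f \<and> f ` U \<subseteq> L \<and> nondegenerate_in L f U"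
  then obtain y and T :: "real^'n \<Rightarrow> real^'n" where T: "L = (\<lambda>x. y + T x) ` UNIV" "AE x in lborel. \<not> VWA (y + T x)"
    unfolding extremal_affine_def by blast
  \<comment> \<open>One point of \<open>L\<close> that is not very well approximable is what
    \<open>nondegenerate_extremal\<close> asks for, and a set of full measure is not empty.\<close>
  have "\<exists>x. \<not> VWA (y + T x)"
  proof (rule ccontr)
    assume "\<not> ?thesis"
    then have "AE x in (lborel :: (real^'n) measure). False" using T(2) by simp
    then have "emeasure lborel (UNIV :: (real^'n) set) = 0"
      by (subst (asm) AE_iff_measurable[of UNIV]) auto
    then show False by simp
  qed
  then obtain x where "\<not> VWA (y + T x)" by blast
  moreover have "y + T x \<in> L" using T(1) by blast
  ultimately show "extremal_map f U" using nondegenerate_extremal[OF assms(1)] a by blast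
next
  fix y assume ne: "\<not> extremal_affine L" and y: "y \<in> L"
  show "VWA y"
  proof (rule ccontr)
    assume vwa: "\<not> VWA y"
    note lin = lin_part_eq[OF assms(1) y]
    \<comment> \<open>A single y that is not very well approximable makes the affine parametrisation
      through y an extremal map; T maps the whole space onto the linear part.\<close>
    obtain T :: "real^'n \<Rightarrow> real^'n" where T: "linear T" "range T = lin_part L"
      using linear_projection_exists[OF subspace_lin_part[OF assms(1) y]] by blast
    have LT: "L = (\<lambda>x. y + T x) ` UNIV"
    proof -
      have "(\<lambda>x. y + T x) ` UNIV = (+) y ` range T" by auto
      also have "\<dots> = L" unfolding T(2) lin by (auto simp: image_image)
      finally show ?thesis by simp
    qed
    have "nondegenerate_at L (\<lambda>x. y + T x) x" for x
      unfolding nondegenerate_at_def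
    \<comment> \<open>First derivatives suffice: they are the images of the coordinate vectors and
      span the range of T.\<close>
    proof (intro exI[of _ 1])
      have "{partial_iter (\<lambda>x. y + T x) is x | is. 1 \<le> length is \<and> length is \<le> 1} = T ` range (\<lambda>i. axis i 1)"
      proof -
        have "{is :: 'n list. 1 \<le> length is \<and> length is \<le> 1} = range (\<lambda>i. [i])"
        proof (intro set_eqI iffI)
          fix "is" :: "'n list" assume "is \<in> {is. 1 \<le> length is \<and> length is \<le> 1}"
          then show "is \<in> range (\<lambda>i. [i])" by (cases "is") auto
        qed auto
        then have "{partial_iter (\<lambda>x. y + T x) is x | is. 1 \<le> length is \<and> length is \<le> 1}
            = (\<lambda>is. partial_iter (\<lambda>x. y + T x) is x) ` range (\<lambda>i. [i])" by (simp only: setcompr_eq_image)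
        then show ?thesis by (simp add: partial_iter_affine[OF T(1)] image_image)
      qed
      also have "span \<dots> = T ` span (range (\<lambda>i. axis i 1))" by (rule linear_span_image[OF T(1)])
      also have "\<dots> = lin_part L" by (simp add: span_axis_UNIV T(2))
      finally show "span {partial_iter (\<lambda>x. y + T x) is x | is. 1 \<le> length is \<and> length is \<le> 1} = lin_part L" .
    qed
    then have "nondegenerate_in L (\<lambda>x. y + T x) UNIV" by (simp add: nondegenerate_in_def)
    then have "extremal_map (\<lambda>x. y + T x) UNIV"
      using LT by (intro nondegenerate_extremal[OF assms(1) y vwa] smooth_on_affine[OF T(1)]) auto
    then have "extremal_affine L"
      unfolding extremal_affine_def extremal_map_def using T(1) LT by auto
    then show False using ne by blast
  qed
qed

end
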